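(* Let $J$ be a subinterval of $\mathbb{R}$ and let $A\in\mathcal{G}[J\times\mathbb{R}^n,\mathbb{R}^n]$ be a Colombeau map of natural type with a representative $(A_\varepsilon)_\varepsilon$ such that $$\sup_{x\in\mathbb{R}^n}|A_\varepsilon(t,x)|\le\beta(t),\qquad \varepsilon\in\,]0,1],\ \text{for almost every } t\in J,$$ for some positive function $\beta\in L^1_{\rm loc}(J)$. If $(\widetilde t,\widetilde x)\in\widetilde{J\times\mathbb{R}^n}$ is a generalized point, then there exists a c-bounded solution $\xi\in\mathcal{G}(J)^n$ to the initial value problem $$\dot\xi(s)=A(s,\xi(s)),\qquad \xi(\widetilde t)=\widetilde x .$$ Furthermore, there exist some $(t,x)\in\overline J\times\mathbb{R}^n$ and $\zeta\in AC(J)^n$ such that for any representative $(\xi_\varepsilon)_\varepsilon$ of $\xi$ and any representative $(\widetilde t_\varepsilon,\widetilde x_\varepsilon)_\varepsilon$ of $(\widetilde t,\widetilde x)$ there exist subnets $(\widetilde t_{\tau(\varepsilon)},\widetilde x_{\tau(\varepsilon)})_\varepsilon$ and $(\xi_{\tau(\varepsilon)})_\varepsilon$ with $\tau\in\mathcal{T}$ and $$\lim_{\varepsilon\to0}(\widetilde t_{\tau(\varepsilon)},\widetilde x_{\tau(\varepsilon)})=(t,x)\quad\text{and}\quad \xi_{\tau(\varepsilon)}\to\zeta\ \ (\varepsilon\to0)\ \text{uniformly on compact subsets of } J .$$ The function $\zeta$ satisfies the integral inequality $$\langle\zeta(s),w\rangle\le\langle x,w\rangle+\int_t^s H_A(\tau,\zeta(\tau),w)\,d\tau$$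 for all $w\in\mathbb{R}^n$, where $(x,w)\mapsto H_A(t,x,w)$ denotes the supporting function of the generalized graph $\operatorname{Graph}(A(t,\cdot))$.
   Context: **Colombeau algebra.** For $\Omega\subseteq\mathbb{R}^d$ open, $\mathcal{E}_M(\Omega)$ is the set of nets $(u_\varepsilon)_{\varepsilon\in]0,1]}$ in $C^\infty(\Omega)$ such that for every compact $K\subset\Omega$ and $\alpha\in\mathbb{N}_0^d$ there is $p\in\mathbb{R}$ with $\sup_K|\partial^\alpha u_\varepsilon|=O(\varepsilon^{-p})$ as $\varepsilon\to0$. $\mathcal{N}(\Omega)$ is the ideal of those nets in $\mathcal{E}_M(\Omega)$ with $\sup_K|u_\varepsilon|=O(\varepsilon^q)$ for all compact $K$ and all $q$. $\mathcal{G}(\Omega)=\mathcal{E}_M(\Omega)/\mathcal{N}(\Omega)$; the same notation is used on $J$ and $J\times\mathbb{R}^n$. **Generalized points.** $\widetilde{J\times\mathbb{R}^n}$ is the set of classes of nets $(t_\varepsilon,x_\varepsilon)_{\varepsilon\in]0,1]}$ in $J\times\mathbb{R}^n$ that are moderate, i.e. $|(t_\varepsilon,x_\varepsilon)|=O(\varepsilon^{-p})$ for some $p$, modulo nets whose difference is $O(\varepsilon^q)$ for all $q$. **C-bounded maps.** $\mathcal{G}[\Omega_1,\Omega_2]$ is the set of generalized maps having a representative $(F_\varepsilon)_\varepsilon$ with $F_\varepsilon\in C^\infty(\Omega_1,\Omega_2)$ such that for every compact $K\subset\Omega_1$ there is a compact $K'\subset\Omega_2$ with $F_\varepsilon(K)\subseteq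 K'$ for all $\varepsilon\in]0,1]$; such maps are called c-bounded. Such an $F$ is of natural type if it has a representative such that $\varepsilon\mapsto F_\varepsilon(x)$ is continuous on $]0,1]$ for each fixed $x\in\Omega_1$. $A(s,\xi(s))$ is the class of $A_\varepsilon(s,\xi_\varepsilon(s))$, and $\xi(\widetilde t)$ is the class of $\xi_\varepsilon(\widetilde t_\varepsilon)$. **Subnets.** $\mathcal{T}$ is the set of maps $\tau:]0,1]\to]0,1]$ with $\lim_{\varepsilon\to0}\tau(\varepsilon)=0$; a subnet of $(\lambda_\varepsilon)_\varepsilon$ is a net $(\lambda_{\tau(\varepsilon)})_\varepsilon$ with $\tau\in\mathcal{T}$, and a cluster point is a limit of a subnet. $AC(J)$ denotes the absolutely continuous functions on $J$, in the local sense $AC(J)=W^{1,1}_{\rm loc}(J)$. **Generalized graph and supporting function.** For $F\in\mathcal{G}[\Omega_1,\Omega_2]$ with representative $(F_\varepsilon)_\varepsilon$, $\operatorname{Graph}(F)$ is the set of $(x,y)\in\Omega_1\times\Omega_2$ for which there are a net $(x_\varepsilon)_\varepsilon$ in $\Omega_1$ with $x_\varepsilon\to x$ and a map $\tau\in\mathcal{T}$ such that $y$ is a cluster point of $(F_{\tau(\varepsilon)}(x_\varepsilon))_\varepsilon$; put $\operatorname{Graph}(F)_x=\{y:(x,y)\in\operatorname{Graph}(F)\}$. Under the assumed bound, $A(t,\cdot)$ is a c-bounded Colombeau map on $\mathbb{R}^n$ for almost all $t\in J$, and for such $t$ one sets $H_A(t,x,w)=\sup_{a\in\operatorname{Graph}(A(t,\cdot))_x}\langle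 a,w\rangle$.
   Formalization: The generalized point is assumed compactly supported in J×R^n (otherwise ξ(t̃) is ill-defined or, e.g. for A=0, x̃=[1/ε], no c-bounded solution exists), and the integral inequality is claimed only for s ≥ t (it fails for s < t, e.g. A_ε=sin(t/ε)). *)

theory Defs
  imports "HOL-Analysis.Analysis" "HOL-Library.Landau_Symbols"
begin

text \<open>
  Nets are total functions of a real parameter, of which only the values on \<open>]0,1]\<close> matter;
  likewise, of a function on \<open>S\<close> only the values on \<open>S\<close> matter. The equivalence classes below
  identify nets that differ elsewhere, so the quotients are the usual ones.
\<close>

abbreviation params :: "real set" where
  "params \<equiv> {0<..1}"

text \<open>
  Partial derivatives are taken within \<open>S\<close>. For open \<open>S\<close> this is the ordinary partial derivative;
  for \<open>S = J\<close> or \<open>S = J \<times> \<real>\<^sup>n\<close> with a nondegenerate interval \<open>J\<close> that contains an end point,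
  it is the one-sided derivative there.
\<close>

definition partial_within ::
    "'a::euclidean_space set \<Rightarrow> 'a \<Rightarrow> ('a \<Rightarrow> 'b::real_normed_vector) \<Rightarrow> 'a \<Rightarrow> 'b" where
  "partial_within S b f x =
     vector_derivative (\<lambda>h. f (x + h *\<^sub>R b)) (at 0 within {h. x + h *\<^sub>R b \<in> S})"

text \<open>
  A multi-index is rendered as a list of standard basis vectors. Every ordering of the partial
  derivatives occurs, which is harmless because they commute on smooth functions.
\<close>

abbreviation partials_within ::
    "'a::euclidean_space set \<Rightarrow> 'a list \<Rightarrow> ('a \<Rightarrow> 'b::real_normed_vector) \<Rightarrow> 'a \<Rightarrow> 'b" where
  "partials_within S bs f \<equiv> foldr (partial_within S) bs f"

definition smooth_on :: "'a::euclidean_space set \<Rightarrow> ('a \<Rightarrow> 'b::real_normed_vector) \<Rightarrow> bool" where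
  "smooth_on S f \<longleftrightarrow>
     (\<forall>bs. set bs \<subseteq> Basis \<longrightarrow>
        continuous_on S (partials_within S bs f) \<and>
        (\<forall>b\<in>Basis. \<forall>x\<in>S. (\<lambda>h. partials_within S bs f (x + h *\<^sub>R b))
            differentiable (at 0 within {h. x + h *\<^sub>R b \<in> S})))"

text \<open>
  Vector-valued nets are treated directly, so that \<open>colombeau S\<close> at value type \<open>real ^ 'n\<close> is
  the \<open>n\<close>-fold product of the scalar algebra.
\<close>

definition moderate_nets ::
    "'a::euclidean_space set \<Rightarrow> (real \<Rightarrow> 'a \<Rightarrow> 'b::real_normed_vector) set" where
  "moderate_nets S =
     {u. (\<forall>\<epsilon>\<in>params. smooth_on S (u \<epsilon>)) \<and>
         (\<forall>K bs. compact K \<and> K \<subseteq> S \<and> K \<noteq> {} \<and> set bs \<subseteq> Basis \<longrightarrow>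
            (\<exists>p. (\<lambda>\<epsilon>. SUP x\<in>K. norm (partials_within S bs (u \<epsilon>) x))
                   \<in> O[at_right 0](\<lambda>\<epsilon>. \<epsilon> powr (- p))))}"

definition negligible_nets ::
    "'a::euclidean_space set \<Rightarrow> (real \<Rightarrow> 'a \<Rightarrow> 'b::real_normed_vector) set" where
  "negligible_nets S =
     {u \<in> moderate_nets S.
        \<forall>K q. compact K \<and> K \<subseteq> S \<and> K \<noteq> {} \<longrightarrow>
          (\<lambda>\<epsilon>. SUP x\<in>K. norm (u \<epsilon> x)) \<in> O[at_right 0](\<lambda>\<epsilon>. \<epsilon> powr q)}"

definition net_equiv :: "'a::euclidean_space set \<Rightarrow>
    ((real \<Rightarrow> 'a \<Rightarrow> 'b::real_normed_vector) \<times> (real \<Rightarrow> 'a \<Rightarrow> 'b)) set" where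
  "net_equiv S =
     {(u, v). u \<in> moderate_nets S \<and> v \<in> moderate_nets S \<and>
              (\<lambda>\<epsilon> x. u \<epsilon> x - v \<epsilon> x) \<in> negligible_nets S}"

definition colombeau ::
    "'a::euclidean_space set \<Rightarrow> (real \<Rightarrow> 'a \<Rightarrow> 'b::real_normed_vector) set set" where
  "colombeau S = moderate_nets S // net_equiv S"

definition net_class :: "'a::euclidean_space set \<Rightarrow>
    (real \<Rightarrow> 'a \<Rightarrow> 'b::real_normed_vector) \<Rightarrow> (real \<Rightarrow> 'a \<Rightarrow> 'b) set" where
  "net_class S u = net_equiv S `` {u}"

definition moderate_points :: "'a::real_normed_vector set \<Rightarrow> (real \<Rightarrow> 'a) set" where
  "moderate_points S =
     {p. (\<forall>\<epsilon>\<in>params. p \<epsilon> \<in> S) \<and>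
         (\<exists>N. (\<lambda>\<epsilon>. norm (p \<epsilon>)) \<in> O[at_right 0](\<lambda>\<epsilon>. \<epsilon> powr (- N)))}"

definition point_equiv ::
    "'a::real_normed_vector set \<Rightarrow> ((real \<Rightarrow> 'a) \<times> (real \<Rightarrow> 'a)) set" where
  "point_equiv S =
     {(p, r). p \<in> moderate_points S \<and> r \<in> moderate_points S \<and>
              (\<forall>q. (\<lambda>\<epsilon>. norm (p \<epsilon> - r \<epsilon>)) \<in> O[at_right 0](\<lambda>\<epsilon>. \<epsilon> powr q))}"

definition gen_points :: "'a::real_normed_vector set \<Rightarrow> (real \<Rightarrow> 'a) set set" where
  "gen_points S = moderate_points S // point_equiv S"

definition point_class :: "'a::real_normed_vector set \<Rightarrow> (real \<Rightarrow> 'a) \<Rightarrow> (real \<Rightarrow> 'a) set" where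
  "point_class S p = point_equiv S `` {p}"

text \<open>
  The value of a generalized function at a generalized point is independent of the representatives
  only when the point is compactly supported in the domain.
\<close>

definition compactly_supported :: "'a::real_normed_vector set \<Rightarrow> (real \<Rightarrow> 'a) set \<Rightarrow> bool" where
  "compactly_supported S P \<longleftrightarrow>
     (\<exists>p\<in>P. \<exists>K. compact K \<and> K \<subseteq> S \<and> (\<forall>\<^sub>F \<epsilon> in at_right 0. p \<epsilon> \<in> K))"

definition gen_fst :: "'a::real_normed_vector set \<Rightarrow>
    (real \<Rightarrow> 'a \<times> 'b::real_normed_vector) set \<Rightarrow> (real \<Rightarrow> 'a) set" where
  "gen_fst S P = (\<Union>p\<in>P. point_class S (\<lambda>\<epsilon>. fst (p \<epsilon>)))"

definition gen_snd :: "'b::real_normed_vector set \<Rightarrow>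
    (real \<Rightarrow> 'a::real_normed_vector \<times> 'b) set \<Rightarrow> (real \<Rightarrow> 'b) set" where
  "gen_snd T P = (\<Union>p\<in>P. point_class T (\<lambda>\<epsilon>. snd (p \<epsilon>)))"

definition c_bounded_net :: "'a::euclidean_space set \<Rightarrow> 'b::real_normed_vector set \<Rightarrow>
    (real \<Rightarrow> 'a \<Rightarrow> 'b) \<Rightarrow> bool" where
  "c_bounded_net S T f \<longleftrightarrow>
     (\<forall>\<epsilon>\<in>params. smooth_on S (f \<epsilon>) \<and> f \<epsilon> ` S \<subseteq> T) \<and>
     (\<forall>K. compact K \<and> K \<subseteq> S \<longrightarrow>
        (\<exists>K'. compact K' \<and> K' \<subseteq> T \<and> (\<forall>\<epsilon>\<in>params. f \<epsilon> ` K \<subseteq> K')))"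

definition c_bounded_maps :: "'a::euclidean_space set \<Rightarrow> 'b::real_normed_vector set \<Rightarrow>
    (real \<Rightarrow> 'a \<Rightarrow> 'b) set set" where
  "c_bounded_maps S T = {F \<in> colombeau S. \<exists>f\<in>F. c_bounded_net S T f}"

definition natural_type :: "'a::euclidean_space set \<Rightarrow>
    (real \<Rightarrow> 'a \<Rightarrow> 'b::real_normed_vector) set \<Rightarrow> bool" where
  "natural_type S F \<longleftrightarrow> (\<exists>f\<in>F. \<forall>x\<in>S. continuous_on params (\<lambda>\<epsilon>. f \<epsilon> x))"

text \<open>
  An operation on classes is the union, over all representatives, of the class of the resulting
  net. Where the operation is independent of the representatives, this is that common class.
\<close>

definition gen_deriv :: "real set \<Rightarrow> (real \<Rightarrow> real \<Rightarrow> 'b::real_normed_vector) set \<Rightarrow>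
    (real \<Rightarrow> real \<Rightarrow> 'b) set" where
  "gen_deriv J \<xi> = (\<Union>u\<in>\<xi>. net_class J (\<lambda>\<epsilon> s. vector_derivative (u \<epsilon>) (at s within J)))"

definition gen_along :: "real set \<Rightarrow> (real \<Rightarrow> real \<times> 'b \<Rightarrow> 'b) set \<Rightarrow>
    (real \<Rightarrow> real \<Rightarrow> 'b::real_normed_vector) set \<Rightarrow> (real \<Rightarrow> real \<Rightarrow> 'b) set" where
  "gen_along J A \<xi> = (\<Union>a\<in>A. \<Union>u\<in>\<xi>. net_class J (\<lambda>\<epsilon> s. a \<epsilon> (s, u \<epsilon> s)))"

definition gen_slice :: "(real \<Rightarrow> real \<times> 'a \<Rightarrow> 'b) set \<Rightarrow> real \<Rightarrow>
    (real \<Rightarrow> 'a::euclidean_space \<Rightarrow> 'b::real_normed_vector) set" where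
  "gen_slice A t = (\<Union>a\<in>A. net_class UNIV (\<lambda>\<epsilon> x. a \<epsilon> (t, x)))"

definition gen_value :: "'b set \<Rightarrow> (real \<Rightarrow> 'a \<Rightarrow> 'b::real_normed_vector) set \<Rightarrow>
    (real \<Rightarrow> 'a) set \<Rightarrow> (real \<Rightarrow> 'b) set" where
  "gen_value T \<xi> P = (\<Union>u\<in>\<xi>. \<Union>p\<in>P. point_class T (\<lambda>\<epsilon>. u \<epsilon> (p \<epsilon>)))"

definition subnet_maps :: "(real \<Rightarrow> real) set" where
  "subnet_maps = {\<tau>. \<tau> ` params \<subseteq> params \<and> (\<tau> \<longlongrightarrow> 0) (at_right 0)}"

definition cluster_point :: "(real \<Rightarrow> 'b::topological_space) \<Rightarrow> 'b \<Rightarrow> bool" where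
  "cluster_point v y \<longleftrightarrow> (\<exists>\<sigma>\<in>subnet_maps. ((\<lambda>\<epsilon>. v (\<sigma> \<epsilon>)) \<longlongrightarrow> y) (at_right 0))"

definition net_graph :: "'a::topological_space set \<Rightarrow> 'b::topological_space set \<Rightarrow>
    (real \<Rightarrow> 'a \<Rightarrow> 'b) \<Rightarrow> ('a \<times> 'b) set" where
  "net_graph S T f =
     {(x, y). x \<in> S \<and> y \<in> T \<and>
        (\<exists>xs. \<exists>\<tau>\<in>subnet_maps. (\<forall>\<epsilon>\<in>params. xs \<epsilon> \<in> S) \<and> (xs \<longlongrightarrow> x) (at_right 0) \<and>
           cluster_point (\<lambda>\<epsilon>. f (\<tau> \<epsilon>) (xs \<epsilon>)) y)}"

definition gen_graph :: "'a::topological_space set \<Rightarrow> 'b::topological_space set \<Rightarrow>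
    (real \<Rightarrow> 'a \<Rightarrow> 'b) set \<Rightarrow> ('a \<times> 'b) set" where
  "gen_graph S T F = (\<Union>f\<in>F. net_graph S T f)"

definition supporting_function :: "(real \<Rightarrow> real \<times> 'a \<Rightarrow> 'a::euclidean_space) set \<Rightarrow>
    real \<Rightarrow> 'a \<Rightarrow> 'a \<Rightarrow> real" where
  "supporting_function A t x w = (SUP a\<in>gen_graph UNIV UNIV (gen_slice A t) `` {x}. a \<bullet> w)"

definition locally_integrable_on :: "(real \<Rightarrow> real) \<Rightarrow> real set \<Rightarrow> bool" where
  "locally_integrable_on \<beta> J \<longleftrightarrow>
     (\<forall>K. compact K \<and> K \<subseteq> J \<longrightarrow> \<beta> absolutely_integrable_on K)"

definition locally_absolutely_continuous_on ::
    "(real \<Rightarrow> 'b::real_normed_vector) \<Rightarrow> real set \<Rightarrow> bool" where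
  "locally_absolutely_continuous_on z J \<longleftrightarrow>
     (\<forall>a b. a \<le> b \<and> {a..b} \<subseteq> J \<longrightarrow>
        (\<forall>e>0. \<exists>d>0. \<forall>(n::nat) l r.
           (\<forall>i<n. a \<le> l i \<and> l i \<le> r i \<and> r i \<le> b) \<and>
           disjoint_family_on (\<lambda>i. {l i<..<r i}) {..<n} \<and> (\<Sum>i<n. r i - l i) < d \<longrightarrow>
           (\<Sum>i<n. norm (z (r i) - z (l i))) < e))"

end

theory Submission
  imports Defs "HOL-Complex_Analysis.Great_Picard"
begin

text \<open>
For each fixed \<open>\<epsilon>\<close> the problem is an ordinary differential equation with a smooth right-hand side
that at almost every time is dominated by the locally integrable function \<open>\<beta>\<close>. Picard iteration started at the constant
\<open>x\<^sub>0\<close> stays, on every compact interval, within distance \<open>\<integral>\<beta>\<close> of \<open>x\<^sub>0\<close>, where the right-hand side is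
Lipschitz, and so it converges on all of \<open>J\<close> at once (\<open>global_solution_exists\<close>). The same integral
bounds the solutions uniformly in \<open>\<epsilon>\<close>, and the equation itself then bounds their derivatives:
each derivative of a solution is a polynomial in derivatives of the field along the solution and in
lower derivatives of the solution (\<open>moderate_upto_solution\<close>). Hence the solutions form a c-bounded
moderate net.

That the class of this net solves the generalized problem is a statement about all
representatives. The right-hand side is handled by a Lipschitz estimate with a moderate constant.
The derivative of a negligible moderate net must be shown to be negligible again; this is
Landau's interpolation between a function and its second derivative (\<open>negligible_derivative\<close>).

The solutions are equicontinuous on compact intervals with modulus \<open>\<integral>\<beta>\<close>, so a sequence of parameters
along which the initial points converge has a subsequence along which the solutions converge
locally uniformly (\<open>locally_uniform_subsequence\<close>). Since the field is c-bounded, the solutions are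
even locally Lipschitz with a constant that does not depend on small \<open>\<epsilon>\<close>, and so is the limit \<open>\<zeta>\<close>.

Along the subsequence the velocities accumulate only in the generalized graph of the field
over \<open>\<zeta>\<close>. Their components in direction \<open>w\<close> therefore exceed the supporting function only
by amounts that tend to zero, and dominated convergence gives the integral inequality
(\<open>limit_integral_inequality\<close>). The supporting function along \<open>\<zeta>\<close> is measurable because it is the
limit of suprema over shrinking sets of parameters and displacements, and each of these
suprema is lower semicontinuous in time (\<open>envelope_measurable\<close>).
\<close>

section \<open>Moderate and negligible nets as pointwise bounds\<close>

lemma eventually_params: "\<forall>\<^sub>F \<epsilon> in at_right 0. \<epsilon> \<in> params"
  unfolding eventually_at_right_field by (intro exI[of _ 1]) auto

text \<open>
A power of \<open>\<epsilon>\<close> absorbs any constant at the price of an arbitrarily small loss in the exponent.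
Moderateness and negligibility can therefore be expressed by bounds without constants.
\<close>

lemma eventually_mult_powr_le:
  fixes c p q :: real
  assumes "q < p"
  shows "\<forall>\<^sub>F \<epsilon> in at_right 0. c * \<epsilon> powr p \<le> \<epsilon> powr q"
proof -
  have "((\<lambda>\<epsilon>::real. \<epsilon> powr (p - q)) \<longlongrightarrow> 0 powr (p - q)) (at_right 0)"
    using assms by (intro tendsto_powr' tendsto_intros) (auto intro: eventually_mono[OF eventually_at_right_less])
  then have "((\<lambda>\<epsilon>. c * \<epsilon> powr (p - q)) \<longlongrightarrow> 0) (at_right 0)"
    using tendsto_mult_right_zero by force
  then have "\<forall>\<^sub>F \<epsilon> in at_right 0. c * \<epsilon> powr (p - q) < 1"
    by (rule order_tendstoD) auto
  then show ?thesis
  proof (eventually_elim)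
    case (elim \<epsilon>)
    then have "(c * \<epsilon> powr (p - q)) * \<epsilon> powr q \<le> 1 * \<epsilon> powr q"
      by (intro mult_right_mono) auto
    then show ?case by (simp add: mult.assoc flip: powr_add)
  qed
qed

lemma eventually_powr_mono:
  fixes p q :: real
  assumes "q \<le> p"
  shows "\<forall>\<^sub>F \<epsilon> in at_right 0. \<epsilon> powr p \<le> \<epsilon> powr q"
  using eventually_params by eventually_elim (use assms in \<open>auto intro: powr_mono'\<close>)

lemma bigo_powr_eventually_le:
  fixes r :: "real \<Rightarrow> real"
  assumes "r \<in> O[at_right 0](\<lambda>\<epsilon>. \<epsilon> powr p)" "q < p"
  shows "\<forall>\<^sub>F \<epsilon> in at_right 0. \<bar>r \<epsilon>\<bar> \<le> \<epsilon> powr q"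
proof -
  obtain c where c: "\<forall>\<^sub>F \<epsilon> in at_right 0. norm (r \<epsilon>) \<le> c * norm (\<epsilon> powr p)"
    using assms(1) by (rule landau_o.bigE)
  show ?thesis
    using c eventually_mult_powr_le[OF assms(2), of c] by eventually_elim auto
qed

lemma eventually_le_powr_imp_bigo:
  fixes r :: "real \<Rightarrow> real"
  assumes "\<forall>\<^sub>F \<epsilon> in at_right 0. \<bar>r \<epsilon>\<bar> \<le> \<epsilon> powr q"
  shows "r \<in> O[at_right 0](\<lambda>\<epsilon>. \<epsilon> powr q)"
  by (rule bigoI[where c = 1]) (use assms in \<open>auto elim!: eventually_mono\<close>)

text \<open>
Pointwise bounds without supremum and without constant: they restrict to smaller sets and
combine under sums, products and compositions without side conditions on the suprema.
\<close>

definition locally_moderate ::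
    "'a::metric_space set \<Rightarrow> (real \<Rightarrow> 'a \<Rightarrow> 'b::real_normed_vector) \<Rightarrow> bool" where
  "locally_moderate S u \<longleftrightarrow> (\<forall>K. compact K \<and> K \<subseteq> S \<longrightarrow>
     (\<exists>p. \<forall>\<^sub>F \<epsilon> in at_right 0. \<forall>x\<in>K. norm (u \<epsilon> x) \<le> \<epsilon> powr (- p)))"

definition locally_negligible ::
    "'a::metric_space set \<Rightarrow> (real \<Rightarrow> 'a \<Rightarrow> 'b::real_normed_vector) \<Rightarrow> bool" where
  "locally_negligible S u \<longleftrightarrow> (\<forall>K q. compact K \<and> K \<subseteq> S \<longrightarrow>
     (\<forall>\<^sub>F \<epsilon> in at_right 0. \<forall>x\<in>K. norm (u \<epsilon> x) \<le> \<epsilon> powr q))"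

lemma norm_le_SUP_compact:
  fixes f :: "'a::metric_space \<Rightarrow> 'b::real_normed_vector"
  assumes "compact K" "continuous_on K f" "x \<in> K"
  shows "norm (f x) \<le> (SUP x\<in>K. norm (f x))"
proof -
  have "compact ((\<lambda>x. norm (f x)) ` K)"
    using assms by (intro compact_continuous_image continuous_intros)
  then show ?thesis
    by (intro cSUP_upper[OF assms(3)] bounded_imp_bdd_above compact_imp_bounded)
qed

lemma smooth_on_continuous:
  assumes "smooth_on S f" "set bs \<subseteq> Basis"
  shows "continuous_on S (partials_within S bs f)"
  using assms by (auto simp: smooth_on_def)

lemma moderate_imp_locally_moderate:
  assumes u: "u \<in> moderate_nets S" and bs: "set bs \<subseteq> Basis"
  shows "locally_moderate S (\<lambda>\<epsilon>. partials_within S bs (u \<epsilon>))"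
  unfolding locally_moderate_def
proof (intro allI impI)
  fix K assume K: "compact K \<and> K \<subseteq> S"
  show "\<exists>p. \<forall>\<^sub>F \<epsilon> in at_right 0. \<forall>x\<in>K. norm (partials_within S bs (u \<epsilon>) x) \<le> \<epsilon> powr (- p)"
  proof (cases "K = {}")
    case False
    then obtain p where
      "(\<lambda>\<epsilon>. SUP x\<in>K. norm (partials_within S bs (u \<epsilon>) x)) \<in> O[at_right 0](\<lambda>\<epsilon>. \<epsilon> powr (- p))"
      using u K bs unfolding moderate_nets_def by blast
    then have "\<forall>\<^sub>F \<epsilon> in at_right 0.
        \<bar>SUP x\<in>K. norm (partials_within S bs (u \<epsilon>) x)\<bar> \<le> \<epsilon> powr (- (p + 1))"
      by (rule bigo_powr_eventually_le) auto
    then have "\<forall>\<^sub>F \<epsilon> in at_right 0. \<forall>x\<in>K. norm (partials_within S bs (u \<epsilon>) x) \<le> \<epsilon> powr (- (p + 1))"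
      using eventually_params
    proof eventually_elim
      case (elim \<epsilon>)
      have "smooth_on S (u \<epsilon>)" using u elim(2) by (auto simp: moderate_nets_def)
      then have "continuous_on K (partials_within S bs (u \<epsilon>))"
        using smooth_on_continuous[OF _ bs] K continuous_on_subset by blast
      then show ?case
        using norm_le_SUP_compact[of K] K elim(1) by fastforce
    qed
    then show ?thesis by blast
  qed auto
qed

lemma abs_SUP_norm_le:
  assumes "K \<noteq> {}" "\<And>x. x \<in> K \<Longrightarrow> norm (f x) \<le> c"
  shows "\<bar>SUP x\<in>K. norm (f x)\<bar> \<le> c"
proof -
  have "(SUP x\<in>K. norm (f x)) \<le> c" using assms by (intro cSUP_least)
  moreover obtain x where x: "x \<in> K" using assms(1) by blast
  have "norm (f x) \<le> (SUP x\<in>K. norm (f x))"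
    by (intro cSUP_upper x bdd_aboveI2[of _ _ c] assms)
  then have "0 \<le> (SUP x\<in>K. norm (f x))" using norm_ge_zero order_trans by blast
  ultimately show ?thesis by simp
qed

lemma moderate_netsI:
  assumes "\<And>\<epsilon>. \<epsilon> \<in> params \<Longrightarrow> smooth_on S (u \<epsilon>)"
    and "\<And>bs. set bs \<subseteq> Basis \<Longrightarrow> locally_moderate S (\<lambda>\<epsilon>. partials_within S bs (u \<epsilon>))"
  shows "u \<in> moderate_nets S"
  unfolding moderate_nets_def
proof (intro CollectI conjI ballI allI impI assms(1))
  fix K bs assume K: "compact K \<and> K \<subseteq> S \<and> K \<noteq> {} \<and> set bs \<subseteq> (Basis::'a set)"
  then obtain p where "\<forall>\<^sub>F \<epsilon> in at_right 0. \<forall>x\<in>K. norm (partials_within S bs (u \<epsilon>) x) \<le> \<epsilon> powr (- p)"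
    using assms(2)[of bs] unfolding locally_moderate_def by blast
  then have "\<forall>\<^sub>F \<epsilon> in at_right 0.
        \<bar>SUP x\<in>K. norm (partials_within S bs (u \<epsilon>) x)\<bar> \<le> \<epsilon> powr (- p)"
    by eventually_elim (use K in \<open>auto intro: abs_SUP_norm_le\<close>)
  then show "\<exists>p. (\<lambda>\<epsilon>. SUP x\<in>K. norm (partials_within S bs (u \<epsilon>) x)) \<in> O[at_right 0](\<lambda>\<epsilon>. \<epsilon> powr (- p))"
    by (intro exI[of _ p] eventually_le_powr_imp_bigo)
qed auto

lemma negligible_nets_iff:
  "u \<in> negligible_nets S \<longleftrightarrow> u \<in> moderate_nets S \<and> locally_negligible S u"
proof (intro iffI conjI)
  assume u: "u \<in> negligible_nets S"
  then show mod: "u \<in> moderate_nets S" by (simp add: negligible_nets_def)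
  show "locally_negligible S u"
    unfolding locally_negligible_def
  proof (intro allI impI)
    fix K q assume K: "compact K \<and> K \<subseteq> S"
    show "\<forall>\<^sub>F \<epsilon> in at_right 0. \<forall>x\<in>K. norm (u \<epsilon> x) \<le> \<epsilon> powr q"
    proof (cases "K = {}")
      case False
      then have "(\<lambda>\<epsilon>. SUP x\<in>K. norm (u \<epsilon> x)) \<in> O[at_right 0](\<lambda>\<epsilon>. \<epsilon> powr (q + 1))"
        using u K unfolding negligible_nets_def by blast
      then have "\<forall>\<^sub>F \<epsilon> in at_right 0. \<bar>SUP x\<in>K. norm (u \<epsilon> x)\<bar> \<le> \<epsilon> powr q"
        by (rule bigo_powr_eventually_le) auto
      then show ?thesis
        using eventually_params
      proof eventually_elim
        case (elim \<epsilon>)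
        have "smooth_on S (u \<epsilon>)" using mod elim(2) by (auto simp: moderate_nets_def)
        then have "continuous_on K (u \<epsilon>)"
          using smooth_on_continuous[of S _ "[]"] K by (auto intro: continuous_on_subset)
        then show ?case
          using norm_le_SUP_compact[of K] K elim(1) by fastforce
      qed
    qed auto
  qed
next
  assume u: "u \<in> moderate_nets S \<and> locally_negligible S u"
  show "u \<in> negligible_nets S"
    unfolding negligible_nets_def
  proof (intro CollectI conjI allI impI)
    fix K q assume K: "compact K \<and> K \<subseteq> S \<and> K \<noteq> {}"
    then have "\<forall>\<^sub>F \<epsilon> in at_right 0. \<forall>x\<in>K. norm (u \<epsilon> x) \<le> \<epsilon> powr q"
      using u unfolding locally_negligible_def by blast
    then have "\<forall>\<^sub>F \<epsilon> in at_right 0. \<bar>SUP x\<in>K. norm (u \<epsilon> x)\<bar> \<le> \<epsilon> powr q"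
      by eventually_elim (use K in \<open>auto intro: abs_SUP_norm_le\<close>)
    then show "(\<lambda>\<epsilon>. SUP x\<in>K. norm (u \<epsilon> x)) \<in> O[at_right 0](\<lambda>\<epsilon>. \<epsilon> powr q)"
      by (rule eventually_le_powr_imp_bigo)
  qed (use u in auto)
qed

lemma eventually_sum_le_powr:
  fixes p q r :: real and f g :: "real \<Rightarrow> real"
  assumes "\<forall>\<^sub>F \<epsilon> in at_right 0. f \<epsilon> \<le> \<epsilon> powr p" "\<forall>\<^sub>F \<epsilon> in at_right 0. g \<epsilon> \<le> \<epsilon> powr q"
    and "r < p" "r < q"
  shows "\<forall>\<^sub>F \<epsilon> in at_right 0. f \<epsilon> + g \<epsilon> \<le> \<epsilon> powr r"
  using assms(1,2) eventually_mult_powr_le[OF assms(3), of 2] eventually_mult_powr_le[OF assms(4), of 2]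
  by eventually_elim linarith

lemma locally_moderate_add:
  assumes "locally_moderate S u" "locally_moderate S v"
  shows "locally_moderate S (\<lambda>\<epsilon> x. u \<epsilon> x + v \<epsilon> x)"
  unfolding locally_moderate_def
proof (intro allI impI)
  fix K assume K: "compact K \<and> K \<subseteq> S"
  obtain p where p: "\<forall>\<^sub>F \<epsilon> in at_right 0. \<forall>x\<in>K. norm (u \<epsilon> x) \<le> \<epsilon> powr (- p)"
    using assms K unfolding locally_moderate_def by blast
  obtain q where q: "\<forall>\<^sub>F \<epsilon> in at_right 0. \<forall>x\<in>K. norm (v \<epsilon> x) \<le> \<epsilon> powr (- q)"
    using assms K unfolding locally_moderate_def by blast
  have "\<forall>\<^sub>F \<epsilon> in at_right 0. \<epsilon> powr (- p) + \<epsilon> powr (- q) \<le> \<epsilon> powr (- (max p q + 1))"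
    by (rule eventually_sum_le_powr[of _ "- p" _ "- q"]) auto
  then have "\<forall>\<^sub>F \<epsilon> in at_right 0. \<forall>x\<in>K. norm (u \<epsilon> x + v \<epsilon> x) \<le> \<epsilon> powr (- (max p q + 1))"
    using p q by eventually_elim (force intro: norm_triangle_le)
  then show "\<exists>p. \<forall>\<^sub>F \<epsilon> in at_right 0. \<forall>x\<in>K. norm (u \<epsilon> x + v \<epsilon> x) \<le> \<epsilon> powr (- p)"
    by blast
qed

lemma locally_moderate_scaleR:
  fixes u :: "real \<Rightarrow> 'a::metric_space \<Rightarrow> real" and v :: "real \<Rightarrow> 'a \<Rightarrow> 'b::real_normed_vector"
  assumes "locally_moderate S u" "locally_moderate S v"
  shows "locally_moderate S (\<lambda>\<epsilon> x. u \<epsilon> x *\<^sub>R v \<epsilon> x)"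
  unfolding locally_moderate_def
proof (intro allI impI)
  fix K assume K: "compact K \<and> K \<subseteq> S"
  obtain p where p: "\<forall>\<^sub>F \<epsilon> in at_right 0. \<forall>x\<in>K. norm (u \<epsilon> x) \<le> \<epsilon> powr (- p)"
    using assms K unfolding locally_moderate_def by blast
  obtain q where q: "\<forall>\<^sub>F \<epsilon> in at_right 0. \<forall>x\<in>K. norm (v \<epsilon> x) \<le> \<epsilon> powr (- q)"
    using assms K unfolding locally_moderate_def by blast
  have "\<forall>\<^sub>F \<epsilon> in at_right 0. \<forall>x\<in>K. norm (u \<epsilon> x *\<^sub>R v \<epsilon> x) \<le> \<epsilon> powr (- (p + q))"
    using p q
  proof eventually_elim
    case (elim \<epsilon>)
    show ?case
    proof
      fix x assume "x \<in> K"
      then have "norm (u \<epsilon> x) * norm (v \<epsilon> x) \<le> \<epsilon> powr (- p) * \<epsilon> powr (- q)"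
        using elim by (intro mult_mono) auto
      then show "norm (u \<epsilon> x *\<^sub>R v \<epsilon> x) \<le> \<epsilon> powr (- (p + q))"
        by (simp flip: powr_add)
    qed
  qed
  then show "\<exists>p. \<forall>\<^sub>F \<epsilon> in at_right 0. \<forall>x\<in>K. norm (u \<epsilon> x *\<^sub>R v \<epsilon> x) \<le> \<epsilon> powr (- p)"
    by blast
qed

lemma locally_moderate_mono:
  assumes "locally_moderate S u" "\<And>\<epsilon> x. \<epsilon> \<in> params \<Longrightarrow> x \<in> S \<Longrightarrow> norm (v \<epsilon> x) \<le> norm (u \<epsilon> x)"
  shows "locally_moderate S v"
  unfolding locally_moderate_def
proof (intro allI impI)
  fix K assume K: "compact K \<and> K \<subseteq> S"
  obtain p where p: "\<forall>\<^sub>F \<epsilon> in at_right 0. \<forall>x\<in>K. norm (u \<epsilon> x) \<le> \<epsilon> powr (- p)"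
    using assms K unfolding locally_moderate_def by blast
  then have "\<forall>\<^sub>F \<epsilon> in at_right 0. \<forall>x\<in>K. norm (v \<epsilon> x) \<le> \<epsilon> powr (- p)"
    using eventually_params by eventually_elim (use K in \<open>auto intro: order_trans[OF assms(2)]\<close>)
  then show "\<exists>p. \<forall>\<^sub>F \<epsilon> in at_right 0. \<forall>x\<in>K. norm (v \<epsilon> x) \<le> \<epsilon> powr (- p)"
    by blast
qed

lemma locally_negligible_add:
  assumes "locally_negligible S u" "locally_negligible S v"
  shows "locally_negligible S (\<lambda>\<epsilon> x. u \<epsilon> x + v \<epsilon> x)"
  unfolding locally_negligible_def
proof (intro allI impI)
  fix K and q :: real assume K: "compact K \<and> K \<subseteq> S"
  have "\<forall>\<^sub>F \<epsilon> in at_right 0. \<epsilon> powr (q + 1) + \<epsilon> powr (q + 1) \<le> \<epsilon> powr q"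
    by (rule eventually_sum_le_powr[of _ "q + 1" _ "q + 1"]) auto
  moreover have "\<forall>\<^sub>F \<epsilon> in at_right 0. \<forall>x\<in>K. norm (u \<epsilon> x) \<le> \<epsilon> powr (q + 1)"
    using assms K unfolding locally_negligible_def by blast
  moreover have "\<forall>\<^sub>F \<epsilon> in at_right 0. \<forall>x\<in>K. norm (v \<epsilon> x) \<le> \<epsilon> powr (q + 1)"
    using assms K unfolding locally_negligible_def by blast
  ultimately show "\<forall>\<^sub>F \<epsilon> in at_right 0. \<forall>x\<in>K. norm (u \<epsilon> x + v \<epsilon> x) \<le> \<epsilon> powr q"
    by eventually_elim (force intro: norm_triangle_le)
qed

lemma locally_negligible_minus_commute:
  "locally_negligible S (\<lambda>\<epsilon> x. u \<epsilon> x - v \<epsilon> x) \<longleftrightarrow> locally_negligible S (\<lambda>\<epsilon> x. v \<epsilon> x - u \<epsilon> x)"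
  unfolding locally_negligible_def by (simp add: norm_minus_commute)

lemma locally_negligible_trans:
  assumes "locally_negligible S (\<lambda>\<epsilon> x. u \<epsilon> x - v \<epsilon> x)" "locally_negligible S (\<lambda>\<epsilon> x. v \<epsilon> x - w \<epsilon> x)"
  shows "locally_negligible S (\<lambda>\<epsilon> x. u \<epsilon> x - w \<epsilon> x)"
  using locally_negligible_add[OF assms] by simp

section \<open>Differentiability from continuous partial derivatives\<close>

definition has_partials_on :: "'a::euclidean_space set \<Rightarrow> ('a \<Rightarrow> 'b::real_normed_vector) \<Rightarrow>
    ('a \<Rightarrow> 'a \<Rightarrow> 'b) \<Rightarrow> bool" where
  "has_partials_on S f D \<longleftrightarrow> (\<forall>b\<in>Basis. \<forall>x\<in>S.
     ((\<lambda>h. f (x + h *\<^sub>R b)) has_vector_derivative D b x) (at 0 within {h. x + h *\<^sub>R b \<in> S}))"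

lemma smooth_on_has_partials:
  fixes S :: "'a::euclidean_space set"
  assumes "smooth_on S f" "set bs \<subseteq> Basis"
  shows "has_partials_on S (partials_within S bs f) (\<lambda>b. partials_within S (b # bs) f)"
  unfolding has_partials_on_def
proof (intro ballI)
  fix b x :: 'a assume "b \<in> Basis" "x \<in> S"
  then have "(\<lambda>h. partials_within S bs f (x + h *\<^sub>R b)) differentiable
      (at 0 within {h. x + h *\<^sub>R b \<in> S})"
    using assms by (simp add: smooth_on_def)
  then show "((\<lambda>h. partials_within S bs f (x + h *\<^sub>R b)) has_vector_derivative
      partials_within S (b # bs) f x) (at 0 within {h. x + h *\<^sub>R b \<in> S})"
    by (simp add: partial_within_def vector_derivative_works)
qed

lemma has_partials_on_line:
  assumes "has_partials_on S f D" "b \<in> Basis" "y + \<theta> *\<^sub>R b \<in> S"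
  shows "((\<lambda>\<theta>. f (y + \<theta> *\<^sub>R b)) has_vector_derivative D b (y + \<theta> *\<^sub>R b))
           (at \<theta> within {\<theta>. y + \<theta> *\<^sub>R b \<in> S})"
proof -
  let ?T = "{\<theta>. y + \<theta> *\<^sub>R b \<in> S}" and ?T' = "{h. (y + \<theta> *\<^sub>R b) + h *\<^sub>R b \<in> S}"
  have img: "(\<lambda>t. t - \<theta>) ` ?T \<subseteq> ?T'"
    by (auto simp: algebra_simps)
  have "((\<lambda>h. f (y + \<theta> *\<^sub>R b + h *\<^sub>R b)) has_vector_derivative D b (y + \<theta> *\<^sub>R b)) (at (\<theta> - \<theta>) within ?T')"
    using assms by (simp add: has_partials_on_def)
  then have g: "((\<lambda>h. f (y + \<theta> *\<^sub>R b + h *\<^sub>R b)) has_vector_derivative D b (y + \<theta> *\<^sub>R b))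
      (at (\<theta> - \<theta>) within (\<lambda>t. t - \<theta>) ` ?T)"
    by (rule has_vector_derivative_within_subset[OF _ img])
  have "((\<lambda>t. t - \<theta>) has_vector_derivative 1) (at \<theta> within ?T)"
    by (auto intro!: derivative_eq_intros)
  from vector_diff_chain_within[OF this g] show ?thesis
    by (simp add: o_def algebra_simps)
qed

lemma closed_segment_0_real: "\<theta> \<in> closed_segment 0 (t::real) \<Longrightarrow> \<bar>\<theta>\<bar> \<le> \<bar>t\<bar> \<and> (0 \<le> \<theta> \<and> \<theta> \<le> t \<or> t \<le> \<theta> \<and> \<theta> \<le> 0)"
  by (auto simp: closed_segment_eq_real_ivl split: if_splits)

text \<open>
Walk from \<open>x\<close> to \<open>x + h\<close> one coordinate at a time and apply the mean value inequality on each leg.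
A multidimensional interval contains every corner of this path, which also covers time
intervals with end points, where the domain is not open. The choice \<open>c = 0\<close> gives a
Lipschitz estimate and \<open>c b = D b x\<close> the total derivative.
\<close>

lemma increment_along_coordinates:
  fixes S :: "'a::euclidean_space set" and f :: "'a \<Rightarrow> 'b::real_normed_vector"
  assumes S: "is_interval S" and D: "has_partials_on S f D"
    and x: "x \<in> S" "x + h \<in> S"
    and bound: "\<And>b z. \<lbrakk>b \<in> Basis; z \<in> S; norm (z - x) \<le> norm h\<rbrakk> \<Longrightarrow> norm (D b z - c b) \<le> e"
  shows "norm (f (x + h) - f x - (\<Sum>b\<in>Basis. (h \<bullet> b) *\<^sub>R c b)) \<le> e * (\<Sum>b\<in>Basis. \<bar>h \<bullet> b\<bar>)"
proof -
  \<comment> \<open>The displacement after the coordinates in \<open>B\<close> have been moved.\<close>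
  define k where "k B = (\<Sum>b\<in>B. (h \<bullet> b) *\<^sub>R b)" for B
  have k_inner: "k B \<bullet> i = (if i \<in> B then h \<bullet> i else 0)" if "i \<in> Basis" "B \<subseteq> Basis" for i B
  proof -
    have "k B \<bullet> i = (\<Sum>b\<in>B. (h \<bullet> b) * (if b = i then 1 else 0))"
      unfolding k_def inner_sum_left
      by (rule sum.cong) (use that in \<open>auto simp: inner_Basis\<close>)
    also have "\<dots> = (\<Sum>b\<in>B. (if b = i then h \<bullet> b else 0))"
      by (rule sum.cong) auto
    finally show ?thesis
      using finite_subset[OF that(2)] by simp
  qed
  have inS: "x + k B + \<theta> *\<^sub>R b \<in> S \<and> norm (x + k B + \<theta> *\<^sub>R b - x) \<le> norm h"
    if "insert b B \<subseteq> Basis" "b \<notin> B" "\<theta> \<in> closed_segment 0 (h \<bullet> b)" for b B \<theta>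
  proof -
    have coord: "(k B + \<theta> *\<^sub>R b) \<bullet> i = (if i \<in> B then h \<bullet> i else if i = b then \<theta> else 0)"
      if "i \<in> Basis" for i
      using that \<open>insert b B \<subseteq> Basis\<close> \<open>b \<notin> B\<close> by (auto simp: inner_add_left k_inner inner_Basis)
    note \<theta> = closed_segment_0_real[OF that(3)]
    have "x + (k B + \<theta> *\<^sub>R b) \<in> S"
      using S[unfolded is_interval_def, rule_format, OF x]
      by (rule meta_mp) (use \<theta> in \<open>auto simp: inner_add_left[of x] coord\<close>)
    moreover have "norm (k B + \<theta> *\<^sub>R b) \<le> norm h"
      by (rule norm_le_componentwise) (use \<theta> in \<open>auto simp: coord\<close>)
    ultimately show ?thesis by (simp add: add.assoc)
  qed
  have "norm (f (x + k B) - f x - (\<Sum>b\<in>B. (h \<bullet> b) *\<^sub>R c b)) \<le> e * (\<Sum>b\<in>B. \<bar>h \<bullet> b\<bar>)"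
    if "B \<subseteq> Basis" for B
    using finite_subset[OF that finite_Basis] that
  proof (induction B)
    case empty
    then show ?case by (simp add: k_def)
  next
    case (insert b B)
    let ?y = "x + k B" and ?t = "h \<bullet> b"
    let ?seg = "closed_segment 0 ?t"
    have b: "b \<in> Basis" using insert by simp
    have seg: "?y + \<theta> *\<^sub>R b \<in> S" "norm (?y + \<theta> *\<^sub>R b - x) \<le> norm h" if "\<theta> \<in> ?seg" for \<theta>
      using inS[OF insert(4,2) that] by auto
    have "norm ((f (?y + ?t *\<^sub>R b) - ?t *\<^sub>R c b) - (f (?y + 0 *\<^sub>R b) - 0 *\<^sub>R c b)) \<le> e * norm (?t - 0)"
    proof (rule differentiable_bound[where S = ?seg and f = "\<lambda>\<theta>. f (?y + \<theta> *\<^sub>R b) - \<theta> *\<^sub>R c b"])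
      fix \<theta> assume \<theta>: "\<theta> \<in> ?seg"
      have "((\<lambda>\<theta>. f (?y + \<theta> *\<^sub>R b)) has_vector_derivative D b (?y + \<theta> *\<^sub>R b)) (at \<theta> within ?seg)"
        by (rule has_vector_derivative_within_subset[OF has_partials_on_line[OF D b]])
          (use seg \<theta> in auto)
      then have "((\<lambda>\<theta>. f (?y + \<theta> *\<^sub>R b) - \<theta> *\<^sub>R c b) has_vector_derivative (D b (?y + \<theta> *\<^sub>R b) - c b))
          (at \<theta> within ?seg)"
        by (auto intro!: derivative_eq_intros)
      then show "((\<lambda>\<theta>. f (?y + \<theta> *\<^sub>R b) - \<theta> *\<^sub>R c b) has_derivative
          (\<lambda>t. t *\<^sub>R (D b (?y + \<theta> *\<^sub>R b) - c b))) (at \<theta> within ?seg)"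
        by (simp add: has_vector_derivative_def)
      have "norm (D b (?y + \<theta> *\<^sub>R b) - c b) \<le> e"
        using seg[OF \<theta>] b by (intro bound)
      then show "onorm (\<lambda>t. t *\<^sub>R (D b (?y + \<theta> *\<^sub>R b) - c b)) \<le> e"
        by (intro onorm_le) (simp add: mult.commute[of e] mult_left_mono)
    qed auto
    moreover have "x + k (insert b B) = ?y + ?t *\<^sub>R b"
      using insert by (simp add: k_def algebra_simps)
    ultimately have "norm (f (x + k (insert b B)) - f ?y - ?t *\<^sub>R c b) \<le> e * \<bar>?t\<bar>"
      by (simp add: algebra_simps)
    then have "norm ((f (x + k (insert b B)) - f ?y - ?t *\<^sub>R c b) +
        (f ?y - f x - (\<Sum>b\<in>B. (h \<bullet> b) *\<^sub>R c b))) \<le> e * \<bar>?t\<bar> + e * (\<Sum>b\<in>B. \<bar>h \<bullet> b\<bar>)"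
      by (intro norm_triangle_mono insert.IH) (use insert in auto)
    then show ?case
      using insert by (simp add: algebra_simps)
  qed
  from this[of Basis] show ?thesis
    by (simp add: k_def euclidean_representation del: sum_distrib_left)
qed

lemma sum_abs_inner_Basis_le: "(\<Sum>b\<in>Basis. \<bar>h \<bullet> b\<bar>) \<le> DIM('a) * norm (h::'a::euclidean_space)"
  using sum_bounded_above[of "Basis :: 'a set" "\<lambda>b. \<bar>h \<bullet> b\<bar>" "norm h"] by (simp add: Basis_le_norm)

lemma lipschitz_from_partials:
  fixes S :: "'a::euclidean_space set" and f :: "'a \<Rightarrow> 'b::real_normed_vector" and M :: real
  assumes S: "is_interval S" and D: "has_partials_on S f D"
    and x: "x \<in> S" "y \<in> S"
    and bound: "\<And>b z. \<lbrakk>b \<in> Basis; z \<in> S; norm (z - x) \<le> norm (y - x)\<rbrakk> \<Longrightarrow> norm (D b z) \<le> M"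
  shows "norm (f y - f x) \<le> DIM('a) * M * norm (y - x)"
proof -
  obtain b :: 'a where "b \<in> Basis" using SOME_Basis by blast
  then have "norm (D b x) \<le> M" using bound[of b x] x by simp
  then have M: "0 \<le> M" by (rule order_trans[OF norm_ge_zero])
  have "norm (f y - f x) \<le> M * (\<Sum>b\<in>Basis. \<bar>(y - x) \<bullet> b\<bar>)"
    using increment_along_coordinates[OF S D, of x "y - x" "\<lambda>_. 0" M] x bound by simp
  also have "\<dots> \<le> M * (DIM('a) * norm (y - x))"
    using M by (intro mult_left_mono sum_abs_inner_Basis_le)
  finally show ?thesis by (simp add: mult_ac)
qed

lemma has_derivative_from_partials:
  fixes S :: "'a::euclidean_space set" and f :: "'a \<Rightarrow> 'b::real_normed_vector"
  assumes S: "is_interval S" and D: "has_partials_on S f D"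
    and cont: "\<And>b. b \<in> Basis \<Longrightarrow> continuous_on S (D b)" and x: "x \<in> S"
  shows "(f has_derivative (\<lambda>h. \<Sum>b\<in>Basis. (h \<bullet> b) *\<^sub>R D b x)) (at x within S)"
  unfolding has_derivative_within_alt
proof (intro conjI allI impI)
  show "bounded_linear (\<lambda>h. \<Sum>b\<in>Basis. (h \<bullet> b) *\<^sub>R D b x)"
    by (intro bounded_linear_sum bounded_linear_scaleR_const bounded_linear_inner_left)
  fix e :: real assume e: "0 < e"
  let ?e = "e / DIM('a)"
  have "\<exists>d>0. \<forall>y\<in>S. norm (y - x) < d \<longrightarrow> norm (D b y - D b x) \<le> ?e" if b: "b \<in> Basis" for b
  proof -
    have "0 < ?e" using e by simp
    then obtain d where "d > 0" "\<forall>y\<in>S. dist y x < d \<longrightarrow> dist (D b y) (D b x) < ?e"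
      using cont[OF b] x unfolding continuous_on_iff by blast
    then show ?thesis by (metis dist_norm less_imp_le)
  qed
  then obtain d where d: "\<And>b. b \<in> Basis \<Longrightarrow> d b > 0"
    and dD: "\<And>b y. \<lbrakk>b \<in> Basis; y \<in> S; norm (y - x) < d b\<rbrakk> \<Longrightarrow> norm (D b y - D b x) \<le> ?e"
    by metis
  define d0 where "d0 = Min (d ` Basis)"
  have d0: "d0 > 0" "\<And>b. b \<in> Basis \<Longrightarrow> d0 \<le> d b"
    using d by (auto simp: d0_def)
  have "norm (f y - f x - (\<Sum>b\<in>Basis. ((y - x) \<bullet> b) *\<^sub>R D b x)) \<le> e * norm (y - x)"
    if "y \<in> S" "norm (y - x) < d0" for y
  proof -
    have "norm (f (x + (y - x)) - f x - (\<Sum>b\<in>Basis. ((y - x) \<bullet> b) *\<^sub>R D b x))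
        \<le> ?e * (\<Sum>b\<in>Basis. \<bar>(y - x) \<bullet> b\<bar>)"
    proof (rule increment_along_coordinates[OF S D x])
      show "norm (D b z - D b x) \<le> ?e" if "b \<in> Basis" "z \<in> S" "norm (z - x) \<le> norm (y - x)" for b z
        using that \<open>norm (y - x) < d0\<close> d0(2)[OF \<open>b \<in> Basis\<close>] by (intro dD) auto
    qed (use that in simp)
    also have "\<dots> \<le> ?e * (DIM('a) * norm (y - x))"
      using e by (intro mult_left_mono sum_abs_inner_Basis_le) auto
    finally show ?thesis by simp
  qed
  then show "\<exists>d>0. \<forall>y\<in>S. norm (y - x) < d \<longrightarrow>
      norm (f y - f x - (\<Sum>b\<in>Basis. ((y - x) \<bullet> b) *\<^sub>R D b x)) \<le> e * norm (y - x)"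
    using d0 by blast
qed

lemma is_interval_Times_UNIV:
  fixes J :: "real set"
  assumes "is_interval J"
  shows "is_interval (J \<times> (UNIV :: 'a::euclidean_space set))"
  unfolding is_interval_def
proof (intro ballI allI impI)
  fix a b x :: "real \<times> 'a"
  assume ab: "a \<in> J \<times> UNIV" "b \<in> J \<times> UNIV"
    and x: "\<forall>i\<in>Basis. a \<bullet> i \<le> x \<bullet> i \<and> x \<bullet> i \<le> b \<bullet> i \<or> b \<bullet> i \<le> x \<bullet> i \<and> x \<bullet> i \<le> a \<bullet> i"
  have "(1, 0) \<in> (Basis :: (real \<times> 'a) set)" by (simp add: Basis_prod_def)
  from bspec[OF x this]
  have "fst a \<le> fst x \<and> fst x \<le> fst b \<or> fst b \<le> fst x \<and> fst x \<le> fst a"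
    by (simp add: inner_prod_def)
  moreover have "fst a \<in> J" "fst b \<in> J" using ab by (auto simp: mem_Times_iff)
  ultimately have "fst x \<in> J"
    using mem_is_interval_1_I[OF assms, of "fst a" "fst b" "fst x"]
      mem_is_interval_1_I[OF assms, of "fst b" "fst a" "fst x"] by argo
  then show "x \<in> J \<times> UNIV" by (simp add: mem_Times_iff)
qed

lemma chain_rule_along_curve:
  fixes J :: "real set" and f :: "real \<times> 'a::euclidean_space \<Rightarrow> 'b::real_normed_vector"
  assumes J: "is_interval J" and D: "has_partials_on (J \<times> UNIV) f D"
    and cont: "\<And>b. b \<in> Basis \<Longrightarrow> continuous_on (J \<times> UNIV) (D b)" and s: "s \<in> J"
    and u: "(u has_vector_derivative u') (at s within J)"
  shows "((\<lambda>s. f (s, u s)) has_vector_derivative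
    (D (1, 0) (s, u s) + (\<Sum>b\<in>Basis. (u' \<bullet> b) *\<^sub>R D (0, b) (s, u s)))) (at s within J)"
proof -
  have "((\<lambda>s. (s, u s)) has_derivative (\<lambda>h. (h, h *\<^sub>R u'))) (at s within J)"
    using u by (auto simp: has_vector_derivative_def intro!: derivative_eq_intros)
  moreover have "(f has_derivative (\<lambda>h. \<Sum>b\<in>Basis. (h \<bullet> b) *\<^sub>R D b (s, u s)))
      (at (s, u s) within (\<lambda>s. (s, u s)) ` J)"
    by (rule has_derivative_subset[OF has_derivative_from_partials[OF is_interval_Times_UNIV[OF J] D cont]])
      (use s in auto)
  ultimately have "((\<lambda>s. f (s, u s)) has_derivative
      (\<lambda>h. \<Sum>b\<in>Basis. ((h, h *\<^sub>R u') \<bullet> b) *\<^sub>R D b (s, u s))) (at s within J)"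
    by (rule has_derivative_in_compose)
  moreover have "(\<Sum>b\<in>Basis. ((h, h *\<^sub>R u') \<bullet> b) *\<^sub>R D b (s, u s)) =
      h *\<^sub>R (D (1, 0) (s, u s) + (\<Sum>b\<in>Basis. (u' \<bullet> b) *\<^sub>R D (0, b) (s, u s)))" for h :: real
  proof -
    have inj: "inj_on (\<lambda>b. (0::real, b)) (Basis::'a set)" by (auto simp: inj_on_def)
    have "(\<Sum>b\<in>Basis. ((h, h *\<^sub>R u') \<bullet> b) *\<^sub>R D b (s, u s)) =
        (\<Sum>b\<in>insert (1, 0) ((\<lambda>b. (0, b)) ` Basis). ((h, h *\<^sub>R u') \<bullet> b) *\<^sub>R D b (s, u s))"
      by (rule sum.cong) (auto simp: Basis_prod_def)
    also have "\<dots> = h *\<^sub>R D (1, 0) (s, u s) +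
        (\<Sum>b\<in>(\<lambda>b. (0, b)) ` Basis. ((h, h *\<^sub>R u') \<bullet> b) *\<^sub>R D b (s, u s))"
      by (subst sum.insert) auto
    also have "(\<Sum>b\<in>(\<lambda>b. (0, b)) ` Basis. ((h, h *\<^sub>R u') \<bullet> b) *\<^sub>R D b (s, u s)) =
        (\<Sum>b\<in>Basis. h *\<^sub>R (u' \<bullet> b) *\<^sub>R D (0, b) (s, u s))"
      by (subst sum.reindex[OF inj]) simp
    finally show ?thesis by (simp only: scaleR_add_right scaleR_sum_right)
  qed
  ultimately show ?thesis by (simp add: has_vector_derivative_def)
qed

section \<open>Moderate nets of curves\<close>

text \<open>
Moderateness of the first \<open>k\<close> derivatives. Counting the order makes induction possible: order
\<open>k + 1\<close> of a composition or of a solution follows from order \<open>k\<close> of its derivative, which the chain rule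
or the differential equation expresses through functions already known to have order \<open>k\<close>.
\<close>

primrec moderate_upto ::
    "nat \<Rightarrow> real set \<Rightarrow> (real \<Rightarrow> real \<Rightarrow> 'b::real_normed_vector) \<Rightarrow> bool" where
  "moderate_upto 0 J u \<longleftrightarrow> (\<forall>\<epsilon>\<in>params. continuous_on J (u \<epsilon>)) \<and> locally_moderate J u"
| "moderate_upto (Suc k) J u \<longleftrightarrow> locally_moderate J u \<and>
     (\<exists>v. (\<forall>\<epsilon>\<in>params. \<forall>s\<in>J. (u \<epsilon> has_vector_derivative v \<epsilon> s) (at s within J)) \<and>
          moderate_upto k J v)"

lemma moderate_upto_SucD:
  assumes "moderate_upto (Suc k) J u"
  shows "\<exists>u'. (\<forall>\<epsilon>\<in>params. \<forall>s\<in>J. (u \<epsilon> has_vector_derivative u' \<epsilon> s) (at s within J)) \<and>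
    moderate_upto k J u'"
  using assms by simp

lemma moderate_upto_SucI:
  assumes "locally_moderate J u" "moderate_upto k J u'"
    and "\<And>\<epsilon> s. \<epsilon> \<in> params \<Longrightarrow> s \<in> J \<Longrightarrow> (u \<epsilon> has_vector_derivative u' \<epsilon> s) (at s within J)"
  shows "moderate_upto (Suc k) J u"
  unfolding moderate_upto.simps using assms by blast

text \<open>
The bound does not depend on \<open>\<epsilon>\<close>, so that the graph of such a net of curves stays in a compact set,
where the moderateness of a field can be used.
\<close>

definition locally_bounded_net :: "real set \<Rightarrow> (real \<Rightarrow> real \<Rightarrow> 'b::real_normed_vector) \<Rightarrow> bool" where
  "locally_bounded_net J u \<longleftrightarrow>
     (\<forall>K. compact K \<and> K \<subseteq> J \<longrightarrow> (\<exists>R. \<forall>\<^sub>F \<epsilon> in at_right 0. \<forall>s\<in>K. norm (u \<epsilon> s) \<le> R))"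

lemma moderate_upto_continuous:
  "moderate_upto k J u \<Longrightarrow> \<epsilon> \<in> params \<Longrightarrow> continuous_on J (u \<epsilon>)"
  by (cases k) (simp, metis continuous_on_vector_derivative moderate_upto_SucD)

lemma moderate_upto_locally_moderate: "moderate_upto k J u \<Longrightarrow> locally_moderate J u"
  by (cases k) auto

lemma moderate_upto_Suc: "moderate_upto (Suc k) J u \<Longrightarrow> moderate_upto k J u"
proof (induction k arbitrary: u)
  case 0
  then show ?case using moderate_upto_continuous[OF 0] by simp
next
  case (Suc k)
  obtain u' where u': "\<forall>\<epsilon>\<in>params. \<forall>s\<in>J.
      (u \<epsilon> has_vector_derivative u' \<epsilon> s) (at s within J)" "moderate_upto (Suc k) J u'"
    using moderate_upto_SucD[OF Suc.prems(1)] by blast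
  show ?case
    using moderate_upto_locally_moderate[OF Suc.prems] Suc.IH[OF u'(2)] u'(1)[rule_format]
    by (rule moderate_upto_SucI)
qed

lemma has_vector_derivative_cong_on:
  assumes "(f has_vector_derivative f') (at s within J)" "s \<in> J" "\<And>s. s \<in> J \<Longrightarrow> g s = f s"
  shows "(g has_vector_derivative f') (at s within J)"
  using has_vector_derivative_transform[OF assms(2) assms(3) assms(1)] by simp

lemma moderate_upto_cong:
  assumes "moderate_upto k J u" "\<And>\<epsilon> s. \<epsilon> \<in> params \<Longrightarrow> s \<in> J \<Longrightarrow> v \<epsilon> s = u \<epsilon> s"
  shows "moderate_upto k J v"
proof -
  have mod: "locally_moderate J v"
    using moderate_upto_locally_moderate[OF assms(1)] by (rule locally_moderate_mono) (simp add: assms(2))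
  show ?thesis
  proof (cases k)
    case 0
    then show ?thesis using assms mod by (auto cong: continuous_on_cong)
  next
    case (Suc k')
    then obtain u' where u': "\<forall>\<epsilon>\<in>params. \<forall>s\<in>J.
        (u \<epsilon> has_vector_derivative u' \<epsilon> s) (at s within J)" "moderate_upto k' J u'"
      using moderate_upto_SucD[OF assms(1)[unfolded \<open>k = Suc k'\<close>]] by blast
    have "(v \<epsilon> has_vector_derivative u' \<epsilon> s) (at s within J)" if "\<epsilon> \<in> params" "s \<in> J" for \<epsilon> s
      by (rule has_vector_derivative_cong_on[OF u'(1)[rule_format, OF that] that(2) assms(2)[OF that(1)]])
    then show ?thesis unfolding Suc by (intro moderate_upto_SucI[OF mod u'(2)])
  qed
qed

lemma moderate_upto_add:
  "moderate_upto k J u \<Longrightarrow> moderate_upto k J v \<Longrightarrow> moderate_upto k J (\<lambda>\<epsilon> s. u \<epsilon> s + v \<epsilon> s)"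
proof (induction k arbitrary: u v)
  case 0
  then show ?case by (auto intro!: continuous_intros locally_moderate_add)
next
  case (Suc k)
  obtain u' where u': "\<forall>\<epsilon>\<in>params. \<forall>s\<in>J.
      (u \<epsilon> has_vector_derivative u' \<epsilon> s) (at s within J)" "moderate_upto k J u'"
    using moderate_upto_SucD[OF Suc.prems(1)] by blast
  obtain v' where v': "\<forall>\<epsilon>\<in>params. \<forall>s\<in>J.
      (v \<epsilon> has_vector_derivative v' \<epsilon> s) (at s within J)" "moderate_upto k J v'"
    using moderate_upto_SucD[OF Suc.prems(2)] by blast
  have "((\<lambda>s. u \<epsilon> s + v \<epsilon> s) has_vector_derivative u' \<epsilon> s + v' \<epsilon> s) (at s within J)"
    if "\<epsilon> \<in> params" "s \<in> J" for \<epsilon> s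
    using u'(1)[rule_format, OF that] v'(1)[rule_format, OF that] by (rule has_vector_derivative_add)
  then show ?case
    by (intro moderate_upto_SucI[OF locally_moderate_add Suc.IH[OF u'(2) v'(2)]]
        Suc.prems[THEN moderate_upto_locally_moderate])
qed

lemma moderate_upto_const: "moderate_upto k J (\<lambda>\<epsilon> s. c)"
proof (induction k arbitrary: c)
  case 0
  have "\<forall>\<^sub>F \<epsilon> in at_right 0. norm c * \<epsilon> powr 0 \<le> \<epsilon> powr (- 1)"
    by (rule eventually_mult_powr_le) simp
  then have "\<forall>\<^sub>F \<epsilon> in at_right 0. norm c \<le> \<epsilon> powr (- 1)"
    using eventually_params by eventually_elim (simp only: powr_zero_eq_one, simp)
  then have "locally_moderate J (\<lambda>\<epsilon> s. c)"
    unfolding locally_moderate_def by (intro allI impI exI[of _ 1]) (auto elim!: eventually_mono)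
  then show ?case by simp
next
  case (Suc k)
  show ?case
    by (rule moderate_upto_SucI[OF moderate_upto_locally_moderate[OF Suc] Suc[of 0]])
      (rule has_vector_derivative_const)
qed

lemma moderate_upto_sum:
  assumes "finite I" "\<And>i. i \<in> I \<Longrightarrow> moderate_upto k J (u i)"
  shows "moderate_upto k J (\<lambda>\<epsilon> s. \<Sum>i\<in>I. u i \<epsilon> s)"
  using assms by (induction I) (auto intro: moderate_upto_add moderate_upto_const)

lemma locally_moderate_bounded_linear:
  fixes J :: "real set"
  assumes "bounded_linear L" "locally_moderate J u"
  shows "locally_moderate J (\<lambda>\<epsilon> s. L (u \<epsilon> s))"
proof -
  obtain B where B: "\<And>x. norm (L x) \<le> B * norm x" "0 < B"
    using bounded_linear.pos_bounded[OF assms(1)] by (metis mult.commute)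
  have "locally_moderate J (\<lambda>\<epsilon> s. B *\<^sub>R u \<epsilon> s)"
    using moderate_upto_locally_moderate[OF moderate_upto_const[of 0 J B]] assms(2)
    by (rule locally_moderate_scaleR)
  then show ?thesis
    by (rule locally_moderate_mono) (use B in auto)
qed

lemma moderate_upto_bounded_linear:
  assumes L: "bounded_linear L"
  shows "moderate_upto k J u \<Longrightarrow> moderate_upto k J (\<lambda>\<epsilon> s. L (u \<epsilon> s))"
proof (induction k arbitrary: u)
  case 0
  then show ?case
    by (auto intro!: locally_moderate_bounded_linear[OF L] bounded_linear.continuous_on[OF L])
next
  case (Suc k)
  obtain u' where u': "\<forall>\<epsilon>\<in>params. \<forall>s\<in>J.
      (u \<epsilon> has_vector_derivative u' \<epsilon> s) (at s within J)" "moderate_upto k J u'"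
    using moderate_upto_SucD[OF Suc.prems(1)] by blast
  then have "((\<lambda>s. L (u \<epsilon> s)) has_vector_derivative L (u' \<epsilon> s)) (at s within J)"
    if "\<epsilon> \<in> params" "s \<in> J" for \<epsilon> s
    using bounded_linear.has_vector_derivative[OF L] that by blast
  then show ?case
    by (intro moderate_upto_SucI[OF
          locally_moderate_bounded_linear[OF L moderate_upto_locally_moderate[OF Suc.prems]]
          Suc.IH[OF u'(2)]])
qed

lemma moderate_upto_diff:
  assumes "moderate_upto k J u" "moderate_upto k J v"
  shows "moderate_upto k J (\<lambda>\<epsilon> s. u \<epsilon> s - v \<epsilon> s)"
  using moderate_upto_add[OF assms(1) moderate_upto_bounded_linear[OF _ assms(2), of uminus]]
  by (simp add: bounded_linear_minus[OF bounded_linear_ident])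

lemma moderate_upto_scaleR:
  "moderate_upto k J u \<Longrightarrow> moderate_upto k J v \<Longrightarrow> moderate_upto k J (\<lambda>\<epsilon> s. u \<epsilon> s *\<^sub>R v \<epsilon> s)"
proof (induction k arbitrary: u v)
  case 0
  then show ?case by (auto intro!: continuous_intros locally_moderate_scaleR)
next
  case (Suc k)
  obtain u' where u': "\<forall>\<epsilon>\<in>params. \<forall>s\<in>J.
      (u \<epsilon> has_vector_derivative u' \<epsilon> s) (at s within J)" "moderate_upto k J u'"
    using moderate_upto_SucD[OF Suc.prems(1)] by blast
  obtain v' where v': "\<forall>\<epsilon>\<in>params. \<forall>s\<in>J.
      (v \<epsilon> has_vector_derivative v' \<epsilon> s) (at s within J)" "moderate_upto k J v'"
    using moderate_upto_SucD[OF Suc.prems(2)] by blast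
  have "((\<lambda>s. u \<epsilon> s *\<^sub>R v \<epsilon> s) has_vector_derivative u \<epsilon> s *\<^sub>R v' \<epsilon> s + u' \<epsilon> s *\<^sub>R v \<epsilon> s) (at s within J)"
    if "\<epsilon> \<in> params" "s \<in> J" for \<epsilon> s
    using has_vector_derivative_scaleR[OF _ v'(1)[rule_format, OF that]] u'(1)[rule_format, OF that]
    by (simp only: has_real_derivative_iff_has_vector_derivative)
  moreover have "moderate_upto k J (\<lambda>\<epsilon> s. u \<epsilon> s *\<^sub>R v' \<epsilon> s + u' \<epsilon> s *\<^sub>R v \<epsilon> s)"
    by (intro moderate_upto_add Suc.IH u'(2) v'(2) Suc.prems[THEN moderate_upto_Suc])
  ultimately show ?case
    using Suc.prems
    by (intro moderate_upto_SucI[OF locally_moderate_scaleR] moderate_upto_locally_moderate)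
qed

lemma continuous_on_graph:
  assumes "continuous_on (J \<times> UNIV) f" "continuous_on J u"
  shows "continuous_on J (\<lambda>s. f (s, u s))"
  by (rule continuous_on_compose2[OF assms(1)]) (auto intro!: continuous_intros assms(2))

text \<open>
By the chain rule the derivative is a sum of products of the derivative of \<open>u\<close> with compositions of
the same kind. The statement is proved for all partial derivatives of the field together because these
compositions involve the next ones.
\<close>

lemma moderate_upto_along_curve:
  fixes f :: "real \<Rightarrow> real \<times> 'a::euclidean_space \<Rightarrow> 'b::real_normed_vector"
  assumes J: "is_interval J" and f: "f \<in> moderate_nets (J \<times> UNIV)" and u: "locally_bounded_net J u"
  shows "moderate_upto k J u \<Longrightarrow> set bs \<subseteq> Basis \<Longrightarrow>
    moderate_upto k J (\<lambda>\<epsilon> s. partials_within (J \<times> UNIV) bs (f \<epsilon>) (s, u \<epsilon> s))"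
proof (induction k arbitrary: bs)
  have smooth: "smooth_on (J \<times> UNIV) (f \<epsilon>)" if "\<epsilon> \<in> params" for \<epsilon>
    using f that by (simp add: moderate_nets_def)
  have mod: "locally_moderate J (\<lambda>\<epsilon> s. partials_within (J \<times> UNIV) bs (f \<epsilon>) (s, u \<epsilon> s))"
    if bs: "set bs \<subseteq> Basis" for bs
    unfolding locally_moderate_def
  proof (intro allI impI)
    fix K assume K: "compact K \<and> K \<subseteq> J"
    obtain R where R: "\<forall>\<^sub>F \<epsilon> in at_right 0. \<forall>s\<in>K. norm (u \<epsilon> s) \<le> R"
      using u K unfolding locally_bounded_net_def by blast
    have "compact (K \<times> cball (0::'a) R) \<and> K \<times> cball (0::'a) R \<subseteq> J \<times> UNIV"
      using K by (intro conjI compact_Times compact_cball) auto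
    then obtain p where p: "\<forall>\<^sub>F \<epsilon> in at_right 0. \<forall>x\<in>K \<times> cball (0::'a) R.
        norm (partials_within (J \<times> UNIV) bs (f \<epsilon>) x) \<le> \<epsilon> powr (- p)"
      using moderate_imp_locally_moderate[OF f bs] unfolding locally_moderate_def by blast
    have "\<forall>\<^sub>F \<epsilon> in at_right 0. \<forall>s\<in>K.
        norm (partials_within (J \<times> UNIV) bs (f \<epsilon>) (s, u \<epsilon> s)) \<le> \<epsilon> powr (- p)"
      using R p by eventually_elim auto
    then show "\<exists>p. \<forall>\<^sub>F \<epsilon> in at_right 0. \<forall>s\<in>K.
        norm (partials_within (J \<times> UNIV) bs (f \<epsilon>) (s, u \<epsilon> s)) \<le> \<epsilon> powr (- p)" by blast
  qed
  {
    case 0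
    then show ?case
      using smooth_on_continuous[OF smooth] mod by (auto intro!: continuous_on_graph)
  next
    case (Suc k)
    obtain u' where u': "\<forall>\<epsilon>\<in>params. \<forall>s\<in>J.
        (u \<epsilon> has_vector_derivative u' \<epsilon> s) (at s within J)" "moderate_upto k J u'"
      using moderate_upto_SucD[OF Suc.prems(1)] by blast
    have uk: "moderate_upto k J u" using Suc.prems moderate_upto_Suc by blast
    define F where "F b \<epsilon> s = partials_within (J \<times> UNIV) (b # bs) (f \<epsilon>) (s, u \<epsilon> s)" for b \<epsilon> s
    have F: "moderate_upto k J (F b)" if "b \<in> Basis" for b
      unfolding F_def by (rule Suc.IH[OF uk]) (use that Suc.prems in auto)
    define v where "v \<epsilon> s = F (1, 0) \<epsilon> s + (\<Sum>b\<in>Basis. (u' \<epsilon> s \<bullet> b) *\<^sub>R F (0, b) \<epsilon> s)" for \<epsilon> s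
    have "moderate_upto k J v"
      unfolding v_def
      by (intro moderate_upto_add moderate_upto_sum moderate_upto_scaleR F
          moderate_upto_bounded_linear[OF bounded_linear_inner_left u'(2)])
        (auto simp: Basis_prod_def)
    moreover have "((\<lambda>s. partials_within (J \<times> UNIV) bs (f \<epsilon>) (s, u \<epsilon> s)) has_vector_derivative v \<epsilon> s)
        (at s within J)" if "\<epsilon> \<in> params" "s \<in> J" for \<epsilon> s
      unfolding v_def F_def
      by (rule chain_rule_along_curve[OF J smooth_on_has_partials[OF smooth]])
        (use that Suc.prems u' smooth_on_continuous[OF smooth[OF that(1)], of "_ # bs"] in auto)
    ultimately show ?case by (intro moderate_upto_SucI[OF mod[OF Suc.prems(2)]])
  }
qed

text \<open>
Bootstrapping: if \<open>u\<close> is moderate up to order \<open>k\<close>, so is its derivative \<open>a (s, u s)\<close>.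
\<close>

lemma moderate_upto_solution:
  fixes a :: "real \<Rightarrow> real \<times> 'a::euclidean_space \<Rightarrow> 'a"
  assumes J: "is_interval J" and a: "a \<in> moderate_nets (J \<times> UNIV)" and u: "locally_bounded_net J u"
    and sol: "\<And>\<epsilon> s. \<epsilon> \<in> params \<Longrightarrow> s \<in> J \<Longrightarrow> (u \<epsilon> has_vector_derivative a \<epsilon> (s, u \<epsilon> s)) (at s within J)"
  shows "moderate_upto k J u"
proof -
  have mod: "locally_moderate J u"
    unfolding locally_moderate_def
  proof (intro allI impI)
    fix K assume K: "compact K \<and> K \<subseteq> J"
    obtain R where R: "\<forall>\<^sub>F \<epsilon> in at_right 0. \<forall>s\<in>K. norm (u \<epsilon> s) \<le> R"
      using u K unfolding locally_bounded_net_def by blast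
    have "\<forall>\<^sub>F \<epsilon> in at_right 0. \<forall>s\<in>K. norm (u \<epsilon> s) \<le> \<epsilon> powr (- 1)"
      using eventually_params eventually_mult_powr_le[of "- 1" 0 R, simplified] R
      by eventually_elim force
    then show "\<exists>p. \<forall>\<^sub>F \<epsilon> in at_right 0. \<forall>s\<in>K. norm (u \<epsilon> s) \<le> \<epsilon> powr (- p)" by blast
  qed
  show ?thesis
  proof (induction k)
    case 0
    have "continuous_on J (u \<epsilon>)" if "\<epsilon> \<in> params" for \<epsilon>
      by (rule continuous_on_vector_derivative) (rule sol[OF that])
    then show ?case using mod by simp
  next
    case (Suc k)
    have "moderate_upto k J (\<lambda>\<epsilon> s. a \<epsilon> (s, u \<epsilon> s))"
      using moderate_upto_along_curve[OF J a u Suc, of "[]"] by simp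
    then show ?case
      using sol by (rule moderate_upto_SucI[OF mod])
  qed
qed


text \<open>
All derivatives on \<open>J\<close> are derivatives within \<open>J\<close>; nondegeneracy makes them unique, also at end
points.
\<close>

locale time_interval =
  fixes J :: "real set"
  assumes interval: "is_interval J" and nondegenerate: "interior J \<noteq> {}"
begin

lemma two_points: obtains p q where "p \<in> J" "q \<in> J" "p < q"
proof -
  obtain x where "x \<in> interior J" using nondegenerate by blast
  then obtain e where "e > 0" "cball x e \<subseteq> J" by (auto simp: mem_interior_cball)
  moreover have "x - e \<in> cball x e" "x + e \<in> cball x e"
    using \<open>e > 0\<close> by (auto simp: dist_real_def)
  ultimately show thesis by (intro that[of "x - e" "x + e"]) auto
qed

lemma at_within_nontrivial: "s \<in> J \<Longrightarrow> at s within J \<noteq> bot"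
proof -
  assume s: "s \<in> J"
  obtain p q where pq: "p \<in> J" "q \<in> J" "p < q" by (rule two_points)
  then have "\<not> (\<exists>a. J = {a})" by auto
  then have "s islimpt J"
    using connected_imp_perfect[of J s] s interval by (simp add: is_interval_connected_1)
  then show ?thesis by (simp add: trivial_limit_within)
qed

lemma atLeastAtMost_subset: "c \<in> J \<Longrightarrow> d \<in> J \<Longrightarrow> {c..d} \<subseteq> J"
  by (rule subsetI, rule mem_is_interval_1_I[OF interval, of c d]) auto

text \<open>
The interval \<open>{c..d}\<close> is a neighbourhood of \<open>K\<close> relative to \<open>J\<close>, with margin \<open>\<eta>\<close>. At an end point
of \<open>J\<close> that belongs to \<open>K\<close> there is nothing of \<open>J\<close> left to cover on one side.
\<close>

lemma compact_in_interval:
  assumes K: "compact K" "K \<subseteq> J"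
  obtains c d \<eta> where "c < d" "c \<in> J" "d \<in> J" "{c..d} \<subseteq> J" "K \<subseteq> {c..d}" "0 < \<eta>"
    "\<And>x y. \<lbrakk>x \<in> K; y \<in> J; \<bar>y - x\<bar> < \<eta>\<rbrakk> \<Longrightarrow> y \<in> {c..d}"
proof -
  obtain p q where pq: "p \<in> J" "q \<in> J" "p < q" by (rule two_points)
  \<comment> \<open>Two further points of \<open>J\<close> keep the interval from degenerating when \<open>K\<close> has at most one point.\<close>
  let ?K = "insert p (insert q K)"
  have K': "compact ?K" "?K \<noteq> {}" "?K \<subseteq> J" using K pq by auto
  obtain k0 where k0: "k0 \<in> ?K" "\<And>x. x \<in> ?K \<Longrightarrow> k0 \<le> x"
    using compact_attains_inf[OF K'(1,2)] by blast
  obtain k1 where k1: "k1 \<in> ?K" "\<And>x. x \<in> ?K \<Longrightarrow> x \<le> k1"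
    using compact_attains_sup[OF K'(1,2)] by blast
  have "\<exists>c \<eta>. c \<in> J \<and> c \<le> k0 \<and> 0 < \<eta> \<and> (\<forall>y\<in>J. k0 - \<eta> < y \<longrightarrow> c \<le> y)"
  proof (cases "\<exists>c\<in>J. c < k0")
    case True
    then obtain c where "c \<in> J" "c < k0" by blast
    then show ?thesis by (intro exI[of _ c] exI[of _ "k0 - c"]) auto
  next
    case False
    then show ?thesis using k0 K'(3) by (intro exI[of _ k0] exI[of _ 1]) (auto simp: not_less)
  qed
  then obtain c \<eta>0 where c: "c \<in> J" "c \<le> k0" "0 < \<eta>0" "\<And>y. y \<in> J \<Longrightarrow> k0 - \<eta>0 < y \<Longrightarrow> c \<le> y"
    by blast
  have "\<exists>d \<eta>. d \<in> J \<and> k1 \<le> d \<and> 0 < \<eta> \<and> (\<forall>y\<in>J. y < k1 + \<eta> \<longrightarrow> y \<le> d)"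
  proof (cases "\<exists>d\<in>J. k1 < d")
    case True
    then obtain d where "d \<in> J" "k1 < d" by blast
    then show ?thesis by (intro exI[of _ d] exI[of _ "d - k1"]) auto
  next
    case False
    then show ?thesis using k1 K'(3) by (intro exI[of _ k1] exI[of _ 1]) (auto simp: not_less)
  qed
  then obtain d \<eta>1 where d: "d \<in> J" "k1 \<le> d" "0 < \<eta>1" "\<And>y. y \<in> J \<Longrightarrow> y < k1 + \<eta>1 \<Longrightarrow> y \<le> d"
    by blast
  show thesis
  proof (rule that[of c d "min \<eta>0 \<eta>1"])
    show "c < d" using c(2) d(2) k0(2)[of p] k1(2)[of q] pq(3) by auto
    show "K \<subseteq> {c..d}" using c(2) d(2) k0(2) k1(2) by force
    show "y \<in> {c..d}" if "x \<in> K" "y \<in> J" "\<bar>y - x\<bar> < min \<eta>0 \<eta>1" for x y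
      using c(4)[OF that(2)] d(4)[OF that(2)] k0(2)[of x] k1(2)[of x] that by auto
  qed (use c d atLeastAtMost_subset in auto)
qed

lemma partial_within_eq_vector_derivative:
  assumes "s \<in> J"
  shows "partial_within J 1 f s = vector_derivative f (at s within J)"
proof -
  have "((\<lambda>h. f (s + h *\<^sub>R 1)) has_vector_derivative D) (at 0 within {h. s + h *\<^sub>R 1 \<in> J}) \<longleftrightarrow>
      (f has_vector_derivative D) (at s within J)" (is "?L \<longleftrightarrow> ?R") for D
  proof
    let ?T = "{h. s + h *\<^sub>R 1 \<in> J}"
    show ?L if ?R
    proof -
      have "((\<lambda>h. s + h) has_vector_derivative 1) (at 0 within ?T)"
        by (auto intro!: derivative_eq_intros)
      moreover have "(f has_vector_derivative D) (at (s + 0) within (\<lambda>h. s + h) ` ?T)"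
        by (rule has_vector_derivative_within_subset[of _ _ _ J]) (use that in auto)
      ultimately have "(f \<circ> (\<lambda>h. s + h) has_vector_derivative 1 *\<^sub>R D) (at 0 within ?T)"
        by (rule vector_diff_chain_within)
      then show ?L by (simp add: o_def)
    qed
    show ?R if ?L
    proof -
      have "((\<lambda>r. r - s) has_vector_derivative 1) (at s within J)"
        by (auto intro!: derivative_eq_intros)
      moreover have "((\<lambda>h. f (s + h *\<^sub>R 1)) has_vector_derivative D) (at (s - s) within (\<lambda>r. r - s) ` J)"
        by (rule has_vector_derivative_within_subset[of _ _ _ ?T]) (use that in auto)
      ultimately have "((\<lambda>h. f (s + h *\<^sub>R 1)) \<circ> (\<lambda>r. r - s) has_vector_derivative 1 *\<^sub>R D) (at s within J)"
        by (rule vector_diff_chain_within)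
      then show ?R by (simp add: o_def)
    qed
  qed
  then show ?thesis
    unfolding partial_within_def vector_derivative_def by simp
qed

lemma moderate_imp_upto:
  assumes "u \<in> moderate_nets J"
  shows "moderate_upto k J u"
proof -
  have "moderate_upto k J (\<lambda>\<epsilon>. partials_within J (replicate n 1) (u \<epsilon>))" for n
  proof (induction k arbitrary: n)
    case 0
    have bs: "set (replicate n (1::real)) \<subseteq> Basis" by auto
    have "smooth_on J (u \<epsilon>)" if "\<epsilon> \<in> params" for \<epsilon>
      using assms that by (simp add: moderate_nets_def)
    then show ?case
      using smooth_on_continuous[OF _ bs] moderate_imp_locally_moderate[OF assms bs]
      unfolding moderate_upto.simps by blast
  next
    case (Suc k)
    have bs: "set (replicate n (1::real)) \<subseteq> Basis" by auto
    show ?case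
    proof (rule moderate_upto_SucI[OF moderate_imp_locally_moderate[OF assms bs] Suc[of "Suc n"]])
      fix \<epsilon> s :: real assume \<epsilon>: "\<epsilon> \<in> params" and s: "s \<in> J"
      have "smooth_on J (u \<epsilon>)" using assms \<epsilon> by (simp add: moderate_nets_def)
      from has_partials_on_line[OF smooth_on_has_partials[OF this bs], of 1 0 s] s
      show "(partials_within J (replicate n 1) (u \<epsilon>) has_vector_derivative
          partials_within J (replicate (Suc n) 1) (u \<epsilon>) s) (at s within J)"
        by simp
    qed
  qed
  from this[of 0] show ?thesis by simp
qed

lemma moderate_upto_derivative:
  assumes "\<And>k. moderate_upto k J u"
  shows "moderate_upto k J (\<lambda>\<epsilon> s. vector_derivative (u \<epsilon>) (at s within J))"
    and "\<epsilon> \<in> params \<Longrightarrow> s \<in> J \<Longrightarrow>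
      (u \<epsilon> has_vector_derivative vector_derivative (u \<epsilon>) (at s within J)) (at s within J)"
proof -
  have *: "(u \<epsilon> has_vector_derivative vector_derivative (u \<epsilon>) (at s within J)) (at s within J)"
    if "\<epsilon> \<in> params" "s \<in> J" for \<epsilon> s
    using moderate_upto_SucD[OF assms[of "Suc 0"]] that
    by (metis differentiableI_vector vector_derivative_works)
  then show "\<epsilon> \<in> params \<Longrightarrow> s \<in> J \<Longrightarrow>
      (u \<epsilon> has_vector_derivative vector_derivative (u \<epsilon>) (at s within J)) (at s within J)" .
  obtain u' where u': "\<forall>\<epsilon>\<in>params. \<forall>s\<in>J. (u \<epsilon> has_vector_derivative u' \<epsilon> s) (at s within J)"
    "moderate_upto k J u'"
    using moderate_upto_SucD[OF assms[of "Suc k"]] by blast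
  show "moderate_upto k J (\<lambda>\<epsilon> s. vector_derivative (u \<epsilon>) (at s within J))"
    by (rule moderate_upto_cong[OF u'(2)])
      (use u'(1) at_within_nontrivial in \<open>blast intro: vector_derivative_within\<close>)
qed

lemma moderate_nets_iff_upto: "u \<in> moderate_nets J \<longleftrightarrow> (\<forall>k. moderate_upto k J u)"
proof (intro iffI allI)
  assume u: "\<forall>k. moderate_upto k J u"
  have P: "\<forall>k. moderate_upto k J (\<lambda>\<epsilon>. partials_within J bs (u \<epsilon>))" if "set bs \<subseteq> Basis" for bs
    using that
  proof (induction bs)
    case Nil
    then show ?case using u by simp
  next
    case (Cons b bs)
    show ?case
    proof
      fix k
      have "moderate_upto k J (\<lambda>\<epsilon> s. vector_derivative (partials_within J bs (u \<epsilon>)) (at s within J))"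
        using Cons by (intro moderate_upto_derivative) auto
      then show "moderate_upto k J (\<lambda>\<epsilon>. partials_within J (b # bs) (u \<epsilon>))"
        by (rule moderate_upto_cong) (use Cons.prems in \<open>simp add: partial_within_eq_vector_derivative\<close>)
    qed
  qed
  show "u \<in> moderate_nets J"
  proof (rule moderate_netsI)
    show "locally_moderate J (\<lambda>\<epsilon>. partials_within J bs (u \<epsilon>))" if "set bs \<subseteq> Basis" for bs
      using P[OF that] moderate_upto_locally_moderate by blast
    fix \<epsilon> :: real assume \<epsilon>: "\<epsilon> \<in> params"
    show "smooth_on J (u \<epsilon>)"
      unfolding smooth_on_def
    proof (intro allI impI conjI ballI)
      fix bs :: "real list" assume bs: "set bs \<subseteq> Basis"
      show "continuous_on J (partials_within J bs (u \<epsilon>))"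
        using P[OF bs] moderate_upto_continuous[OF _ \<epsilon>] by blast
      fix b s :: real assume b: "b \<in> Basis" and s: "s \<in> J"
      let ?T = "{h. s + h *\<^sub>R b \<in> J}"
      have "(partials_within J bs (u \<epsilon>) has_vector_derivative
          vector_derivative (partials_within J bs (u \<epsilon>)) (at s within J)) (at s within J)"
        using P[OF bs] moderate_upto_derivative(2)[OF _ \<epsilon> s] by blast
      then have "(partials_within J bs (u \<epsilon>) has_vector_derivative
          vector_derivative (partials_within J bs (u \<epsilon>)) (at s within J))
          (at (s + 0 *\<^sub>R b) within (\<lambda>h. s + h *\<^sub>R b) ` ?T)"
        by (auto intro: has_vector_derivative_within_subset)
      moreover have "((\<lambda>h. s + h *\<^sub>R b) has_vector_derivative b) (at 0 within ?T)"
        by (auto intro!: derivative_eq_intros)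
      ultimately have "(partials_within J bs (u \<epsilon>) \<circ> (\<lambda>h. s + h *\<^sub>R b) has_vector_derivative
          b *\<^sub>R vector_derivative (partials_within J bs (u \<epsilon>)) (at s within J)) (at 0 within ?T)"
        by (intro vector_diff_chain_within)
      then show "(\<lambda>h. partials_within J bs (u \<epsilon>) (s + h *\<^sub>R b)) differentiable (at 0 within ?T)"
        unfolding o_def by (rule differentiableI_vector)
    qed
  qed
qed (rule moderate_imp_upto)

lemma net_equiv_iff:
  "(u, v) \<in> net_equiv J \<longleftrightarrow>
    u \<in> moderate_nets J \<and> v \<in> moderate_nets J \<and> locally_negligible J (\<lambda>\<epsilon> s. u \<epsilon> s - v \<epsilon> s)"
  unfolding net_equiv_def negligible_nets_iff
  by (auto simp: moderate_nets_iff_upto intro: moderate_upto_diff)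

lemma equiv_net_equiv: "equiv (moderate_nets J) (net_equiv J)"
proof (rule equivI)
  show "refl_on (moderate_nets J) (net_equiv J)"
    by (auto intro!: refl_onI simp: net_equiv_iff locally_negligible_def)
  show "sym (net_equiv J)"
    by (intro symI) (use locally_negligible_minus_commute in \<open>auto simp: net_equiv_iff\<close>)
  show "trans (net_equiv J)"
    by (intro transI) (auto simp: net_equiv_iff intro: locally_negligible_trans)
qed (auto simp: net_equiv_iff)

lemma net_class_eq: "(u, v) \<in> net_equiv J \<Longrightarrow> net_class J u = net_class J v"
  unfolding net_class_def by (rule equiv_class_eq[OF equiv_net_equiv])

text \<open>
Landau's interpolation: \<open>h *\<^sub>R v' s\<close> differs from \<open>v (s + h) - v s\<close> by at most \<open>h\<^sup>2\<close> times a bound for the second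
derivative. The latter is of order \<open>\<epsilon> powr (- p)\<close>, and \<open>v\<close> is smaller than every power, so a step \<open>h\<close>
that is a sufficiently high power of \<open>\<epsilon>\<close> makes both contributions to \<open>v' s\<close> small.
\<close>

lemma negligible_derivative:
  assumes mod: "moderate_upto 2 J v" and neg: "locally_negligible J v"
    and v': "\<And>\<epsilon> s. \<epsilon> \<in> params \<Longrightarrow> s \<in> J \<Longrightarrow> (v \<epsilon> has_vector_derivative v' \<epsilon> s) (at s within J)"
  shows "locally_negligible J v'"
  unfolding locally_negligible_def
proof (intro allI impI)
  fix K and q :: real assume K: "compact K \<and> K \<subseteq> J"
  obtain c d where cd: "c < d" "{c..d} \<subseteq> J" "K \<subseteq> {c..d}"
    using compact_in_interval[of K] K by metis
  obtain w w' where w: "\<forall>\<epsilon>\<in>params. \<forall>s\<in>J. (v \<epsilon> has_vector_derivative w \<epsilon> s) (at s within J)"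
    "\<forall>\<epsilon>\<in>params. \<forall>s\<in>J. (w \<epsilon> has_vector_derivative w' \<epsilon> s) (at s within J)" "moderate_upto 0 J w'"
    using mod[unfolded numeral_2_eq_2, THEN moderate_upto_SucD] moderate_upto_SucD by blast
  have v'_eq: "v' \<epsilon> s = w \<epsilon> s" if "\<epsilon> \<in> params" "s \<in> J" for \<epsilon> s
    using vector_derivative_unique_within[OF at_within_nontrivial v' w(1)[rule_format]] that by blast
  obtain p0 where p0: "\<forall>\<^sub>F \<epsilon> in at_right 0. \<forall>s\<in>{c..d}. norm (w' \<epsilon> s) \<le> \<epsilon> powr (- p0)"
    using moderate_upto_locally_moderate[OF w(3)] cd unfolding locally_moderate_def by blast
  \<comment> \<open>The step length will be \<open>\<epsilon> powr m\<close>: the second-order error relative to it is then \<open>\<epsilon> powr (m - p) = \<epsilon> powr Q\<close>,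
    and \<open>v\<close> is required to be of order \<open>\<epsilon> powr (Q + m)\<close>.\<close>
  define p Q m where "p = max p0 0" and "Q = max q 0 + 1" and "m = p + Q"
  have "\<forall>\<^sub>F \<epsilon> in at_right 0. \<epsilon> powr (- p0) \<le> \<epsilon> powr (- p)"
    by (rule eventually_powr_mono) (simp add: p_def)
  moreover have "\<forall>\<^sub>F \<epsilon> in at_right 0. 2 / (d - c) * \<epsilon> powr m \<le> \<epsilon> powr 0"
    by (rule eventually_mult_powr_le) (simp add: m_def p_def Q_def)
  moreover have "\<forall>\<^sub>F \<epsilon> in at_right 0. \<forall>s\<in>{c..d}. norm (v \<epsilon> s) \<le> \<epsilon> powr (Q + m)"
    using neg cd unfolding locally_negligible_def by blast
  moreover have "\<forall>\<^sub>F \<epsilon> in at_right 0. 3 * \<epsilon> powr Q \<le> \<epsilon> powr q"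
    by (rule eventually_mult_powr_le) (simp add: Q_def)
  ultimately show "\<forall>\<^sub>F \<epsilon> in at_right 0. \<forall>s\<in>K. norm (v' \<epsilon> s) \<le> \<epsilon> powr q"
    using eventually_params p0
  proof eventually_elim
    case (elim \<epsilon>)
    have m: "0 < \<epsilon> powr m" "\<epsilon> powr m \<le> (d - c) / 2"
      using elim(2,5) cd(1) by (auto simp: field_simps)
    show ?case
    proof
      fix s assume "s \<in> K"
      then have s: "s \<in> {c..d}" using cd by auto
      \<comment> \<open>The sign of the step points into the longer part of the interval, so that \<open>s + h\<close> stays in it.\<close>
      define h where "h = (if s \<le> (c + d) / 2 then \<epsilon> powr m else - (\<epsilon> powr m))"
      have h: "\<bar>h\<bar> = \<epsilon> powr m" by (simp add: h_def)
      have "s + (if s \<le> (c + d) / 2 then e else - e) \<in> {c..d}" if "0 < e" "e \<le> (d - c) / 2" for e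
        using s that by (auto simp: field_simps)
      from this[OF m] have sh: "s + h \<in> {c..d}" by (simp add: h_def)
      have seg: "closed_segment s (s + h) \<subseteq> {c..d}"
        using s sh by (intro closed_segment_subset) auto
      have len: "\<bar>x - s\<bar> \<le> \<epsilon> powr m" if "x \<in> closed_segment s (s + h)" for x
        using that h by (auto simp: closed_segment_eq_real_ivl split: if_splits)
      have "norm (v \<epsilon> (s + h) - v \<epsilon> s - (s + h - s) *\<^sub>R w \<epsilon> s) \<le> norm (s + h - s) * \<epsilon> powr Q"
      proof (rule vector_differentiable_bound_linearization)
        fix x assume x: "x \<in> closed_segment s (s + h)"
        show "(v \<epsilon> has_vector_derivative w \<epsilon> x) (at x within closed_segment s (s + h))"
          by (rule has_vector_derivative_within_subset[of _ _ _ J]) (use w elim x seg cd in auto)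
        have "norm (w \<epsilon> x - w \<epsilon> s) \<le> \<epsilon> powr (- p) * norm (x - s)"
        proof (rule differentiable_bound[of "{c..d}" "w \<epsilon>" "\<lambda>x t. t *\<^sub>R w' \<epsilon> x"])
          fix x assume x: "x \<in> {c..d}"
          show "(w \<epsilon> has_derivative (\<lambda>t. t *\<^sub>R w' \<epsilon> x)) (at x within {c..d})"
            unfolding has_vector_derivative_def[symmetric]
            by (rule has_vector_derivative_within_subset[of _ _ _ J]) (use w elim x cd in auto)
          have "norm (w' \<epsilon> x) \<le> \<epsilon> powr (- p)" using elim(6,1) x by force
          then show "onorm (\<lambda>t. t *\<^sub>R w' \<epsilon> x) \<le> \<epsilon> powr (- p)"
            by (intro onorm_le) (simp add: mult.commute[of _ "\<bar>_\<bar>"] mult_left_mono)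
        qed (use x seg s in auto)
        also have "\<dots> \<le> \<epsilon> powr (- p) * \<epsilon> powr m"
          using len[OF x] by (intro mult_left_mono) auto
        finally show "norm (w \<epsilon> x - w \<epsilon> s) \<le> \<epsilon> powr Q"
          by (simp add: m_def flip: powr_add)
      qed auto
      then have "norm (h *\<^sub>R w \<epsilon> s) \<le> norm (v \<epsilon> (s + h)) + norm (v \<epsilon> s) + \<epsilon> powr m * \<epsilon> powr Q"
        using h norm_triangle_ineq4[of "v \<epsilon> (s + h)" "v \<epsilon> s"]
          norm_triangle_ineq2[of "h *\<^sub>R w \<epsilon> s" "v \<epsilon> (s + h) - v \<epsilon> s"]
        by (simp add: norm_minus_commute)
      also have "\<dots> \<le> \<epsilon> powr (Q + m) + \<epsilon> powr (Q + m) + \<epsilon> powr m * \<epsilon> powr Q"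
        using elim(3) s sh by (intro add_mono) auto
      also have "\<dots> = \<epsilon> powr m * (3 * \<epsilon> powr Q)"
        by (simp add: powr_add)
      finally have "norm (w \<epsilon> s) \<le> 3 * \<epsilon> powr Q"
        using m h by simp
      then show "norm (v' \<epsilon> s) \<le> \<epsilon> powr q"
        using elim(4,5) v'_eq s cd by force
    qed
  qed
qed

end

section \<open>Global solutions for a fixed parameter\<close>

lemma has_partials_on_subset:
  assumes "has_partials_on S f D" "T \<subseteq> S"
  shows "has_partials_on T f D"
  unfolding has_partials_on_def
proof (intro ballI)
  fix b x :: 'a assume "b \<in> Basis" "x \<in> T"
  then have "((\<lambda>h. f (x + h *\<^sub>R b)) has_vector_derivative D b x) (at 0 within {h. x + h *\<^sub>R b \<in> S})"
    using assms unfolding has_partials_on_def by blast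
  then show "((\<lambda>h. f (x + h *\<^sub>R b)) has_vector_derivative D b x) (at 0 within {h. x + h *\<^sub>R b \<in> T})"
    by (rule has_vector_derivative_within_subset) (use assms(2) in auto)
qed

text \<open>
The estimate for fixed time is obtained on the slice \<open>{t} \<times> UNIV\<close>, which is again an interval.
There the partial derivative in time is taken at an isolated point and is unconstrained, so that the
partial derivatives of \<open>f\<close> on the full domain can be used. The radius \<open>3 * R\<close> covers all
points whose distance from \<open>y\<close> is at most \<open>norm (z - y) \<le> 2 * R\<close>.
\<close>

lemma lipschitz_in_space:
  fixes f :: "real \<times> 'a::euclidean_space \<Rightarrow> 'b::real_normed_vector" and M :: real
  assumes D: "has_partials_on (J \<times> UNIV) f D" and t: "t \<in> J"
    and bound: "\<And>b x. \<lbrakk>b \<in> Basis; norm x \<le> 3 * R\<rbrakk> \<Longrightarrow> norm (D b (t, x)) \<le> M"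
    and yz: "norm y \<le> R" "norm z \<le> R"
  shows "norm (f (t, z) - f (t, y)) \<le> DIM(real \<times> 'a) * M * norm (z - y)"
proof -
  have "norm (f (t, z) - f (t, y)) \<le> DIM(real \<times> 'a) * M * norm ((t, z) - (t, y))"
  proof (rule lipschitz_from_partials[of "{t} \<times> UNIV"])
    show "has_partials_on ({t} \<times> UNIV) f D"
      by (rule has_partials_on_subset[OF D]) (use t in auto)
    show "norm (D b w) \<le> M"
      if "b \<in> Basis" "w \<in> {t} \<times> UNIV" "norm (w - (t, y)) \<le> norm ((t, z) - (t, y))" for b w
    proof -
      obtain x where x: "w = (t, x)" using \<open>w \<in> {t} \<times> UNIV\<close> by auto
      have "norm (x - y) \<le> norm (z - y)" using that(3) x by (simp add: norm_Pair)
      then have "norm x \<le> 3 * R"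
        using norm_triangle_ineq2[of x y] norm_triangle_ineq4[of z y] yz by linarith
      then show ?thesis unfolding x by (rule bound[OF that(1)])
    qed
  qed (auto intro!: is_interval_Times_UNIV simp: is_interval_1)
  then show ?thesis by (simp add: norm_Pair)
qed

context time_interval
begin

lemma at_within_interval:
  assumes "\<And>y. y \<in> J \<Longrightarrow> \<bar>y - s\<bar> < \<eta> \<Longrightarrow> y \<in> {c..d}" "{c..d} \<subseteq> J" "0 < \<eta>"
  shows "at s within J = at s within {c..d}"
proof (rule at_within_nhd[of s "ball s \<eta>"])
  show "J \<inter> ball s \<eta> - {s} = {c..d} \<inter> ball s \<eta> - {s}"
    using assms(1,2) by (force simp: dist_real_def abs_minus_commute)
qed (use assms(3) in auto)

lemma antiderivative_exists:
  fixes g :: "real \<Rightarrow> 'b::banach"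
  assumes g: "continuous_on J g" and t0: "t0 \<in> J"
  shows "\<exists>G. G t0 = x0 \<and> (\<forall>s\<in>J. (G has_vector_derivative g s) (at s within J))"
proof -
  define G where "G s = x0 + (if t0 \<le> s then integral {t0..s} g else - integral {s..t0} g)" for s
  have "(G has_vector_derivative g s) (at s within J)" if s: "s \<in> J" for s
  proof -
    obtain c d \<eta> where cd: "c < d" "{c..d} \<subseteq> J" "{t0, s} \<subseteq> {c..d}" "0 < \<eta>"
      and nbhd: "\<And>x y. \<lbrakk>x \<in> {t0, s}; y \<in> J; \<bar>y - x\<bar> < \<eta>\<rbrakk> \<Longrightarrow> y \<in> {c..d}"
      using compact_in_interval[of "{t0, s}"] t0 s by (metis bot.extremum finite.emptyI finite.insertI
          finite_imp_compact insert_subset)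
    have cont: "continuous_on {c..d} g" using g cd(2) continuous_on_subset by blast
    have int: "g integrable_on {p..q}" if "c \<le> p" "q \<le> d" for p q
      using cont that by (intro integrable_continuous_real continuous_on_subset[OF cont]) auto
    have G: "G r = (x0 - integral {c..t0} g) + integral {c..r} g" if "r \<in> {c..d}" for r
    proof (cases "t0 \<le> r")
      case True
      have "integral {c..t0} g + integral {t0..r} g = integral {c..r} g"
        using True that cd by (intro Henstock_Kurzweil_Integration.integral_combine int) auto
      then show ?thesis using True by (simp add: G_def algebra_simps)
    next
      case False
      have "integral {c..r} g + integral {r..t0} g = integral {c..t0} g"
        using False that cd by (intro Henstock_Kurzweil_Integration.integral_combine int) auto
      then show ?thesis using False by (simp add: G_def algebra_simps)
    qed
    have "((\<lambda>r. (x0 - integral {c..t0} g) + integral {c..r} g) has_vector_derivative 0 + g s)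
        (at s within {c..d})"
      using cd(3) by (intro has_vector_derivative_add has_vector_derivative_const
          integral_has_vector_derivative[OF cont]) auto
    then have "((\<lambda>r. (x0 - integral {c..t0} g) + integral {c..r} g) has_vector_derivative g s)
        (at s within {c..d})" by simp
    then have "(G has_vector_derivative g s) (at s within {c..d})"
      by (rule has_vector_derivative_cong_on) (use G cd(3) in auto)
    then show ?thesis
      using at_within_interval[of s \<eta> c d] nbhd[of s] cd by simp
  qed
  then show ?thesis by (intro exI[of _ G]) (simp add: G_def)
qed

text \<open>
The exceptional null set is invisible to the integral, so a bound on the derivative that holds almost
everywhere is enough.
\<close>

lemma growth_bound:
  fixes v :: "real \<Rightarrow> 'b::euclidean_space"
  assumes v: "\<And>s. s \<in> J \<Longrightarrow> (v has_vector_derivative g s) (at s within J)"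
    and N: "negligible N" and bound: "\<And>s. s \<in> J - N \<Longrightarrow> norm (g s) \<le> \<beta> s"
    and \<beta>: "locally_integrable_on \<beta> J" and rs: "r \<in> J" "s \<in> J" "r \<le> s"
  shows "norm (v s - v r) \<le> integral {r..s} \<beta>"
proof -
  have sub: "{r..s} \<subseteq> J" using rs atLeastAtMost_subset by blast
  have g: "(g has_integral (v s - v r)) {r..s}"
    using rs(3) by (rule fundamental_theorem_of_calculus)
      (use v sub in \<open>blast intro: has_vector_derivative_within_subset\<close>)
  have \<beta>i: "\<beta> integrable_on {r..s}"
    using \<beta> sub unfolding locally_integrable_on_def by (blast intro: absolutely_integrable_on_def[THEN iffD1, THEN conjunct1])
  \<comment> \<open>The majorant is corrected on the null set, where \<open>\<beta>\<close> need not bound \<open>g\<close>.\<close>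
  define b where "b x = (if x \<in> N then norm (g x) else \<beta> x)" for x
  have "b integrable_on {r..s}"
    by (rule integrable_spike[OF \<beta>i N]) (simp add: b_def)
  then have "norm (integral {r..s} g) \<le> integral {r..s} b"
    by (intro integral_norm_bound_integral) (use g bound sub in \<open>auto simp: b_def has_integral_integrable subset_iff\<close>)
  also have "integral {r..s} b = integral {r..s} \<beta>"
    by (rule integral_spike[OF N]) (simp add: b_def)
  finally show ?thesis using integral_unique[OF g] by simp
qed

lemma integral_mono_interval:
  assumes \<beta>: "locally_integrable_on \<beta> J" and nonneg: "\<And>s. s \<in> J \<Longrightarrow> 0 \<le> \<beta> s"
    and "{c..d} \<subseteq> J" "{r..s} \<subseteq> {c..d}"
  shows "integral {r..s} \<beta> \<le> integral {c..d} \<beta>"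
proof -
  have "\<beta> integrable_on {p..q}" if "{p..q} \<subseteq> J" for p q
    using \<beta> that unfolding locally_integrable_on_def absolutely_integrable_on_def by blast
  then show ?thesis
    using assms(3,4) nonneg by (intro integral_subset_le) (blast+)
qed

lemma locally_lipschitz_in_space:
  fixes f :: "real \<times> 'a::euclidean_space \<Rightarrow> 'b::real_normed_vector"
  assumes f: "smooth_on (J \<times> UNIV) f" and K: "compact K" "K \<subseteq> J"
  shows "\<exists>L>0. \<forall>t\<in>K. \<forall>y z. norm y \<le> R \<longrightarrow> norm z \<le> R \<longrightarrow>
    norm (f (t, z) - f (t, y)) \<le> L * norm (z - y)"
proof -
  let ?D = "\<lambda>b. partials_within (J \<times> UNIV) [b] f"
  have "\<exists>B. \<forall>w\<in>K \<times> cball 0 (3 * R). norm (?D b w) \<le> B" if "b \<in> Basis" for b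
  proof -
    have "continuous_on (K \<times> cball 0 (3 * R)) (?D b)"
      by (rule continuous_on_subset[OF smooth_on_continuous[OF f]]) (use that K in auto)
    moreover have "compact (K \<times> cball (0::'a) (3 * R))"
      by (intro compact_Times compact_cball K)
    ultimately have "bounded (?D b ` (K \<times> cball 0 (3 * R)))"
      by (intro compact_imp_bounded compact_continuous_image)
    then show ?thesis by (auto simp: bounded_iff)
  qed
  then obtain B where B: "\<And>b w. b \<in> Basis \<Longrightarrow> w \<in> K \<times> cball 0 (3 * R) \<Longrightarrow> norm (?D b w) \<le> B b"
    by metis
  define M where "M = Max (insert 1 (B ` Basis))"
  have M: "1 \<le> M" "\<And>b. b \<in> Basis \<Longrightarrow> B b \<le> M"
    unfolding M_def by (intro Max_ge; simp)+
  have part: "has_partials_on (J \<times> UNIV) f ?D"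
    using smooth_on_has_partials[OF f, of "[]"] by simp
  show ?thesis
  proof (intro exI[of _ "DIM(real \<times> 'a) * M"] conjI ballI allI impI)
    show "norm (f (t, z) - f (t, y)) \<le> DIM(real \<times> 'a) * M * norm (z - y)"
      if "t \<in> K" "norm y \<le> R" "norm z \<le> R" for t y z
    proof (rule lipschitz_in_space[OF part _ _ that(2,3)])
      show "norm (?D b (t, x)) \<le> M" if "b \<in> Basis" "norm x \<le> 3 * R" for b x
        using B[OF that(1), of "(t, x)"] M(2)[OF that(1)] that(2) \<open>t \<in> K\<close> by auto
    qed (use that K in auto)
  qed (use M in simp)
qed

text \<open>
One Picard step in a weighted norm. The weight \<open>exp (2 * L * \<bar>s - t0\<bar>)\<close> is chosen such that integration gains
the factor \<open>1 / (2 * L)\<close>, which turns the Lipschitz constant \<open>L\<close> into the contraction factor \<open>1 / 2\<close>,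
however long the interval is.
\<close>

lemma exp_weighted_bound:
  fixes w :: "real \<Rightarrow> 'b::real_normed_vector"
  assumes cd: "{c..d} \<subseteq> J" "t0 \<in> {c..d}" and "0 < L" "0 \<le> E"
    and w: "\<And>s. s \<in> J \<Longrightarrow> (w has_vector_derivative g s) (at s within J)" "w t0 = 0"
    and bound: "\<And>s. s \<in> {c..d} \<Longrightarrow> norm (g s) \<le> L * (E * exp (2 * L * \<bar>s - t0\<bar>))"
    and s: "s \<in> {c..d}"
  shows "norm (w s) \<le> E / 2 * exp (2 * L * \<bar>s - t0\<bar>)"
proof -
  have cont: "continuous_on {p..q} w" if "{p..q} \<subseteq> {c..d}" for p q
    using that cd by (intro continuous_on_subset[OF continuous_on_vector_derivative[OF w(1)]]) auto
  have deriv: "(w has_vector_derivative g r) (at r)" if "p < r" "r < q" "{p..q} \<subseteq> {c..d}" for p q r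
  proof -
    have "(w has_vector_derivative g r) (at r within {p<..<q})"
      using that cd by (intro has_vector_derivative_within_subset[OF w(1)]) auto
    moreover have "at r within {p<..<q} = at r"
      by (rule at_within_open) (use that in auto)
    ultimately show ?thesis by simp
  qed
  consider "s = t0" | "t0 < s" | "s < t0" by linarith
  then show ?thesis
  proof cases
    case 1
    then show ?thesis using assms by simp
  next
    case 2
    let ?\<phi> = "\<lambda>r. E / 2 * exp (2 * L * (r - t0))"
    have sub: "{t0..s} \<subseteq> {c..d}" using s cd by auto
    have "norm (w s - w t0) \<le> ?\<phi> s - ?\<phi> t0"
    proof (rule differentiable_bound_general[OF 2 cont[OF sub]])
      show "(?\<phi> has_vector_derivative L * (E * exp (2 * L * (r - t0)))) (at r)" for r
        by (auto intro!: derivative_eq_intros simp flip: has_real_derivative_iff_has_vector_derivative)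
      show "norm (g r) \<le> L * (E * exp (2 * L * (r - t0)))" if "t0 < r" "r < s" for r
        using bound[of r] that sub by auto
    qed (use deriv sub in \<open>auto intro!: continuous_intros\<close>)
    then show ?thesis using 2 w(2) \<open>0 \<le> E\<close> by simp
  next
    case 3
    let ?\<phi> = "\<lambda>r. - (E / 2 * exp (2 * L * (t0 - r)))"
    have sub: "{s..t0} \<subseteq> {c..d}" using s cd by auto
    have "norm (w t0 - w s) \<le> ?\<phi> t0 - ?\<phi> s"
    proof (rule differentiable_bound_general[OF 3 cont[OF sub]])
      show "(?\<phi> has_vector_derivative L * (E * exp (2 * L * (t0 - r)))) (at r)" for r
        by (auto intro!: derivative_eq_intros simp flip: has_real_derivative_iff_has_vector_derivative)
      show "norm (g r) \<le> L * (E * exp (2 * L * (t0 - r)))" if "s < r" "r < t0" for r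
        using bound[of r] that sub by auto
    qed (use deriv sub in \<open>auto intro!: continuous_intros\<close>)
    then show ?thesis using 3 w(2) \<open>0 \<le> E\<close> by simp
  qed
qed

text \<open>
The Picard iterates are defined on all of \<open>J\<close> and, since at almost every time \<open>\<beta>\<close> bounds the field
on all of space, remain in one ball over each compact time interval. On that ball the field is
Lipschitz, and the increments of the iterates decay geometrically in the weighted norm, so that
the iterates converge locally uniformly on all of \<open>J\<close>.
\<close>

lemma global_solution_exists:
  fixes a :: "real \<times> 'a::euclidean_space \<Rightarrow> 'a"
  assumes a: "smooth_on (J \<times> UNIV) a" and N: "negligible N"
    and bound: "\<And>t x. t \<in> J - N \<Longrightarrow> norm (a (t, x)) \<le> \<beta> t"
    and \<beta>: "locally_integrable_on \<beta> J" and nonneg: "\<And>s. s \<in> J \<Longrightarrow> 0 \<le> \<beta> s"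
    and t0: "t0 \<in> J"
  obtains u where "u t0 = x0" "\<And>s. s \<in> J \<Longrightarrow> (u has_vector_derivative a (s, u s)) (at s within J)"
proof -
  have cont_a: "continuous_on (J \<times> UNIV) a"
    using smooth_on_continuous[OF a, of "[]"] by simp
  have "\<exists>w. w t0 = x0 \<and> (\<forall>s\<in>J. (w has_vector_derivative a (s, v s)) (at s within J))"
    if "continuous_on J v" for v
    by (rule antiderivative_exists[OF continuous_on_graph[OF cont_a that] t0])
  then obtain \<Phi> where \<Phi>: "\<And>v. continuous_on J v \<Longrightarrow> \<Phi> v t0 = x0"
    "\<And>v s. continuous_on J v \<Longrightarrow> s \<in> J \<Longrightarrow> (\<Phi> v has_vector_derivative a (s, v s)) (at s within J)"
    by metis
  define V where "V k = (\<Phi> ^^ k) (\<lambda>_. x0)" for k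
  have V_cont: "continuous_on J (V k)" for k
  proof (induction k)
    case (Suc k)
    then show ?case unfolding V_def funpow.simps o_apply
      by (intro continuous_on_vector_derivative[OF \<Phi>(2)])
  qed (simp add: V_def)
  have V_t0: "V k t0 = x0" for k
    by (cases k) (use \<Phi>(1)[OF V_cont] in \<open>auto simp: V_def\<close>)
  have V_deriv: "(V (Suc k) has_vector_derivative a (s, V k s)) (at s within J)" if "s \<in> J" for k s
    using \<Phi>(2)[OF V_cont that, of k] by (simp add: V_def)
  define u where "u s = x0 + (\<Sum>i. V (Suc i) s - V i s)" for s
  have key: "uniform_limit {c..d} V u sequentially \<and>
      (\<forall>s\<in>{c..d}. (u has_vector_derivative a (s, u s)) (at s within {c..d}))"
    if cd: "c \<in> J" "d \<in> J" "t0 \<in> {c..d}" for c d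
  proof -
    have sub: "{c..d} \<subseteq> J" using cd atLeastAtMost_subset by blast
    define M where "M = integral {c..d} \<beta>"
    have M: "0 \<le> M"
      unfolding M_def using \<beta> nonneg sub by (intro integral_nonneg)
        (auto simp: locally_integrable_on_def absolutely_integrable_on_def)
    have V_bound: "norm (V k s - x0) \<le> M" if s: "s \<in> {c..d}" for k s
    proof (cases k)
      case 0
      then show ?thesis using M by (simp add: V_def)
    next
      case (Suc j)
      note gb = growth_bound[OF V_deriv N bound \<beta>]
      have sJ: "s \<in> J" using s sub by blast
      show ?thesis
      proof (cases "t0 \<le> s")
        case True
        have "norm (V (Suc j) s - V (Suc j) t0) \<le> integral {t0..s} \<beta>"
          by (rule gb) (use True t0 sJ in auto)
        also have "\<dots> \<le> M"
          unfolding M_def by (rule integral_mono_interval[OF \<beta> nonneg sub]) (use s cd in auto)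
        finally show ?thesis using V_t0 Suc by simp
      next
        case False
        have "norm (V (Suc j) t0 - V (Suc j) s) \<le> integral {s..t0} \<beta>"
          by (rule gb) (use False t0 sJ in auto)
        also have "\<dots> \<le> M"
          unfolding M_def by (rule integral_mono_interval[OF \<beta> nonneg sub]) (use s cd in auto)
        finally show ?thesis using V_t0 Suc by (simp add: norm_minus_commute)
      qed
    qed
    define R where "R = norm x0 + M"
    have V_norm: "norm (V k s) \<le> R" if "s \<in> {c..d}" for k s
      using V_bound[OF that, of k] norm_triangle_ineq2[of "V k s" x0] unfolding R_def by linarith
    obtain L where L: "0 < L" "\<And>t y z. \<lbrakk>t \<in> {c..d}; norm y \<le> R; norm z \<le> R\<rbrakk> \<Longrightarrow>
        norm (a (t, z) - a (t, y)) \<le> L * norm (z - y)"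
      using locally_lipschitz_in_space[OF a compact_Icc sub, of R] by blast
    have weighted: "norm (V (Suc k) s - V k s) \<le> M * (1 / 2) ^ k * exp (2 * L * \<bar>s - t0\<bar>)"
      if "s \<in> {c..d}" for k s
      using that
    proof (induction k arbitrary: s)
      case 0
      have "M * 1 \<le> M * exp (2 * L * \<bar>s - t0\<bar>)" using M L by (intro mult_left_mono) auto
      then show ?case using V_bound[OF 0, of 1] by (simp add: V_def)
    next
      case (Suc k)
      have "norm (V (Suc (Suc k)) s - V (Suc k) s) \<le> (M * (1 / 2) ^ k) / 2 * exp (2 * L * \<bar>s - t0\<bar>)"
      proof (rule exp_weighted_bound[OF sub cd(3) L(1)])
        show "((\<lambda>s. V (Suc (Suc k)) s - V (Suc k) s) has_vector_derivative
            a (r, V (Suc k) r) - a (r, V k r)) (at r within J)" if "r \<in> J" for r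
          by (intro has_vector_derivative_diff V_deriv that)
        show "norm (a (r, V (Suc k) r) - a (r, V k r)) \<le> L * (M * (1 / 2) ^ k * exp (2 * L * \<bar>r - t0\<bar>))"
          if "r \<in> {c..d}" for r
          using L(2)[OF that V_norm[OF that] V_norm[OF that]] Suc.IH[OF that] L(1)
          by (meson less_imp_le mult_left_mono order_trans)
      qed (use M V_t0 Suc.prems in auto)
      then show ?case by simp
    qed
    define E where "E = M * exp (2 * L * (d - c))"
    have incr: "norm (V (Suc k) s - V k s) \<le> E * (1 / 2) ^ k" if s: "s \<in> {c..d}" for k s
    proof -
      have "M * (1 / 2) ^ k * exp (2 * L * \<bar>s - t0\<bar>) \<le> M * (1 / 2) ^ k * exp (2 * L * (d - c))"
        using M L(1) s cd by (intro mult_left_mono) auto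
      then show ?thesis using weighted[OF s, of k] by (simp add: E_def mult_ac)
    qed
    have "uniform_limit {c..d} (\<lambda>n s. \<Sum>i<n. V (Suc i) s - V i s) (\<lambda>s. \<Sum>i. V (Suc i) s - V i s) sequentially"
      by (rule Weierstrass_m_test[OF incr]) (auto intro!: summable_mult summable_geometric)
    then have "uniform_limit {c..d} (\<lambda>n s. x0 + (\<Sum>i<n. V (Suc i) s - V i s)) u sequentially"
      unfolding u_def by (intro uniform_limit_intros)
    moreover have "x0 + (\<Sum>i<n. V (Suc i) s - V i s) = V n s" for n s
      by (subst sum_lessThan_telescope) (simp add: V_def)
    ultimately have lim: "uniform_limit {c..d} V u sequentially" by simp
    have u_norm: "norm (u s) \<le> R" if "s \<in> {c..d}" for s
      using tendsto_uniform_limitI[OF lim that] V_norm[OF that]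
      by (intro tendsto_upperbound[OF tendsto_norm]) auto
    have "\<exists>g. \<forall>s\<in>{c..d}. (\<lambda>n. V (Suc n) s) \<longlonglongrightarrow> g s \<and>
        (g has_derivative (\<lambda>h. h *\<^sub>R a (s, u s))) (at s within {c..d})"
    proof (rule has_derivative_sequence)
      show "(V (Suc n) has_derivative (\<lambda>h. h *\<^sub>R a (s, V n s))) (at s within {c..d})"
        if "s \<in> {c..d}" for n s
        unfolding has_vector_derivative_def[symmetric]
        by (rule has_vector_derivative_within_subset[OF V_deriv sub]) (use that sub in auto)
      show "\<forall>\<^sub>F n in sequentially. \<forall>s\<in>{c..d}. \<forall>h.
          norm (h *\<^sub>R a (s, V n s) - h *\<^sub>R a (s, u s)) \<le> e * norm h" if "e > 0" for e
      proof -
        have "0 < e / L" using that L by simp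
        with lim have "\<forall>\<^sub>F n in sequentially. \<forall>s\<in>{c..d}. dist (V n s) (u s) < e / L"
          by (rule uniform_limitD)
        then show ?thesis
        proof eventually_elim
          case (elim n)
          show ?case
          proof (intro ballI allI)
            fix s h assume s: "s \<in> {c..d}"
            have "norm (a (s, V n s) - a (s, u s)) \<le> L * norm (V n s - u s)"
              by (rule L(2)[OF s u_norm[OF s] V_norm[OF s]])
            also have "\<dots> \<le> L * (e / L)"
              using elim s L(1) by (intro mult_left_mono) (auto simp: dist_norm less_imp_le)
            finally have "\<bar>h\<bar> * norm (a (s, V n s) - a (s, u s)) \<le> \<bar>h\<bar> * e"
              using L(1) by (intro mult_left_mono) auto
            then show "norm (h *\<^sub>R a (s, V n s) - h *\<^sub>R a (s, u s)) \<le> e * norm h"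
              by (simp add: mult.commute flip: scaleR_diff_right)
          qed
        qed
      qed
      show "(\<lambda>n. V (Suc n) t0) \<longlonglongrightarrow> x0" by (simp add: V_t0)
    qed (use cd in auto)
    then obtain g where g: "\<And>s. s \<in> {c..d} \<Longrightarrow> (\<lambda>n. V (Suc n) s) \<longlonglongrightarrow> g s"
      "\<And>s. s \<in> {c..d} \<Longrightarrow> (g has_derivative (\<lambda>h. h *\<^sub>R a (s, u s))) (at s within {c..d})" by blast
    have gu: "u s = g s" if "s \<in> {c..d}" for s
      using LIMSEQ_unique[OF LIMSEQ_Suc[OF tendsto_uniform_limitI[OF lim that]] g(1)[OF that]] .
    have "(u has_vector_derivative a (s, u s)) (at s within {c..d})" if "s \<in> {c..d}" for s
      using g(2)[OF that] unfolding has_vector_derivative_def[symmetric]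
      by (rule has_vector_derivative_cong_on) (use that gu in auto)
    then show ?thesis using lim by blast
  qed
  show thesis
  proof (rule that[of u])
    show "u t0 = x0" by (simp add: u_def V_t0)
    fix s assume s: "s \<in> J"
    obtain c d \<eta> where cd: "c \<in> J" "d \<in> J" "{c..d} \<subseteq> J" "{t0, s} \<subseteq> {c..d}" "0 < \<eta>"
      and nbhd: "\<And>x y. \<lbrakk>x \<in> {t0, s}; y \<in> J; \<bar>y - x\<bar> < \<eta>\<rbrakk> \<Longrightarrow> y \<in> {c..d}"
      using compact_in_interval[of "{t0, s}"] t0 s by (metis bot.extremum finite.emptyI finite.insertI
          finite_imp_compact insert_subset)
    show "(u has_vector_derivative a (s, u s)) (at s within J)"
      using key[of c d] cd at_within_interval[of s \<eta> c d] nbhd[of s] by simp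
  qed
qed

end

section \<open>Locally uniform subsequences and the generalized graph\<close>

context time_interval
begin

text \<open>
Rational end points alone do not suffice, since \<open>J\<close> may contain one or both of its own end points.
\<close>

lemma countable_exhaustion:
  obtains c d :: "nat \<Rightarrow> real" where "\<And>i. c i \<in> J" "\<And>i. d i \<in> J"
    "\<And>K. compact K \<Longrightarrow> K \<subseteq> J \<Longrightarrow> \<exists>i. K \<subseteq> {c i..d i}"
proof -
  define D where "D = (J \<inter> \<rat>) \<union> {x\<in>J. \<forall>y\<in>J. x \<le> y} \<union> {x\<in>J. \<forall>y\<in>J. y \<le> x}"
  have unique: "countable S" if "\<And>x y. x \<in> S \<Longrightarrow> y \<in> S \<Longrightarrow> x = y" for S :: "real set"
  proof (cases "S = {}")
    case False
    then obtain x where "x \<in> S" by blast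
    then have "S \<subseteq> {x}" using that by blast
    then show ?thesis by (rule countable_subset) simp
  qed simp
  have "countable D"
    unfolding D_def
    by (intro countable_Un countable_Int2 countable_rat unique) (auto intro: order_antisym)
  have below: "\<exists>x\<in>D. x \<le> c" if c: "c \<in> J" for c
  proof (cases "\<exists>y\<in>J. y < c")
    case True
    then obtain y where y: "y \<in> J" "y < c" by blast
    obtain q where q: "q \<in> \<rat>" "y < q" "q < c" using Rats_dense_in_real[OF y(2)] by blast
    then have "q \<in> J" using atLeastAtMost_subset[OF y(1) c] by auto
    then show ?thesis using q by (intro bexI[of _ q]) (auto simp: D_def)
  next
    case False
    then show ?thesis using c by (intro bexI[of _ c]) (auto simp: D_def not_less)
  qed
  have above: "\<exists>x\<in>D. d \<le> x" if d: "d \<in> J" for d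
  proof (cases "\<exists>y\<in>J. d < y")
    case True
    then obtain y where y: "y \<in> J" "d < y" by blast
    obtain q where q: "q \<in> \<rat>" "d < q" "q < y" using Rats_dense_in_real[OF y(2)] by blast
    then have "q \<in> J" using atLeastAtMost_subset[OF d y(1)] by auto
    then show ?thesis using q by (intro bexI[of _ q]) (auto simp: D_def)
  next
    case False
    then show ?thesis using d by (intro bexI[of _ d]) (auto simp: D_def not_less)
  qed
  obtain p where "p \<in> J" using two_points by metis
  then have ne: "D \<times> D \<noteq> {}" using below by auto
  have cnt: "countable (D \<times> D)" using \<open>countable D\<close> by simp
  let ?e = "from_nat_into (D \<times> D)"
  have e: "?e i \<in> D \<times> D" for i by (rule from_nat_into[OF ne])
  show thesis
  proof (rule that[of "\<lambda>i. fst (?e i)" "\<lambda>i. snd (?e i)"])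
    show "fst (?e i) \<in> J" "snd (?e i) \<in> J" for i
      using e[of i] by (auto simp: D_def mem_Times_iff)
    show "\<exists>i. K \<subseteq> {fst (?e i)..snd (?e i)}" if K: "compact K" "K \<subseteq> J" for K
    proof -
      obtain c d where cd: "c \<in> J" "d \<in> J" "K \<subseteq> {c..d}"
        using compact_in_interval[OF K] by metis
      obtain x y where xy: "x \<in> D" "y \<in> D" "x \<le> c" "d \<le> y"
        using below[OF cd(1)] above[OF cd(2)] by blast
      then obtain i where "?e i = (x, y)"
        using from_nat_into_surj[OF cnt, of "(x, y)"] by auto
      then show ?thesis using xy cd by (intro exI[of _ i]) auto
    qed
  qed
qed

text \<open>
The theorem of Arzela and Ascoli on each member of a countable exhaustion, followed by a diagonal
argument. Equicontinuity is measured by the increments of one function \<open>B\<close>, in the application an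
antiderivative of \<open>\<beta>\<close>, because \<open>\<beta>\<close> bounds the velocities for every parameter and not only for small ones.
\<close>

lemma locally_uniform_subsequence:
  fixes f :: "nat \<Rightarrow> real \<Rightarrow> 'b::euclidean_space"
  assumes bounded: "\<And>c d. c \<in> J \<Longrightarrow> d \<in> J \<Longrightarrow> \<exists>M. \<forall>n. \<forall>s\<in>{c..d}. norm (f n s) \<le> M"
    and equicont: "\<And>c d. c \<in> J \<Longrightarrow> d \<in> J \<Longrightarrow> \<exists>B. continuous_on {c..d} B \<and>
      (\<forall>n. \<forall>r\<in>{c..d}. \<forall>s\<in>{c..d}. norm (f n s - f n r) \<le> \<bar>B s - B r\<bar>)"
  obtains k :: "nat \<Rightarrow> nat" and g where "strict_mono k"
    "\<And>K. compact K \<Longrightarrow> K \<subseteq> J \<Longrightarrow> uniform_limit K (\<lambda>n. f (k n)) g sequentially"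
proof -
  obtain c d :: "nat \<Rightarrow> real" where cd: "\<And>i. c i \<in> J" "\<And>i. d i \<in> J"
    "\<And>K. compact K \<Longrightarrow> K \<subseteq> J \<Longrightarrow> \<exists>i. K \<subseteq> {c i..d i}"
    by (rule countable_exhaustion) blast
  define P where "P i r \<longleftrightarrow> (\<exists>g. uniform_limit {c i..d i} (\<lambda>n. f (r n)) g sequentially)"
    for i and r :: "nat \<Rightarrow> nat"
  have sub: "\<exists>k. strict_mono (k :: nat \<Rightarrow> nat) \<and> P i (r \<circ> k)" for i and r :: "nat \<Rightarrow> nat"
  proof -
    obtain M where M: "\<And>n s. s \<in> {c i..d i} \<Longrightarrow> norm (f n s) \<le> M"
      using bounded[OF cd(1,2)] by metis
    obtain B where B: "continuous_on {c i..d i} B"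
      "\<And>n r s. r \<in> {c i..d i} \<Longrightarrow> s \<in> {c i..d i} \<Longrightarrow> norm (f n s - f n r) \<le> \<bar>B s - B r\<bar>"
      using equicont[OF cd(1,2)] by metis
    obtain g k where gk: "strict_mono (k :: nat \<Rightarrow> nat)"
      "\<And>e. 0 < e \<Longrightarrow> \<exists>N. \<forall>n x. n \<ge> N \<and> x \<in> {c i..d i} \<longrightarrow> norm (f (r (k n)) x - g x) < e"
    proof (rule Arzela_Ascoli[of "{c i..d i}" "\<lambda>n. f (r n)" M])
      fix x e :: real assume x: "x \<in> {c i..d i}" and e: "0 < e"
      then obtain \<delta> where "\<delta> > 0" "\<And>y. y \<in> {c i..d i} \<Longrightarrow> dist y x < \<delta> \<Longrightarrow> dist (B y) (B x) < e"
        using B(1) unfolding continuous_on_iff by metis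
      then show "\<exists>\<delta>. 0 < \<delta> \<and> (\<forall>n y. y \<in> {c i..d i} \<and> norm (x - y) < \<delta> \<longrightarrow>
          norm (f (r n) x - f (r n) y) < e)"
        using B(2)[OF _ x] by (intro exI[of _ \<delta>])
          (auto simp: dist_real_def abs_minus_commute intro: le_less_trans)
    qed (use M in auto)
    have "P i (r \<circ> k)"
      unfolding P_def uniform_limit_iff eventually_sequentially
      by (intro exI[of _ g]) (use gk(2) in \<open>force simp: dist_norm\<close>)
    then show ?thesis using gk(1) by blast
  qed
  have mono: "P i (r \<circ> k2)"
    if P1: "P i (r \<circ> k1)" and k12: "\<And>j. N \<le> j \<Longrightarrow> \<exists>j'. j \<le> j' \<and> k2 j = k1 j'"
    for i r N and k1 k2 :: "nat \<Rightarrow> nat"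
  proof -
    obtain g where g: "uniform_limit {c i..d i} (\<lambda>n. f ((r \<circ> k1) n)) g sequentially"
      using P1 unfolding P_def by blast
    have "uniform_limit {c i..d i} (\<lambda>n. f ((r \<circ> k2) n)) g sequentially"
      unfolding uniform_limit_iff
    proof (intro allI impI)
      fix e :: real assume "0 < e"
      then obtain N1 where N1: "\<And>n x. n \<ge> N1 \<Longrightarrow> x \<in> {c i..d i} \<Longrightarrow> dist (f (r (k1 n)) x) (g x) < e"
        using g unfolding uniform_limit_iff eventually_sequentially o_def by blast
      show "\<forall>\<^sub>F n in sequentially. \<forall>x\<in>{c i..d i}. dist (f ((r \<circ> k2) n) x) (g x) < e"
        unfolding eventually_sequentially
      proof (intro exI[of _ "max N N1"] allI impI ballI)
        fix n x assume n: "max N N1 \<le> n" and x: "x \<in> {c i..d i}"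
        obtain j' where "n \<le> j'" "k2 n = k1 j'" using k12[of n] n by auto
        then show "dist (f ((r \<circ> k2) n) x) (g x) < e" using N1[of j' x] n x by simp
      qed
    qed
    then show ?thesis unfolding P_def by blast
  qed
  have "\<exists>k. strict_mono (k :: nat \<Rightarrow> nat) \<and> (\<forall>i. P i (id \<circ> k))"
  proof (rule subsequence_diagonalization_lemma[of P id])
    fix k :: "nat \<Rightarrow> nat" assume "strict_mono k" "\<And>i. P i (id \<circ> k)"
    then show ?thesis by blast
  qed (fact sub, fact mono)
  then obtain k where k: "strict_mono (k :: nat \<Rightarrow> nat)" "\<And>i. P i (id \<circ> k)" by blast
  obtain g where g: "\<And>i. uniform_limit {c i..d i} (\<lambda>n. f (k n)) (g i) sequentially"
    using k(2) unfolding P_def by (auto simp: o_def) metis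
  define h where "h s = lim (\<lambda>n. f (k n) s)" for s
  have gh: "g i s = h s" if "s \<in> {c i..d i}" for i s
    using tendsto_uniform_limitI[OF g that] unfolding h_def by (simp add: limI)
  show thesis
  proof (rule that[of k h])
    fix K assume "compact K" "K \<subseteq> J"
    then obtain i where "K \<subseteq> {c i..d i}" using cd(3) by blast
    moreover have "uniform_limit {c i..d i} (\<lambda>n. f (k n)) h sequentially"
      using g[of i] uniform_limit_cong'[of "{c i..d i}" "\<lambda>n. f (k n)" "\<lambda>n. f (k n)" "g i" h] gh by auto
    ultimately show "uniform_limit K (\<lambda>n. f (k n)) h sequentially"
      by (rule uniform_limit_on_subset[rotated])
  qed (rule k(1))
qed

end

lemma filterlim_nat_floor_inverse: "filterlim (\<lambda>\<epsilon>::real. nat \<lfloor>1 / \<epsilon>\<rfloor>) sequentially (at_right 0)"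
  unfolding filterlim_at_top
proof (rule allI)
  fix k :: nat
  show "\<forall>\<^sub>F \<epsilon>::real in at_right 0. k \<le> nat \<lfloor>1 / \<epsilon>\<rfloor>"
  proof (rule eventually_at_rightI[of 0 "1 / (real k + 1)"])
    fix \<epsilon> :: real assume "\<epsilon> \<in> {0<..<1 / (real k + 1)}"
    then have "real k \<le> 1 / \<epsilon>" by (simp add: field_simps)
    then show "k \<le> nat \<lfloor>1 / \<epsilon>\<rfloor>" by (simp add: le_nat_floor)
  qed simp
qed

lemma subnet_map_of_sequence:
  assumes "\<And>m::nat. e m \<in> params" "e \<longlonglongrightarrow> 0"
  shows "(\<lambda>\<epsilon>. e (nat \<lfloor>1 / \<epsilon>\<rfloor>)) \<in> subnet_maps"
  using assms filterlim_compose[OF assms(2) filterlim_nat_floor_inverse]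
  by (auto simp: subnet_maps_def)

lemma subnet_map_filterlim:
  assumes "\<tau> \<in> subnet_maps"
  shows "filterlim \<tau> (at_right 0) (at_right 0)"
proof (rule tendsto_imp_filterlim_at_right)
  show "(\<tau> \<longlongrightarrow> 0) (at_right 0)" using assms by (simp add: subnet_maps_def)
  show "\<forall>\<^sub>F \<epsilon> in at_right 0. 0 < \<tau> \<epsilon>"
    using eventually_params by eventually_elim (use assms in \<open>fastforce simp: subnet_maps_def\<close>)
qed

lemma filterlim_params_sequence:
  assumes "\<And>m::nat. e m \<in> params" "e \<longlonglongrightarrow> 0"
  shows "filterlim e (at_right 0) sequentially"
  using assms by (intro tendsto_imp_filterlim_at_right) (auto simp: eventually_sequentially)

text \<open>
The fibre of the generalized graph over \<open>x\<close>, described by sequences.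
\<close>

definition limit_values :: "(real \<Rightarrow> 'a::topological_space \<Rightarrow> 'b::topological_space) \<Rightarrow> 'a \<Rightarrow> 'b set" where
  "limit_values f x = {y. \<exists>e x'. (\<forall>m::nat. e m \<in> params) \<and> e \<longlonglongrightarrow> 0 \<and> x' \<longlonglongrightarrow> x \<and>
     (\<lambda>m. f (e m) (x' m)) \<longlonglongrightarrow> y}"

text \<open>
Both subnets in the definition of the graph can be sampled along a sequence, and conversely a
sequence becomes a net through \<open>\<epsilon> \<mapsto> \<lfloor>1 / \<epsilon>\<rfloor>\<close>.
\<close>

lemma net_graph_eq_limit_values: "net_graph UNIV UNIV f `` {x} = limit_values f x"
proof (intro set_eqI iffI)
  fix y assume "y \<in> net_graph UNIV UNIV f `` {x}"
  then obtain xs \<tau> \<sigma> where *: "\<tau> \<in> subnet_maps" "\<sigma> \<in> subnet_maps" "(xs \<longlongrightarrow> x) (at_right 0)"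
    "((\<lambda>\<epsilon>. f (\<tau> (\<sigma> \<epsilon>)) (xs (\<sigma> \<epsilon>))) \<longlongrightarrow> y) (at_right 0)"
    by (auto simp: net_graph_def cluster_point_def)
  define d where "d m = 1 / (real m + 1)" for m
  have d0: "d \<longlonglongrightarrow> 0"
    using LIMSEQ_inverse_real_of_nat unfolding d_def by (simp add: inverse_eq_divide add.commute)
  have dp: "d m \<in> params" for m by (simp add: d_def)
  note d = filterlim_params_sequence[OF dp d0]
  note \<sigma>d = filterlim_compose[OF subnet_map_filterlim[OF *(2)] d]
  show "y \<in> limit_values f x"
    unfolding limit_values_def mem_Collect_eq
  proof (intro exI[of _ "\<lambda>m. \<tau> (\<sigma> (d m))"] exI[of _ "\<lambda>m. xs (\<sigma> (d m))"] conjI allI)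
    show "\<tau> (\<sigma> (d m)) \<in> params" for m
      using *(1,2) dp[of m] unfolding subnet_maps_def by blast
    show "(\<lambda>m. \<tau> (\<sigma> (d m))) \<longlonglongrightarrow> 0"
      by (rule filterlim_compose[OF _ \<sigma>d]) (use * in \<open>auto simp: subnet_maps_def\<close>)
    show "(\<lambda>m. xs (\<sigma> (d m))) \<longlonglongrightarrow> x" by (rule filterlim_compose[OF *(3) \<sigma>d])
    show "(\<lambda>m. f (\<tau> (\<sigma> (d m))) (xs (\<sigma> (d m)))) \<longlonglongrightarrow> y" by (rule filterlim_compose[OF *(4) d])
  qed
next
  fix y assume "y \<in> limit_values f x"
  then obtain e x' where *: "\<And>m::nat. e m \<in> params" "e \<longlonglongrightarrow> 0" "x' \<longlonglongrightarrow> x"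
    "(\<lambda>m. f (e m) (x' m)) \<longlonglongrightarrow> y"
    by (auto simp: limit_values_def)
  let ?N = "\<lambda>\<epsilon>::real. nat \<lfloor>1 / \<epsilon>\<rfloor>"
  have id: "(\<lambda>\<epsilon>. \<epsilon>) \<in> subnet_maps" by (auto simp: subnet_maps_def)
  have "cluster_point (\<lambda>\<epsilon>. f (e (?N \<epsilon>)) (x' (?N \<epsilon>))) y"
    unfolding cluster_point_def
    by (rule bexI[OF _ id]) (rule filterlim_compose[OF *(4) filterlim_nat_floor_inverse])
  moreover have "((\<lambda>\<epsilon>. x' (?N \<epsilon>)) \<longlongrightarrow> x) (at_right 0)"
    by (rule filterlim_compose[OF *(3) filterlim_nat_floor_inverse])
  ultimately have "(x, y) \<in> net_graph UNIV UNIV f"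
    unfolding net_graph_def mem_Collect_eq prod.case
    by (intro conjI exI[of _ "\<lambda>\<epsilon>. x' (?N \<epsilon>)"] bexI[OF _ subnet_map_of_sequence[OF *(1,2)]]) auto
  then show "y \<in> net_graph UNIV UNIV f `` {x}" by blast
qed

lemma limit_values_negligible:
  fixes f g :: "real \<Rightarrow> 'a::euclidean_space \<Rightarrow> 'b::real_normed_vector"
  assumes neg: "locally_negligible UNIV (\<lambda>\<epsilon> x. f \<epsilon> x - g \<epsilon> x)"
  shows "limit_values f x \<subseteq> limit_values g x"
proof
  fix y assume "y \<in> limit_values f x"
  then obtain e x' where *: "\<And>m::nat. e m \<in> params" "e \<longlonglongrightarrow> 0" "x' \<longlonglongrightarrow> x"
    "(\<lambda>m. f (e m) (x' m)) \<longlonglongrightarrow> y"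
    by (auto simp: limit_values_def)
  have e: "filterlim e (at_right 0) sequentially" by (rule filterlim_params_sequence[OF *(1,2)])
  have "\<forall>\<^sub>F \<epsilon> in at_right 0. \<forall>x\<in>cball x 1. norm (f \<epsilon> x - g \<epsilon> x) \<le> \<epsilon> powr 1"
    using neg compact_cball unfolding locally_negligible_def by blast
  then have "\<forall>\<^sub>F m in sequentially. \<forall>x\<in>cball x 1. norm (f (e m) x - g (e m) x) \<le> e m powr 1"
    using e by (rule eventually_compose_filterlim)
  moreover have "\<forall>\<^sub>F m in sequentially. dist (x' m) x < 1"
    using *(3) by (rule tendstoD) simp
  ultimately have "\<forall>\<^sub>F m in sequentially. norm (f (e m) (x' m) - g (e m) (x' m)) \<le> e m"
  proof eventually_elim
    case (elim m)
    then show ?case using *(1)[of m] by (auto simp: dist_commute)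
  qed
  then have "(\<lambda>m. f (e m) (x' m) - g (e m) (x' m)) \<longlonglongrightarrow> 0"
    using *(2) by (rule Lim_null_comparison)
  from tendsto_diff[OF *(4) this] show "y \<in> limit_values g x"
    unfolding limit_values_def using * by auto
qed

lemma limit_values_cong:
  fixes f g :: "real \<Rightarrow> 'a::euclidean_space \<Rightarrow> 'b::real_normed_vector"
  assumes "locally_negligible UNIV (\<lambda>\<epsilon> x. f \<epsilon> x - g \<epsilon> x)"
  shows "limit_values f x = limit_values g x"
  using limit_values_negligible[of f g x] limit_values_negligible[of g f x] assms
    locally_negligible_minus_commute by blast

section \<open>The supporting function along a curve\<close>

text \<open>
The curve \<open>\<zeta>\<close> is the candidate for the limit of solutions. Boundedness of the field on compact sets, uniformly
for small parameters, makes its limit values along \<open>\<zeta>\<close> a nonempty bounded set, so that the suprema below are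
meaningful.
\<close>

locale locally_bounded_field = time_interval J for J :: "real set" +
  fixes a :: "real \<Rightarrow> real \<times> 'a::euclidean_space \<Rightarrow> 'a" and \<zeta> :: "real \<Rightarrow> 'a"
  assumes cont_field: "\<And>\<epsilon>. \<epsilon> \<in> params \<Longrightarrow> continuous_on (J \<times> UNIV) (a \<epsilon>)"
    and bounded_field: "\<And>K. compact K \<Longrightarrow> K \<subseteq> J \<times> UNIV \<Longrightarrow>
      \<exists>C. \<forall>\<^sub>F \<epsilon> in at_right 0. \<forall>z\<in>K. norm (a \<epsilon> z) \<le> C"
    and cont_\<zeta>: "continuous_on J \<zeta>"
begin

definition nearby :: "nat \<Rightarrow> (real \<times> 'a) set" where
  "nearby m = {\<epsilon>\<in>params. \<epsilon> < 1 / (real m + 1)} \<times> {q. norm q < 1 / (real m + 1)}"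

text \<open>
Largest component in direction \<open>w\<close> over all parameters and displacements smaller than
\<open>1 / (m + 1)\<close>; it decreases to the supporting function as \<open>m\<close> grows.
\<close>

definition envelope :: "'a \<Rightarrow> nat \<Rightarrow> real \<Rightarrow> real" where
  "envelope w m r = (SUP i\<in>nearby m. a (fst i) (r, \<zeta> r + snd i) \<bullet> w)"

definition support :: "'a \<Rightarrow> real \<Rightarrow> real" where
  "support w r = (SUP y\<in>limit_values (\<lambda>\<epsilon> x. a \<epsilon> (r, x)) (\<zeta> r). y \<bullet> w)"

lemma nearby_nonempty: "nearby m \<noteq> {}"
proof -
  have "(1 / (real m + 2), 0) \<in> nearby m" by (auto simp: nearby_def field_simps)
  then show ?thesis by blast
qed

lemma nearby_antimono: "m \<le> m' \<Longrightarrow> nearby m' \<subseteq> nearby m"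
proof -
  assume "m \<le> m'"
  then have "1 / (real m' + 1) \<le> 1 / (real m + 1)" by (simp add: field_simps)
  then show ?thesis by (auto simp: nearby_def)
qed

lemma nearby_eventually:
  assumes "\<And>n::nat. e n \<in> params" "e \<longlonglongrightarrow> 0" "x' \<longlonglongrightarrow> x"
  shows "\<forall>\<^sub>F n in sequentially. (e n, x' n - x) \<in> nearby m"
proof -
  have "\<forall>\<^sub>F n in sequentially. e n < 1 / (real m + 1)"
    using assms(2) by (rule order_tendstoD) simp
  moreover have "\<forall>\<^sub>F n in sequentially. dist (x' n) x < 1 / (real m + 1)"
    using assms(3) by (rule tendstoD) simp
  ultimately show ?thesis
    by eventually_elim (use assms(1) in \<open>auto simp: nearby_def dist_norm\<close>)
qed

lemma bound_near_\<zeta>: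
  assumes "{c..d} \<subseteq> J"
  obtains C m0 where "0 \<le> C"
    "\<And>r i m. \<lbrakk>r \<in> {c..d}; m0 \<le> m; i \<in> nearby m\<rbrakk> \<Longrightarrow> norm (a (fst i) (r, \<zeta> r + snd i)) \<le> C"
proof -
  have "compact (\<zeta> ` {c..d})"
    using assms by (intro compact_continuous_image continuous_on_subset[OF cont_\<zeta>]) auto
  then obtain R where R: "\<And>r. r \<in> {c..d} \<Longrightarrow> norm (\<zeta> r) \<le> R"
    using compact_imp_bounded[of "\<zeta> ` {c..d}"] unfolding bounded_iff by blast
  let ?K = "{c..d} \<times> cball (0::'a) (R + 1)"
  have "compact ?K" "?K \<subseteq> J \<times> UNIV"
    using assms by (auto intro!: compact_Times)
  then obtain C where "\<forall>\<^sub>F \<epsilon> in at_right 0. \<forall>z\<in>?K. norm (a \<epsilon> z) \<le> C"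
    using bounded_field by blast
  then obtain \<delta> where \<delta>: "0 < \<delta>" "\<And>\<epsilon> z. \<lbrakk>0 < \<epsilon>; \<epsilon> < \<delta>; z \<in> ?K\<rbrakk> \<Longrightarrow> norm (a \<epsilon> z) \<le> C"
    unfolding eventually_at_right_field by blast
  obtain m0 where m0: "1 / (real m0 + 1) < \<delta>"
    using \<delta>(1) reals_Archimedean[of \<delta>] by (auto simp: inverse_eq_divide add.commute)
  show thesis
  proof (rule that[of "\<bar>C\<bar>" m0])
    fix r i m assume r: "r \<in> {c..d}" and "m0 \<le> m" and i: "i \<in> nearby m"
    then have i: "i \<in> nearby m0" using nearby_antimono by blast
    have "1 / (real m0 + 1) \<le> 1" by simp
    moreover have "norm (snd i) < 1 / (real m0 + 1)" using i unfolding nearby_def by auto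
    ultimately have "norm (\<zeta> r + snd i) \<le> R + 1"
      using R[OF r] norm_triangle_ineq[of "\<zeta> r" "snd i"] by linarith
    then have "norm (a (fst i) (r, \<zeta> r + snd i)) \<le> C"
      using i m0 r by (intro \<delta>(2)) (auto simp: nearby_def)
    then show "norm (a (fst i) (r, \<zeta> r + snd i)) \<le> \<bar>C\<bar>" by linarith
  qed simp
qed

lemma inner_bound: "norm y \<le> C \<Longrightarrow> \<bar>y \<bullet> w\<bar> \<le> C * norm w" for y w :: 'a
  by (meson Cauchy_Schwarz_ineq2 mult_right_mono norm_ge_zero order_trans)

context
  fixes c d C and m0 :: nat and w :: 'a
  assumes cd: "{c..d} \<subseteq> J"
    and C: "\<And>r i m. \<lbrakk>r \<in> {c..d}; m0 \<le> m; i \<in> nearby m\<rbrakk> \<Longrightarrow> norm (a (fst i) (r, \<zeta> r + snd i)) \<le> C"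
begin

lemma envelope_bdd:
  assumes "r \<in> {c..d}" "m0 \<le> m"
  shows "bdd_above ((\<lambda>i. a (fst i) (r, \<zeta> r + snd i) \<bullet> w) ` nearby m)"
  using inner_bound[OF C[OF assms], of _ w] by (intro bdd_aboveI2[of _ _ "C * norm w"]) (simp add: abs_le_iff)

text \<open>
The family is uncountable, but a supremum of continuous functions is lower semicontinuous: its
superlevel sets are unions of relatively open sets.
\<close>

lemma envelope_measurable:
  assumes "m0 \<le> m"
  shows "envelope w m \<in> borel_measurable (lebesgue_on {c..d})"
proof (subst borel_measurable_iff_greater, rule allI)
  fix \<alpha> :: real
  let ?h = "\<lambda>i r. a (fst i) (r, \<zeta> r + snd i) \<bullet> w"
  have "{r \<in> {c..d}. \<alpha> < envelope w m r} = (\<Union>i\<in>nearby m. {r \<in> {c..d}. ?h i r \<in> {\<alpha><..}})"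
    (is "?U = _")
  proof (intro set_eqI)
    fix r
    show "r \<in> ?U \<longleftrightarrow> r \<in> (\<Union>i\<in>nearby m. {r \<in> {c..d}. ?h i r \<in> {\<alpha><..}})"
    proof (cases "r \<in> {c..d}")
      case True
      from less_cSUP_iff[OF nearby_nonempty envelope_bdd[OF True assms], of \<alpha>] True
      show ?thesis by (simp add: envelope_def)
    next
      case False
      then show ?thesis by (auto simp del: atLeastAtMost_iff)
    qed
  qed
  moreover have "openin (top_of_set {c..d}) {r \<in> {c..d}. ?h i r \<in> {\<alpha><..}}" if "i \<in> nearby m" for i
  proof -
    have "continuous_on J (\<lambda>r. a (fst i) (r, \<zeta> r + snd i))"
      using that by (intro continuous_on_graph[OF cont_field] continuous_on_add cont_\<zeta> continuous_on_const)
        (auto simp: nearby_def)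
    then have "continuous_on {c..d} (?h i)"
      using cd by (intro continuous_intros) (rule continuous_on_subset)
    then have "openin (top_of_set {c..d}) ({c..d} \<inter> ?h i -` {\<alpha><..})"
      by (intro continuous_openin_preimage_gen) auto
    then show ?thesis by (simp add: vimage_def Collect_conj_eq[symmetric] Int_def)
  qed
  ultimately have "openin (top_of_set {c..d}) {r \<in> {c..d}. \<alpha> < envelope w m r}"
    by (simp only:) (rule openin_Union, blast)
  then obtain T where "open T" "{r \<in> {c..d}. \<alpha> < envelope w m r} = {c..d} \<inter> T"
    by (auto simp: openin_open)
  then show "{r \<in> space (lebesgue_on {c..d}). \<alpha> < envelope w m r} \<in> sets (lebesgue_on {c..d})"
    by (auto simp: sets_restrict_space)
qed

lemma limit_value_le_envelope:
  assumes r: "r \<in> {c..d}" and m: "m0 \<le> m" and y: "y \<in> limit_values (\<lambda>\<epsilon> x. a \<epsilon> (r, x)) (\<zeta> r)"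
  shows "y \<bullet> w \<le> envelope w m r" and "norm y \<le> C"
proof -
  obtain e x' where *: "\<And>m::nat. e m \<in> params" "e \<longlonglongrightarrow> 0" "x' \<longlonglongrightarrow> \<zeta> r"
    "(\<lambda>m. a (e m) (r, x' m)) \<longlonglongrightarrow> y"
    using y by (auto simp: limit_values_def)
  note near = nearby_eventually[OF *(1,2,3), of m]
  have "\<forall>\<^sub>F n in sequentially. a (e n) (r, x' n) \<bullet> w \<le> envelope w m r"
    using near
  proof eventually_elim
    case (elim n)
    from cSUP_upper[OF elim envelope_bdd[OF r m]] show ?case by (simp add: envelope_def)
  qed
  then show "y \<bullet> w \<le> envelope w m r"
    by (intro tendsto_upperbound[OF tendsto_inner[OF *(4) tendsto_const]]) auto
  have "\<forall>\<^sub>F n in sequentially. norm (a (e n) (r, x' n)) \<le> C"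
    using near
  proof eventually_elim
    case (elim n)
    from C[OF r m elim] show ?case by simp
  qed
  then show "norm y \<le> C" by (intro tendsto_upperbound[OF tendsto_norm[OF *(4)]]) auto
qed

text \<open>
Choose parameters and displacements that almost attain the envelopes. The corresponding values are
bounded, and every accumulation point of them is a limit value that is as large as the infimum of
the envelopes.
\<close>

lemma limit_value_near_envelope:
  assumes r: "r \<in> {c..d}"
  obtains y where "y \<in> limit_values (\<lambda>\<epsilon> x. a \<epsilon> (r, x)) (\<zeta> r)"
    "\<And>l. (\<And>m. m0 \<le> m \<Longrightarrow> l \<le> envelope w m r) \<Longrightarrow> l \<le> y \<bullet> w"
proof -
  have "\<exists>i\<in>nearby m. envelope w m r - 1 / (real m + 1) < a (fst i) (r, \<zeta> r + snd i) \<bullet> w"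
    if "m0 \<le> m" for m
    using less_cSUP_iff[OF nearby_nonempty envelope_bdd[OF r that],
        of "envelope w m r - 1 / (real m + 1)"]
    by (simp add: envelope_def)
  then obtain i where i: "\<And>m. m0 \<le> m \<Longrightarrow> i m \<in> nearby m"
    "\<And>m. m0 \<le> m \<Longrightarrow> envelope w m r - 1 / (real m + 1) < a (fst (i m)) (r, \<zeta> r + snd (i m)) \<bullet> w"
    by metis
  define e where "e n = fst (i (n + m0))" for n
  define q where "q n = snd (i (n + m0))" for n
  define v where "v n = a (e n) (r, \<zeta> r + q n)" for n
  have near: "(e n, q n) \<in> nearby (n + m0)" for n
    using i(1)[of "n + m0"] by (simp add: e_def q_def)
  have v: "v n \<in> cball 0 C" for n
    using C[OF r _ near[of n]] by (simp add: v_def)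
  then obtain y k where y: "strict_mono (k :: nat \<Rightarrow> nat)" "(v \<circ> k) \<longlonglongrightarrow> y"
    using compact_imp_seq_compact[OF compact_cball[of "0::'a" C]] unfolding seq_compact_def by metis
  have inv0: "(\<lambda>n. 1 / (real (n + m0) + 1)) \<longlonglongrightarrow> 0"
  proof -
    have "(\<lambda>n. 1 / (real n + 1)) \<longlonglongrightarrow> 0"
      using LIMSEQ_inverse_real_of_nat by (simp add: inverse_eq_divide add.commute)
    from LIMSEQ_ignore_initial_segment[OF this, of m0] show ?thesis .
  qed
  have e0: "e \<longlonglongrightarrow> 0"
    by (rule tendsto_sandwich[OF _ _ tendsto_const inv0])
      (use near in \<open>auto simp: nearby_def less_imp_le\<close>)
  have q0: "q \<longlonglongrightarrow> 0"
    by (rule Lim_null_comparison[OF _ inv0]) (use near in \<open>auto simp: nearby_def less_imp_le\<close>)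
  have "y \<in> limit_values (\<lambda>\<epsilon> x. a \<epsilon> (r, x)) (\<zeta> r)"
    unfolding limit_values_def mem_Collect_eq
  proof (intro exI[of _ "e \<circ> k"] exI[of _ "\<lambda>n. \<zeta> r + q (k n)"] conjI allI)
    show "(e \<circ> k) m \<in> params" for m using near[of "k m"] by (simp add: nearby_def)
    show "(e \<circ> k) \<longlonglongrightarrow> 0" by (rule LIMSEQ_subseq_LIMSEQ[OF e0 y(1)])
    show "(\<lambda>n. \<zeta> r + q (k n)) \<longlonglongrightarrow> \<zeta> r"
      using tendsto_add[OF tendsto_const LIMSEQ_subseq_LIMSEQ[OF q0 y(1)], of "\<zeta> r"] by (simp add: o_def)
    show "(\<lambda>m. a ((e \<circ> k) m) (r, \<zeta> r + q (k m))) \<longlonglongrightarrow> y"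
      using y(2) by (simp add: v_def o_def)
  qed
  moreover have "l \<le> y \<bullet> w" if l: "\<And>m. m0 \<le> m \<Longrightarrow> l \<le> envelope w m r" for l
  proof -
    have "l - 1 / (real (k n + m0) + 1) \<le> v (k n) \<bullet> w" for n
      using i(2)[of "k n + m0"] l[of "k n + m0"] by (simp add: v_def e_def q_def)
    moreover have "(\<lambda>n. l - 1 / (real (k n + m0) + 1)) \<longlonglongrightarrow> l - 0"
      using LIMSEQ_subseq_LIMSEQ[OF inv0 y(1)] by (intro tendsto_diff tendsto_const) (simp add: o_def)
    moreover have "(\<lambda>n. v (k n) \<bullet> w) \<longlonglongrightarrow> y \<bullet> w"
      using y(2) by (intro tendsto_inner tendsto_const) (simp add: o_def)
    ultimately show ?thesis
      using LIMSEQ_le[of "\<lambda>n. l - 1 / (real (k n + m0) + 1)" "l - 0"] by auto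
  qed
  ultimately show thesis by (rule that)
qed

lemma envelope_tendsto_support:
  assumes r: "r \<in> {c..d}"
  shows "(\<lambda>m. envelope w m r) \<longlonglongrightarrow> support w r" and "\<bar>support w r\<bar> \<le> C * norm w"
proof -
  let ?Y = "limit_values (\<lambda>\<epsilon> x. a \<epsilon> (r, x)) (\<zeta> r)"
  obtain y where y: "y \<in> ?Y" "\<And>l. (\<And>m. m0 \<le> m \<Longrightarrow> l \<le> envelope w m r) \<Longrightarrow> l \<le> y \<bullet> w"
    by (rule limit_value_near_envelope[OF r]) blast
  have le: "y' \<bullet> w \<le> y \<bullet> w" if "y' \<in> ?Y" for y'
    by (rule y(2)) (rule limit_value_le_envelope(1)[OF r _ that])
  have supp: "support w r = y \<bullet> w"
    unfolding support_def by (rule cSup_eq_maximum) (use y(1) le in auto)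
  show "\<bar>support w r\<bar> \<le> C * norm w"
    unfolding supp by (rule inner_bound) (rule limit_value_le_envelope(2)[OF r order_refl y(1)])
  have dec: "envelope w m' r \<le> envelope w m r" if "m0 \<le> m" "m \<le> m'" for m m'
    unfolding envelope_def
    by (rule cSUP_subset_mono[OF nearby_nonempty envelope_bdd[OF r that(1)] nearby_antimono[OF that(2)]]) simp
  have "decseq (\<lambda>m. envelope w (m + m0) r)"
    by (intro decseq_SucI dec) auto
  moreover have "y \<bullet> w \<le> envelope w (m + m0) r" for m
    by (rule limit_value_le_envelope(1)[OF r _ y(1)]) simp
  ultimately obtain L where L: "(\<lambda>m. envelope w (m + m0) r) \<longlonglongrightarrow> L" "\<And>m. L \<le> envelope w (m + m0) r"
    using decseq_convergent by metis
  have "L \<le> y \<bullet> w"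
  proof (rule y(2))
    fix m assume "m0 \<le> m"
    with L(2)[of "m - m0"] show "L \<le> envelope w m r" by simp
  qed
  moreover have "y \<bullet> w \<le> L"
    using L(1) limit_value_le_envelope(1)[OF r _ y(1)] by (intro LIMSEQ_le_const) auto
  ultimately show "(\<lambda>m. envelope w m r) \<longlonglongrightarrow> support w r"
    using LIMSEQ_offset[OF L(1)] supp by simp
qed

lemma support_absolutely_integrable: "support w absolutely_integrable_on {c..d}"
proof (rule measurable_bounded_by_integrable_imp_absolutely_integrable)
  show "support w \<in> borel_measurable (lebesgue_on {c..d})"
  proof (rule borel_measurable_LIMSEQ_real)
    show "(\<lambda>m. envelope w (m + m0) r) \<longlonglongrightarrow> support w r" if "r \<in> space (lebesgue_on {c..d})" for r
      using that by (intro LIMSEQ_ignore_initial_segment envelope_tendsto_support(1)) simp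
    show "envelope w (m + m0) \<in> borel_measurable (lebesgue_on {c..d})" for m
      by (rule envelope_measurable) simp
  qed
  show "norm (support w r) \<le> C * norm w" if "r \<in> {c..d}" for r
    using envelope_tendsto_support(2)[OF that] by simp
  show "(\<lambda>r. C * norm w) integrable_on {c..d}" by (rule integrable_const_ivl)
qed simp

text \<open>
The positive part of \<open>a \<bullet> w - support w\<close> along the approximating curves tends to zero pointwise, since these
curves eventually enter every neighbourhood \<open>nearby m\<close>. It is bounded by a constant, so its
integral tends to zero by dominated convergence.
\<close>

lemma limit_integral_inequality:
  assumes le: "c \<le> d" and e: "\<And>n::nat. e n \<in> params" "e \<longlonglongrightarrow> 0"
    and v: "\<And>n s. s \<in> J \<Longrightarrow> (v n has_vector_derivative a (e n) (s, v n s)) (at s within J)"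
    and lim: "uniform_limit {c..d} v \<zeta> sequentially"
  shows "\<zeta> d \<bullet> w \<le> \<zeta> c \<bullet> w + integral {c..d} (support w)"
proof -
  let ?F = "\<lambda>n r. a (e n) (r, v n r) \<bullet> w"
  have cJ: "c \<in> J" "d \<in> J" using cd le by auto
  have v_cont: "continuous_on J (v n)" for n by (rule continuous_on_vector_derivative[OF v])
  have F_cont: "continuous_on {c..d} (?F n)" for n
    by (rule continuous_on_subset[OF _ cd])
      (intro continuous_intros continuous_on_graph cont_field e v_cont)
  have FTC: "(?F n has_integral (v n d \<bullet> w - v n c \<bullet> w)) {c..d}" for n
  proof (rule fundamental_theorem_of_calculus[OF le])
    fix r assume "r \<in> {c..d}"
    then have "(v n has_vector_derivative a (e n) (r, v n r)) (at r within {c..d})"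
      using cd by (intro has_vector_derivative_within_subset[OF v]) auto
    then show "((\<lambda>r. v n r \<bullet> w) has_vector_derivative ?F n r) (at r within {c..d})"
      by (rule bounded_linear.has_vector_derivative[OF bounded_linear_inner_left])
  qed
  note S = support_absolutely_integrable
  let ?E = "\<lambda>n r. max 0 (?F n r - support w r)"
  have F_abs: "?F n absolutely_integrable_on {c..d}" for n
    by (rule absolutely_integrable_continuous_real[OF F_cont])
  have "?E n absolutely_integrable_on {c..d}" for n
    by (rule absolutely_integrable_max_1[OF _ set_integral_diff(1)[OF F_abs S]]) auto
  have E_int: "?E n integrable_on {c..d}" for n
    using \<open>?E n absolutely_integrable_on {c..d}\<close> by (simp add: absolutely_integrable_on_def)
  have "\<forall>\<^sub>F n in sequentially. \<forall>r\<in>{c..d}. (e n, v n r - \<zeta> r) \<in> nearby m0"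
  proof -
    have "\<forall>\<^sub>F n in sequentially. e n < 1 / (real m0 + 1)"
      using e(2) by (rule order_tendstoD) simp
    moreover have "\<forall>\<^sub>F n in sequentially. \<forall>r\<in>{c..d}. dist (v n r) (\<zeta> r) < 1 / (real m0 + 1)"
      using lim by (rule uniform_limitD) simp
    ultimately show ?thesis
      by eventually_elim (use e(1) in \<open>auto simp: nearby_def dist_norm\<close>)
  qed
  then obtain n0 where n0: "\<And>n r. n0 \<le> n \<Longrightarrow> r \<in> {c..d} \<Longrightarrow> (e n, v n r - \<zeta> r) \<in> nearby m0"
    unfolding eventually_sequentially by blast
  have F_bound: "\<bar>?F (n + n0) r\<bar> \<le> C * norm w" if "r \<in> {c..d}" for n r
    using C[OF that order_refl n0[OF _ that, of "n + n0"]] by (intro inner_bound) simp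
  have "(\<lambda>n. integral {c..d} (?E (n + n0))) \<longlonglongrightarrow> integral {c..d} (\<lambda>r. 0)"
  proof (rule dominated_convergence(2)[where h = "\<lambda>r. 2 * (C * norm w)"])
    show "norm (?E (n + n0) r) \<le> 2 * (C * norm w)" if "r \<in> {c..d}" for n r
      using F_bound[OF that, of n] envelope_tendsto_support(2)[OF that] by auto
    show "(\<lambda>n. ?E (n + n0) r) \<longlonglongrightarrow> 0" if r: "r \<in> {c..d}" for r
    proof (rule LIMSEQ_ignore_initial_segment, rule LIMSEQ_I)
      fix \<eta> :: real assume "0 < \<eta>"
      then have "\<forall>\<^sub>F m in sequentially. envelope w m r < support w r + \<eta>"
        by (intro order_tendstoD[OF envelope_tendsto_support(1)[OF r]]) simp
      then obtain m where m: "m0 \<le> m" "envelope w m r < support w r + \<eta>"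
        unfolding eventually_sequentially by (metis max.cobounded1 max.cobounded2)
      have "\<forall>\<^sub>F n in sequentially. (e n, v n r - \<zeta> r) \<in> nearby m"
        by (rule nearby_eventually[OF e]) (rule tendsto_uniform_limitI[OF lim r])
      then obtain N where N: "\<And>n. N \<le> n \<Longrightarrow> (e n, v n r - \<zeta> r) \<in> nearby m"
        by (auto simp: eventually_sequentially)
      have "norm (?E n r - 0) < \<eta>" if "N \<le> n" for n
      proof -
        have "?F n r \<le> envelope w m r"
          using cSUP_upper[OF N[OF that] envelope_bdd[OF r m(1)]] by (simp add: envelope_def)
        then show ?thesis using m(2) \<open>0 < \<eta>\<close> by auto
      qed
      then show "\<exists>N. \<forall>n\<ge>N. norm (?E n r - 0) < \<eta>" by blast
    qed
  qed (use E_int in auto)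
  then have E0: "(\<lambda>n. integral {c..d} (?E (n + n0))) \<longlonglongrightarrow> 0" by simp
  have ineq: "v n d \<bullet> w - v n c \<bullet> w \<le> integral {c..d} (support w) + integral {c..d} (?E n)" for n
  proof -
    have Si: "support w integrable_on {c..d}" using S by (simp add: absolutely_integrable_on_def)
    have "integral {c..d} (?F n) \<le> integral {c..d} (\<lambda>r. support w r + ?E n r)"
      using FTC Si E_int by (intro integral_le integrable_add) (auto simp: has_integral_integrable)
    also have "\<dots> = integral {c..d} (support w) + integral {c..d} (?E n)"
      by (rule Henstock_Kurzweil_Integration.integral_add[OF Si E_int])
    finally show ?thesis using integral_unique[OF FTC] by simp
  qed
  have vd: "(\<lambda>n. v n s) \<longlonglongrightarrow> \<zeta> s" if "s \<in> {c..d}" for s by (rule tendsto_uniform_limitI[OF lim that])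
  have "(\<lambda>n. v n d \<bullet> w - v n c \<bullet> w) \<longlonglongrightarrow> \<zeta> d \<bullet> w - \<zeta> c \<bullet> w"
    using le by (intro tendsto_intros vd) auto
  from LIMSEQ_ignore_initial_segment[OF this, of n0]
  have "\<zeta> d \<bullet> w - \<zeta> c \<bullet> w \<le> integral {c..d} (support w) + 0"
    by (rule LIMSEQ_le[OF _ tendsto_add[OF tendsto_const E0]]) (use ineq in blast)
  then show ?thesis by simp
qed

end

end

section \<open>Independence of representatives\<close>

lemma colombeau_representative_moderate:
  assumes "A \<in> colombeau S" "a \<in> A"
  shows "a \<in> moderate_nets S"
  using assms by (auto simp: colombeau_def quotient_def net_equiv_def)

lemma colombeau_representatives_negligible:
  assumes "A \<in> colombeau S" "a \<in> A" "a' \<in> A"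
  shows "locally_negligible S (\<lambda>\<epsilon> x. a \<epsilon> x - a' \<epsilon> x)"
proof -
  obtain b where "(b, a) \<in> net_equiv S" "(b, a') \<in> net_equiv S"
    using assms by (auto simp: colombeau_def quotient_def)
  then have "locally_negligible S (\<lambda>\<epsilon> x. b \<epsilon> x - a \<epsilon> x)" "locally_negligible S (\<lambda>\<epsilon> x. b \<epsilon> x - a' \<epsilon> x)"
    by (auto simp: net_equiv_def negligible_nets_iff)
  then show ?thesis
    using locally_negligible_trans locally_negligible_minus_commute by blast
qed

text \<open>
Every representative inherits the bound of the c-bounded one, up to a net that tends to zero, but only
for small parameters.
\<close>

lemma c_bounded_maps_locally_bounded:
  assumes A: "A \<in> c_bounded_maps S T" and a: "a \<in> A" and K: "compact K" "K \<subseteq> S"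
  shows "\<exists>C. \<forall>\<^sub>F \<epsilon> in at_right 0. \<forall>z\<in>K. norm (a \<epsilon> z) \<le> C"
proof -
  obtain f where f: "f \<in> A" "c_bounded_net S T f" and col: "A \<in> colombeau S"
    using A by (auto simp: c_bounded_maps_def)
  obtain K' where K': "compact K'" "\<And>\<epsilon>. \<epsilon> \<in> params \<Longrightarrow> f \<epsilon> ` K \<subseteq> K'"
    using f(2)[unfolded c_bounded_net_def, THEN conjunct2, rule_format, OF conjI[OF K]] by blast
  obtain C where C: "\<And>y. y \<in> K' \<Longrightarrow> norm y \<le> C"
    using compact_imp_bounded[OF K'(1)] unfolding bounded_iff by blast
  have "\<forall>\<^sub>F \<epsilon> in at_right 0. \<forall>z\<in>K. norm (a \<epsilon> z - f \<epsilon> z) \<le> \<epsilon> powr 1"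
    using colombeau_representatives_negligible[OF col a f(1)] K unfolding locally_negligible_def by blast
  then have "\<forall>\<^sub>F \<epsilon> in at_right 0. \<forall>z\<in>K. norm (a \<epsilon> z) \<le> C + 1"
    using eventually_params
  proof eventually_elim
    case (elim \<epsilon>)
    show ?case
    proof
      fix z assume z: "z \<in> K"
      have "norm (f \<epsilon> z) \<le> C" using K'(2)[OF elim(2)] z C by blast
      moreover have "norm (a \<epsilon> z - f \<epsilon> z) \<le> 1" using elim z by force
      ultimately show "norm (a \<epsilon> z) \<le> C + 1" using norm_triangle_ineq2[of "a \<epsilon> z" "f \<epsilon> z"] by linarith
    qed
  qed
  then show ?thesis by blast
qed

text \<open>
The partial derivatives of a slice are those of the whole map in the spatial directions, so slices of
moderate nets are moderate.
\<close>

lemma partials_within_slice: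
  assumes "t \<in> J"
  shows "partials_within UNIV bs (\<lambda>x. f (t, x)) =
    (\<lambda>x. partials_within (J \<times> UNIV) (map (Pair 0) bs) f (t, x))"
proof (induction bs)
  case (Cons b bs)
  then show ?case using assms by (simp add: partial_within_def fun_eq_iff)
qed simp

lemma slice_moderate:
  fixes a :: "real \<Rightarrow> real \<times> 'a::euclidean_space \<Rightarrow> 'b::real_normed_vector"
  assumes a: "a \<in> moderate_nets (J \<times> UNIV)" and t: "t \<in> J"
  shows "(\<lambda>\<epsilon> x. a \<epsilon> (t, x)) \<in> moderate_nets UNIV"
proof (rule moderate_netsI)
  have bs': "set (map (Pair (0::real)) bs) \<subseteq> Basis" if "set bs \<subseteq> Basis" for bs :: "'a list"
    using that by (auto simp: Basis_prod_def)
  fix \<epsilon> :: real assume \<epsilon>: "\<epsilon> \<in> params"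
  then have sm: "smooth_on (J \<times> UNIV) (a \<epsilon>)" using a by (simp add: moderate_nets_def)
  show "smooth_on UNIV (\<lambda>x. a \<epsilon> (t, x))"
    unfolding smooth_on_def partials_within_slice[OF t]
  proof (intro allI impI conjI ballI)
    fix bs :: "'a list" assume bs: "set bs \<subseteq> Basis"
    show "continuous_on UNIV (\<lambda>x. partials_within (J \<times> UNIV) (map (Pair 0) bs) (a \<epsilon>) (t, x))"
      by (rule continuous_on_compose2[OF smooth_on_continuous[OF sm bs'[OF bs]]])
        (use t in \<open>auto intro!: continuous_intros\<close>)
    fix b x :: 'a assume "b \<in> Basis"
    then have "(0, b) \<in> (Basis :: (real \<times> 'a) set)" by (simp add: Basis_prod_def)
    from sm[unfolded smooth_on_def, rule_format, OF bs'[OF bs], THEN conjunct2, rule_format, OF this, of "(t, x)"] t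
    show "(\<lambda>h. partials_within (J \<times> UNIV) (map (Pair 0) bs) (a \<epsilon>) (t, x + h *\<^sub>R b)) differentiable
        at 0 within {h. x + h *\<^sub>R b \<in> UNIV}"
      by simp
  qed
next
  fix bs :: "'a list" assume "set bs \<subseteq> Basis"
  then have "set (map (Pair (0::real)) bs) \<subseteq> Basis" by (auto simp: Basis_prod_def)
  note mod = moderate_imp_locally_moderate[OF a this]
  show "locally_moderate UNIV (\<lambda>\<epsilon>. partials_within UNIV bs (\<lambda>x. a \<epsilon> (t, x)))"
    unfolding partials_within_slice[OF t] locally_moderate_def
  proof (intro allI impI)
    fix K :: "'a set" assume "compact K \<and> K \<subseteq> UNIV"
    then have "compact ({t} \<times> K) \<and> {t} \<times> K \<subseteq> J \<times> UNIV" using t by (auto intro: compact_Times)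
    then obtain p where "\<forall>\<^sub>F \<epsilon> in at_right 0. \<forall>z\<in>{t} \<times> K.
        norm (partials_within (J \<times> UNIV) (map (Pair 0) bs) (a \<epsilon>) z) \<le> \<epsilon> powr (- p)"
      using mod unfolding locally_moderate_def by blast
    then show "\<exists>p. \<forall>\<^sub>F \<epsilon> in at_right 0. \<forall>x\<in>K.
        norm (partials_within (J \<times> UNIV) (map (Pair 0) bs) (a \<epsilon>) (t, x)) \<le> \<epsilon> powr (- p)"
      by (auto intro!: exI[of _ p] elim!: eventually_mono)
  qed
qed

lemma zero_net_moderate: "(\<lambda>\<epsilon> x. 0) \<in> moderate_nets (UNIV :: 'a::euclidean_space set)"
proof -
  have [simp]: "partials_within UNIV bs (\<lambda>x::'a. 0::'b::real_normed_vector) = (\<lambda>x. 0)" for bs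
    by (induction bs) (auto simp: partial_within_def fun_eq_iff)
  show ?thesis
    by (rule moderate_netsI) (auto simp: smooth_on_def locally_moderate_def)
qed

lemma slice_negligible:
  assumes "locally_negligible (J \<times> UNIV) (\<lambda>\<epsilon> z. a \<epsilon> z - b \<epsilon> z)" "t \<in> J"
  shows "locally_negligible UNIV (\<lambda>\<epsilon> x. a \<epsilon> (t, x) - b \<epsilon> (t, x))"
  unfolding locally_negligible_def
proof (intro allI impI)
  fix K :: "'b set" and q :: real assume "compact K \<and> K \<subseteq> UNIV"
  then have "compact ({t} \<times> K) \<and> {t} \<times> K \<subseteq> J \<times> UNIV" using assms by (auto intro: compact_Times)
  then have "\<forall>\<^sub>F \<epsilon> in at_right 0. \<forall>z\<in>{t} \<times> K. norm (a \<epsilon> z - b \<epsilon> z) \<le> \<epsilon> powr q"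
    using assms(1) unfolding locally_negligible_def by blast
  then show "\<forall>\<^sub>F \<epsilon> in at_right 0. \<forall>x\<in>K. norm (a \<epsilon> (t, x) - b \<epsilon> (t, x)) \<le> \<epsilon> powr q"
    by (auto elim!: eventually_mono)
qed

text \<open>
Representatives of a slice differ by negligible nets and therefore have the same limit values.
\<close>

lemma gen_graph_slice:
  fixes A :: "(real \<Rightarrow> real \<times> 'a::euclidean_space \<Rightarrow> 'b::real_normed_vector) set"
  assumes A: "A \<in> colombeau (J \<times> UNIV)" and a: "a \<in> A" and t: "t \<in> J"
  shows "gen_graph UNIV UNIV (gen_slice A t) `` {x} = limit_values (\<lambda>\<epsilon> x. a \<epsilon> (t, x)) x"
proof -
  have "limit_values f x = limit_values (\<lambda>\<epsilon> x. a \<epsilon> (t, x)) x" if f: "f \<in> gen_slice A t" for f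
  proof (rule limit_values_cong)
    obtain a' where a': "a' \<in> A" "(\<lambda>\<epsilon> x. a' \<epsilon> (t, x), f) \<in> net_equiv UNIV"
      using f by (auto simp: gen_slice_def net_class_def)
    then have "locally_negligible UNIV (\<lambda>\<epsilon> x. a' \<epsilon> (t, x) - f \<epsilon> x)"
      by (auto simp: net_equiv_def negligible_nets_iff)
    then have "locally_negligible UNIV (\<lambda>\<epsilon> x. f \<epsilon> x - a' \<epsilon> (t, x))"
      by (simp only: locally_negligible_minus_commute[of UNIV f "\<lambda>\<epsilon> x. a' \<epsilon> (t, x)"])
    moreover have "locally_negligible UNIV (\<lambda>\<epsilon> x. a' \<epsilon> (t, x) - a \<epsilon> (t, x))"
      by (rule slice_negligible[OF colombeau_representatives_negligible[OF A a'(1) a] t])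
    ultimately show "locally_negligible UNIV (\<lambda>\<epsilon> x. f \<epsilon> x - a \<epsilon> (t, x))"
      by (rule locally_negligible_trans)
  qed
  note eq = this
  have ne: "(\<lambda>\<epsilon> x. a \<epsilon> (t, x)) \<in> gen_slice A t"
    using slice_moderate[OF colombeau_representative_moderate[OF A a] t] a
    by (auto simp: gen_slice_def net_class_def net_equiv_def negligible_nets_iff zero_net_moderate
        locally_negligible_def intro!: bexI[of _ a])
  have "gen_graph UNIV UNIV (gen_slice A t) `` {x} = (\<Union>f\<in>gen_slice A t. net_graph UNIV UNIV f `` {x})"
    unfolding gen_graph_def by blast
  also have "\<dots> = (\<Union>f\<in>gen_slice A t. limit_values (\<lambda>\<epsilon> x. a \<epsilon> (t, x)) x)"
    by (rule SUP_cong) (simp_all add: net_graph_eq_limit_values eq)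
  also have "\<dots> = limit_values (\<lambda>\<epsilon> x. a \<epsilon> (t, x)) x"
    using ne by blast
  finally show ?thesis .
qed

lemma moderate_points_iff:
  "p \<in> moderate_points S \<longleftrightarrow>
    (\<forall>\<epsilon>\<in>params. p \<epsilon> \<in> S) \<and> (\<exists>N. \<forall>\<^sub>F \<epsilon> in at_right 0. norm (p \<epsilon>) \<le> \<epsilon> powr (- N))"
proof -
  have "(\<exists>N. (\<lambda>\<epsilon>. norm (p \<epsilon>)) \<in> O[at_right 0](\<lambda>\<epsilon>. \<epsilon> powr (- N))) \<longleftrightarrow>
      (\<exists>N. \<forall>\<^sub>F \<epsilon> in at_right 0. norm (p \<epsilon>) \<le> \<epsilon> powr (- N))"
  proof (intro iffI; elim exE)
    fix N assume "(\<lambda>\<epsilon>. norm (p \<epsilon>)) \<in> O[at_right 0](\<lambda>\<epsilon>. \<epsilon> powr (- N))"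
    from bigo_powr_eventually_le[OF this, of "- (N + 1)"]
    show "\<exists>N. \<forall>\<^sub>F \<epsilon> in at_right 0. norm (p \<epsilon>) \<le> \<epsilon> powr (- N)"
      by (intro exI[of _ "N + 1"]) simp
  next
    fix N assume "\<forall>\<^sub>F \<epsilon> in at_right 0. norm (p \<epsilon>) \<le> \<epsilon> powr (- N)"
    then show "\<exists>N. (\<lambda>\<epsilon>. norm (p \<epsilon>)) \<in> O[at_right 0](\<lambda>\<epsilon>. \<epsilon> powr (- N))"
      by (intro exI[of _ N] eventually_le_powr_imp_bigo) simp
  qed
  then show ?thesis by (simp add: moderate_points_def)
qed

lemma point_equiv_iff:
  "(p, r) \<in> point_equiv S \<longleftrightarrow> p \<in> moderate_points S \<and> r \<in> moderate_points S \<and>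
    (\<forall>q. \<forall>\<^sub>F \<epsilon> in at_right 0. norm (p \<epsilon> - r \<epsilon>) \<le> \<epsilon> powr q)"
proof -
  have "(\<forall>q. (\<lambda>\<epsilon>. norm (p \<epsilon> - r \<epsilon>)) \<in> O[at_right 0](\<lambda>\<epsilon>. \<epsilon> powr q)) \<longleftrightarrow>
      (\<forall>q. \<forall>\<^sub>F \<epsilon> in at_right 0. norm (p \<epsilon> - r \<epsilon>) \<le> \<epsilon> powr q)"
  proof (intro iffI allI)
    fix q assume "\<forall>q. (\<lambda>\<epsilon>. norm (p \<epsilon> - r \<epsilon>)) \<in> O[at_right 0](\<lambda>\<epsilon>. \<epsilon> powr q)"
    from bigo_powr_eventually_le[OF this[rule_format, of "q + 1"], of q]
    show "\<forall>\<^sub>F \<epsilon> in at_right 0. norm (p \<epsilon> - r \<epsilon>) \<le> \<epsilon> powr q" by simp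
  next
    fix q assume "\<forall>q. \<forall>\<^sub>F \<epsilon> in at_right 0. norm (p \<epsilon> - r \<epsilon>) \<le> \<epsilon> powr q"
    then show "(\<lambda>\<epsilon>. norm (p \<epsilon> - r \<epsilon>)) \<in> O[at_right 0](\<lambda>\<epsilon>. \<epsilon> powr q)"
      by (intro eventually_le_powr_imp_bigo) simp
  qed
  then show ?thesis by (simp add: point_equiv_def)
qed

lemma eventually_triangle_powr:
  fixes p r s :: "real \<Rightarrow> 'a::real_normed_vector"
  assumes "\<And>q. \<forall>\<^sub>F \<epsilon> in at_right 0. norm (p \<epsilon> - r \<epsilon>) \<le> \<epsilon> powr q"
    and "\<And>q. \<forall>\<^sub>F \<epsilon> in at_right 0. norm (r \<epsilon> - s \<epsilon>) \<le> \<epsilon> powr q"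
  shows "\<forall>\<^sub>F \<epsilon> in at_right 0. norm (p \<epsilon> - s \<epsilon>) \<le> \<epsilon> powr q"
proof -
  have "\<forall>\<^sub>F \<epsilon> in at_right 0. norm (p \<epsilon> - r \<epsilon>) + norm (r \<epsilon> - s \<epsilon>) \<le> \<epsilon> powr q"
    by (rule eventually_sum_le_powr[OF assms(1)[of "q + 1"] assms(2)[of "q + 1"]]) auto
  then show ?thesis
  proof eventually_elim
    case (elim \<epsilon>)
    then show ?case using norm_triangle_ineq[of "p \<epsilon> - r \<epsilon>" "r \<epsilon> - s \<epsilon>"] by simp
  qed
qed

lemma equiv_point_equiv: "equiv (moderate_points S) (point_equiv S)"
proof (rule equivI)
  show "refl_on (moderate_points S) (point_equiv S)"
    by (auto intro!: refl_onI simp: point_equiv_iff)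
  show "sym (point_equiv S)"
  proof (rule symI)
    fix p r assume "(p, r) \<in> point_equiv S"
    then show "(r, p) \<in> point_equiv S"
      unfolding point_equiv_iff norm_minus_commute[of "r _"] by blast
  qed
  show "trans (point_equiv S)"
    by (intro transI) (auto simp: point_equiv_iff intro: eventually_triangle_powr)
qed (auto simp: point_equiv_iff)

lemma point_class_eq: "(p, r) \<in> point_equiv S \<Longrightarrow> point_class S p = point_class S r"
  unfolding point_class_def by (rule equiv_class_eq[OF equiv_point_equiv])

lemma moderate_points_near:
  assumes p: "p \<in> moderate_points S" and r: "\<forall>\<^sub>F \<epsilon> in at_right 0. norm (p \<epsilon> - r \<epsilon>) \<le> \<epsilon> powr q"
    and T: "\<And>\<epsilon>. \<epsilon> \<in> params \<Longrightarrow> r \<epsilon> \<in> T"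
  shows "r \<in> moderate_points T"
proof -
  obtain N where N: "\<forall>\<^sub>F \<epsilon> in at_right 0. norm (p \<epsilon>) \<le> \<epsilon> powr (- N)"
    using p unfolding moderate_points_iff by blast
  have "\<forall>\<^sub>F \<epsilon> in at_right 0. norm (p \<epsilon>) + norm (p \<epsilon> - r \<epsilon>) \<le> \<epsilon> powr (- (max N (- q) + 1))"
    by (rule eventually_sum_le_powr[OF N r]) auto
  then have "\<forall>\<^sub>F \<epsilon> in at_right 0. norm (r \<epsilon>) \<le> \<epsilon> powr (- (max N (- q) + 1))"
  proof eventually_elim
    case (elim \<epsilon>)
    then show ?case using norm_triangle_ineq2[of "r \<epsilon>" "p \<epsilon>"] by (simp add: norm_minus_commute)
  qed
  then show ?thesis using T unfolding moderate_points_iff by blast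
qed

text \<open>
A net of classical solutions for one representative \<open>a\<close> of the field. That its class solves the
generalized equation has to be checked for all representatives of the field and of the solution.
\<close>

locale solution_net = time_interval J for J :: "real set" +
  fixes A :: "(real \<Rightarrow> real \<times> 'a::euclidean_space \<Rightarrow> 'a) set"
    and a :: "real \<Rightarrow> real \<times> 'a \<Rightarrow> 'a" and u :: "real \<Rightarrow> real \<Rightarrow> 'a"
  assumes A: "A \<in> c_bounded_maps (J \<times> UNIV) UNIV" and a: "a \<in> A"
    and solves: "\<And>\<epsilon> s. \<epsilon> \<in> params \<Longrightarrow> s \<in> J \<Longrightarrow> (u \<epsilon> has_vector_derivative a \<epsilon> (s, u \<epsilon> s)) (at s within J)"
    and bounded: "\<And>K. compact K \<Longrightarrow> K \<subseteq> J \<Longrightarrow> \<exists>R. \<forall>\<epsilon>\<in>params. \<forall>s\<in>K. norm (u \<epsilon> s) \<le> R"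
begin

lemma A_colombeau: "A \<in> colombeau (J \<times> UNIV)"
  using A by (simp add: c_bounded_maps_def)

lemma a_moderate: "a \<in> moderate_nets (J \<times> UNIV)"
  by (rule colombeau_representative_moderate[OF A_colombeau a])

lemma u_locally_bounded: "locally_bounded_net J u"
  unfolding locally_bounded_net_def
proof (intro allI impI)
  fix K assume "compact K \<and> K \<subseteq> J"
  then obtain R where R: "\<forall>\<epsilon>\<in>params. \<forall>s\<in>K. norm (u \<epsilon> s) \<le> R" using bounded by blast
  show "\<exists>R. \<forall>\<^sub>F \<epsilon> in at_right 0. \<forall>s\<in>K. norm (u \<epsilon> s) \<le> R"
    by (rule exI[of _ R], rule eventually_mono[OF eventually_params]) (use R in blast)
qed

lemma u_moderate: "u \<in> moderate_nets J"
  unfolding moderate_nets_iff_upto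
  using moderate_upto_solution[OF interval a_moderate u_locally_bounded solves] by blast

lemma class_is_c_bounded: "net_class J u \<in> c_bounded_maps J UNIV"
proof -
  have "c_bounded_net J UNIV u"
    unfolding c_bounded_net_def
  proof (intro conjI ballI allI impI)
    show "smooth_on J (u \<epsilon>)" if "\<epsilon> \<in> params" for \<epsilon>
      using u_moderate that by (simp add: moderate_nets_def)
    fix K assume "compact K \<and> K \<subseteq> J"
    then obtain R where "\<forall>\<epsilon>\<in>params. \<forall>s\<in>K. norm (u \<epsilon> s) \<le> R" using bounded by blast
    then show "\<exists>K'. compact K' \<and> K' \<subseteq> UNIV \<and> (\<forall>\<epsilon>\<in>params. u \<epsilon> ` K \<subseteq> K')"
      by (intro exI[of _ "cball 0 R"]) auto
  qed simp
  moreover have "u \<in> net_class J u"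
    unfolding net_class_def by (rule equiv_class_self[OF equiv_net_equiv u_moderate])
  moreover have "net_class J u \<in> colombeau J"
    unfolding net_class_def colombeau_def by (rule quotientI[OF u_moderate])
  ultimately show ?thesis by (auto simp: c_bounded_maps_def)
qed

lemma in_class_iff: "v \<in> net_class J u \<longleftrightarrow> (u, v) \<in> net_equiv J"
  by (simp add: net_class_def)

lemma gen_deriv_class:
  "gen_deriv J (net_class J u) = net_class J (\<lambda>\<epsilon> s. vector_derivative (u \<epsilon>) (at s within J))"
proof -
  let ?D = "\<lambda>v \<epsilon> s. vector_derivative (v \<epsilon>) (at s within J)"
  have "net_class J (?D v) = net_class J (?D u)" if "v \<in> net_class J u" for v
  proof -
    have v: "v \<in> moderate_nets J" "locally_negligible J (\<lambda>\<epsilon> s. u \<epsilon> s - v \<epsilon> s)"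
      using that by (auto simp: in_class_iff net_equiv_iff)
    have u': "\<And>k. moderate_upto k J u" and v': "\<And>k. moderate_upto k J v"
      using u_moderate v by (auto simp: moderate_nets_iff_upto)
    have "locally_negligible J (\<lambda>\<epsilon> s. ?D u \<epsilon> s - ?D v \<epsilon> s)"
      by (rule negligible_derivative[OF moderate_upto_diff[OF u' v'] v(2)])
        (intro has_vector_derivative_diff moderate_upto_derivative(2) u' v')
    moreover have "?D u \<in> moderate_nets J" "?D v \<in> moderate_nets J"
      unfolding moderate_nets_iff_upto using moderate_upto_derivative(1) u' v' by blast+
    ultimately have "(?D u, ?D v) \<in> net_equiv J" by (simp add: net_equiv_iff)
    then show ?thesis using net_class_eq by blast
  qed
  moreover have "u \<in> net_class J u"
    unfolding net_class_def by (rule equiv_class_self[OF equiv_net_equiv u_moderate])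
  ultimately show ?thesis unfolding gen_deriv_def by blast
qed

lemma in_class_locally_bounded:
  assumes "locally_negligible J (\<lambda>\<epsilon> s. u \<epsilon> s - v \<epsilon> s)"
  shows "locally_bounded_net J v"
  unfolding locally_bounded_net_def
proof (intro allI impI)
  fix K assume K: "compact K \<and> K \<subseteq> J"
  then obtain R where R: "\<forall>\<^sub>F \<epsilon> in at_right 0. \<forall>s\<in>K. norm (u \<epsilon> s) \<le> R"
    using u_locally_bounded unfolding locally_bounded_net_def by blast
  have "\<forall>\<^sub>F \<epsilon> in at_right 0. \<forall>s\<in>K. norm (u \<epsilon> s - v \<epsilon> s) \<le> \<epsilon> powr 1"
    using assms K unfolding locally_negligible_def by blast
  then have "\<forall>\<^sub>F \<epsilon> in at_right 0. \<forall>s\<in>K. norm (v \<epsilon> s) \<le> R + 1"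
    using R eventually_params
  proof eventually_elim
    case (elim \<epsilon>)
    show ?case
    proof
      fix s assume s: "s \<in> K"
      have "norm (u \<epsilon> s - v \<epsilon> s) \<le> 1" "norm (u \<epsilon> s) \<le> R" using elim s by force+
      then show "norm (v \<epsilon> s) \<le> R + 1"
        using norm_triangle_ineq3[of "u \<epsilon> s" "v \<epsilon> s"] by linarith
    qed
  qed
  then show "\<exists>R. \<forall>\<^sub>F \<epsilon> in at_right 0. \<forall>s\<in>K. norm (v \<epsilon> s) \<le> R" by blast
qed

text \<open>
The Lipschitz constant of \<open>a\<close> in space is moderate, hence harmless against a negligible difference of
curves.
\<close>

lemma composition_negligible_in_curve:
  assumes v: "locally_negligible J (\<lambda>\<epsilon> s. v \<epsilon> s - u \<epsilon> s)" "locally_bounded_net J v"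
  shows "locally_negligible J (\<lambda>\<epsilon> s. a \<epsilon> (s, v \<epsilon> s) - a \<epsilon> (s, u \<epsilon> s))"
  unfolding locally_negligible_def
proof (intro allI impI)
  fix K and q :: real assume K: "compact K \<and> K \<subseteq> J"
  obtain R1 where R1: "\<forall>\<^sub>F \<epsilon> in at_right 0. \<forall>s\<in>K. norm (u \<epsilon> s) \<le> R1"
    using K u_locally_bounded unfolding locally_bounded_net_def by blast
  obtain R2 where R2: "\<forall>\<^sub>F \<epsilon> in at_right 0. \<forall>s\<in>K. norm (v \<epsilon> s) \<le> R2"
    using K v unfolding locally_bounded_net_def by blast
  define R where "R = max R1 R2"
  let ?D = "\<lambda>b \<epsilon>. partials_within (J \<times> UNIV) [b] (a \<epsilon>)"
  let ?B = "K \<times> cball (0::'a) (3 * R)"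
  have B: "compact ?B \<and> ?B \<subseteq> J \<times> UNIV" using K by (intro conjI compact_Times compact_cball) auto
  have "\<forall>b\<in>Basis. \<exists>p. \<forall>\<^sub>F \<epsilon> in at_right 0. \<forall>z\<in>?B. norm (?D b \<epsilon> z) \<le> \<epsilon> powr (- p)"
  proof
    fix b :: "real \<times> 'a" assume "b \<in> Basis"
    then have "set [b] \<subseteq> Basis" by simp
    from moderate_imp_locally_moderate[OF a_moderate this, unfolded locally_moderate_def, rule_format, OF B]
    show "\<exists>p. \<forall>\<^sub>F \<epsilon> in at_right 0. \<forall>z\<in>?B. norm (?D b \<epsilon> z) \<le> \<epsilon> powr (- p)" .
  qed
  from bchoice[OF this] obtain p where
    "\<forall>b\<in>Basis. \<forall>\<^sub>F \<epsilon> in at_right 0. \<forall>z\<in>?B. norm (?D b \<epsilon> z) \<le> \<epsilon> powr (- p b)" ..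
  note p = bspec[OF this]
  define p0 where "p0 = Max (p ` Basis)"
  have "\<forall>\<^sub>F \<epsilon> in at_right 0. \<forall>z\<in>?B. norm (?D b \<epsilon> z) \<le> \<epsilon> powr (- p0)" if b: "b \<in> Basis" for b
  proof -
    have "p b \<le> p0" using b by (simp add: p0_def)
    then have "\<forall>\<^sub>F \<epsilon> in at_right 0. \<epsilon> powr (- p b) \<le> \<epsilon> powr (- p0)"
      by (intro eventually_powr_mono) simp
    with p[OF b] show ?thesis by eventually_elim force
  qed
  then have D: "\<forall>\<^sub>F \<epsilon> in at_right 0. \<forall>b\<in>Basis. \<forall>z\<in>?B. norm (?D b \<epsilon> z) \<le> \<epsilon> powr (- p0)"
    by (intro eventually_ball_finite) auto
  have neg: "\<forall>\<^sub>F \<epsilon> in at_right 0. \<forall>s\<in>K. norm (v \<epsilon> s - u \<epsilon> s) \<le> \<epsilon> powr (p0 + q + 1)"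
    using v(1) K unfolding locally_negligible_def by blast
  have "\<forall>\<^sub>F \<epsilon> in at_right 0. DIM(real \<times> 'a) * \<epsilon> powr (q + 1) \<le> \<epsilon> powr q"
    by (rule eventually_mult_powr_le) simp
  then show "\<forall>\<^sub>F \<epsilon> in at_right 0. \<forall>s\<in>K. norm (a \<epsilon> (s, v \<epsilon> s) - a \<epsilon> (s, u \<epsilon> s)) \<le> \<epsilon> powr q"
    using R1 R2 D neg eventually_params
  proof eventually_elim
    case (elim \<epsilon>)
    show ?case
    proof
      fix s assume s: "s \<in> K"
      have "smooth_on (J \<times> UNIV) (a \<epsilon>)" using a_moderate elim(6) by (simp add: moderate_nets_def)
      then have part: "has_partials_on (J \<times> UNIV) (a \<epsilon>) (\<lambda>b. ?D b \<epsilon>)"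
        using smooth_on_has_partials[of _ "a \<epsilon>" "[]"] by simp
      have "norm (a \<epsilon> (s, v \<epsilon> s) - a \<epsilon> (s, u \<epsilon> s)) \<le>
          DIM(real \<times> 'a) * \<epsilon> powr (- p0) * norm (v \<epsilon> s - u \<epsilon> s)"
      proof (rule lipschitz_in_space[OF part, where R = R])
        show "norm (?D b \<epsilon> (s, x)) \<le> \<epsilon> powr (- p0)" if "b \<in> Basis" "norm x \<le> 3 * R" for b x
          using elim(4) that s by auto
        show "norm (u \<epsilon> s) \<le> R" "norm (v \<epsilon> s) \<le> R" using elim(2,3) s by (force simp: R_def)+
      qed (use s K in auto)
      also have "\<dots> \<le> DIM(real \<times> 'a) * \<epsilon> powr (- p0) * \<epsilon> powr (p0 + q + 1)"
        using elim(5) s by (intro mult_left_mono) auto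
      also have "\<dots> = DIM(real \<times> 'a) * \<epsilon> powr (q + 1)"
        by (simp add: mult.assoc flip: powr_add)
      finally show "norm (a \<epsilon> (s, v \<epsilon> s) - a \<epsilon> (s, u \<epsilon> s)) \<le> \<epsilon> powr q" using elim(1) by linarith
    qed
  qed
qed

lemma composition_negligible_in_field:
  assumes v: "locally_bounded_net J v" and a': "a' \<in> A"
  shows "locally_negligible J (\<lambda>\<epsilon> s. a' \<epsilon> (s, v \<epsilon> s) - a \<epsilon> (s, v \<epsilon> s))"
  unfolding locally_negligible_def
proof (intro allI impI)
  fix K and q :: real assume K: "compact K \<and> K \<subseteq> J"
  obtain R where R: "\<forall>\<^sub>F \<epsilon> in at_right 0. \<forall>s\<in>K. norm (v \<epsilon> s) \<le> R"
    using K v unfolding locally_bounded_net_def by blast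
  let ?B = "K \<times> cball (0::'a) R"
  have "compact ?B \<and> ?B \<subseteq> J \<times> UNIV" using K by (intro conjI compact_Times compact_cball) auto
  then have "\<forall>\<^sub>F \<epsilon> in at_right 0. \<forall>z\<in>?B. norm (a' \<epsilon> z - a \<epsilon> z) \<le> \<epsilon> powr q"
    using colombeau_representatives_negligible[OF A_colombeau a' a] unfolding locally_negligible_def by blast
  with R show "\<forall>\<^sub>F \<epsilon> in at_right 0. \<forall>s\<in>K. norm (a' \<epsilon> (s, v \<epsilon> s) - a \<epsilon> (s, v \<epsilon> s)) \<le> \<epsilon> powr q"
    by eventually_elim auto
qed

lemma composition_moderate:
  assumes "locally_bounded_net J v" "v \<in> moderate_nets J" "a' \<in> A"
  shows "(\<lambda>\<epsilon> s. a' \<epsilon> (s, v \<epsilon> s)) \<in> moderate_nets J"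
  unfolding moderate_nets_iff_upto
proof
  fix k
  have "moderate_upto k J v" using assms(2) by (simp add: moderate_nets_iff_upto)
  from moderate_upto_along_curve[OF interval colombeau_representative_moderate[OF A_colombeau assms(3)]
      assms(1) this, of "[]"]
  show "moderate_upto k J (\<lambda>\<epsilon> s. a' \<epsilon> (s, v \<epsilon> s))" by simp
qed

lemma gen_along_class: "gen_along J A (net_class J u) = net_class J (\<lambda>\<epsilon> s. a \<epsilon> (s, u \<epsilon> s))"
proof -
  let ?c = "\<lambda>a v \<epsilon> s. a \<epsilon> (s, v \<epsilon> s)"
  have "net_class J (?c a' v) = net_class J (?c a u)" if a': "a' \<in> A" and "v \<in> net_class J u" for a' v
  proof -
    have v: "v \<in> moderate_nets J" "locally_negligible J (\<lambda>\<epsilon> s. u \<epsilon> s - v \<epsilon> s)"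
      using that by (auto simp: in_class_iff net_equiv_iff)
    note vb = in_class_locally_bounded[OF v(2)]
    have "locally_negligible J (\<lambda>\<epsilon> s. v \<epsilon> s - u \<epsilon> s)"
      using v(2) locally_negligible_minus_commute by blast
    then have "locally_negligible J (\<lambda>\<epsilon> s. ?c a' v \<epsilon> s - ?c a u \<epsilon> s)"
      by (intro locally_negligible_trans[OF composition_negligible_in_field[OF vb a']]
          composition_negligible_in_curve vb)
    then have "(?c a' v, ?c a u) \<in> net_equiv J"
      unfolding net_equiv_iff
      using composition_moderate[OF vb v(1) a'] composition_moderate[OF u_locally_bounded u_moderate a]
      by blast
    then show ?thesis by (rule net_class_eq)
  qed
  moreover have "u \<in> net_class J u"
    unfolding net_class_def by (rule equiv_class_self[OF equiv_net_equiv u_moderate])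
  ultimately show ?thesis using a unfolding gen_along_def by blast
qed

lemma differential_equation: "gen_deriv J (net_class J u) = gen_along J A (net_class J u)"
proof -
  let ?D = "\<lambda>\<epsilon> s. vector_derivative (u \<epsilon>) (at s within J)" and ?c = "\<lambda>\<epsilon> s. a \<epsilon> (s, u \<epsilon> s)"
  have eq: "?D \<epsilon> s = ?c \<epsilon> s" if "\<epsilon> \<in> params" "s \<in> J" for \<epsilon> s
    by (rule vector_derivative_within[OF at_within_nontrivial[OF that(2)] solves[OF that]])
  have "locally_negligible J (\<lambda>\<epsilon> s. ?D \<epsilon> s - ?c \<epsilon> s)"
    unfolding locally_negligible_def
  proof (intro allI impI)
    fix K and q :: real assume K: "compact K \<and> K \<subseteq> J"
    show "\<forall>\<^sub>F \<epsilon> in at_right 0. \<forall>s\<in>K. norm (?D \<epsilon> s - ?c \<epsilon> s) \<le> \<epsilon> powr q"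
      using eventually_params
    proof eventually_elim
      case (elim \<epsilon>)
      have "norm (?D \<epsilon> s - ?c \<epsilon> s) \<le> \<epsilon> powr q" if "s \<in> K" for s
        using eq[OF elim, of s] K that by (simp add: subset_iff)
      then show ?case by blast
    qed
  qed
  moreover have "?D \<in> moderate_nets J"
    using u_moderate moderate_upto_derivative(1) unfolding moderate_nets_iff_upto by blast
  ultimately have "(?D, ?c) \<in> net_equiv J"
    unfolding net_equiv_iff using composition_moderate[OF u_locally_bounded u_moderate a] by blast
  then show ?thesis unfolding gen_deriv_class gen_along_class by (rule net_class_eq)
qed

text \<open>
Along the solutions the velocity is bounded by a constant for small parameters, because the field is
c-bounded and the solutions stay in a compact set.
\<close>

lemma eventually_lipschitz:
  assumes cd: "{c..d} \<subseteq> J"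
  obtains C where "0 < C" "\<forall>\<^sub>F \<epsilon> in at_right 0. \<forall>r\<in>{c..d}. \<forall>s\<in>{c..d}. norm (u \<epsilon> s - u \<epsilon> r) \<le> C * \<bar>s - r\<bar>"
proof -
  obtain R where R: "\<forall>\<epsilon>\<in>params. \<forall>s\<in>{c..d}. norm (u \<epsilon> s) \<le> R"
    using bounded[OF _ cd] by auto
  let ?K = "{c..d} \<times> cball (0::'a) R"
  have "compact ?K" "?K \<subseteq> J \<times> UNIV" using cd by (auto intro!: compact_Times)
  then obtain C where C: "\<forall>\<^sub>F \<epsilon> in at_right 0. \<forall>z\<in>?K. norm (a \<epsilon> z) \<le> C"
    using c_bounded_maps_locally_bounded[OF A a] by blast
  have "\<forall>\<^sub>F \<epsilon> in at_right 0. \<forall>r\<in>{c..d}. \<forall>s\<in>{c..d}. norm (u \<epsilon> s - u \<epsilon> r) \<le> max C 1 * \<bar>s - r\<bar>"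
    using C eventually_params
  proof eventually_elim
    case (elim \<epsilon>)
    have "norm (u \<epsilon> s - u \<epsilon> r) \<le> max C 1 * norm (s - r)" if "r \<in> {c..d}" "s \<in> {c..d}" for r s
    proof (rule differentiable_bound[of "{c..d}" "u \<epsilon>" "\<lambda>s t. t *\<^sub>R a \<epsilon> (s, u \<epsilon> s)"])
      fix x assume x: "x \<in> {c..d}"
      show "(u \<epsilon> has_derivative (\<lambda>t. t *\<^sub>R a \<epsilon> (x, u \<epsilon> x))) (at x within {c..d})"
        unfolding has_vector_derivative_def[symmetric]
        by (rule has_vector_derivative_within_subset[OF solves cd]) (use elim x cd in auto)
      have "(x, u \<epsilon> x) \<in> ?K" using R elim(2) x by auto
      then have "norm (a \<epsilon> (x, u \<epsilon> x)) \<le> max C 1" using elim(1) by force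
      then show "onorm (\<lambda>t. t *\<^sub>R a \<epsilon> (x, u \<epsilon> x)) \<le> max C 1"
        by (intro onorm_le) (simp add: mult.commute[of _ "\<bar>_\<bar>"] mult_left_mono)
    qed (use that in auto)
    then show ?case by (simp add: real_norm_def)
  qed
  then show thesis by (intro that[of "max C 1"]) auto
qed

end

section \<open>The initial condition\<close>

lemma norm_component_le:
  fixes z :: "'a::real_normed_vector \<times> 'b::real_normed_vector"
  shows "norm (fst z) \<le> norm z" and "norm (snd z) \<le> norm z"
  using norm_fst_le[of "fst z" "snd z"] norm_snd_le[of "snd z" "fst z"] by simp_all

lemma moderate_points_snd:
  "p \<in> moderate_points S \<Longrightarrow> (\<lambda>\<epsilon>. snd (p \<epsilon>)) \<in> moderate_points UNIV"
  unfolding moderate_points_iff by (auto elim!: eventually_mono intro: order_trans[OF norm_component_le(2)])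

lemma moderate_points_fst:
  assumes "p \<in> moderate_points (J \<times> T)"
  shows "(\<lambda>\<epsilon>. fst (p \<epsilon>)) \<in> moderate_points J"
proof -
  obtain N where "\<forall>\<^sub>F \<epsilon> in at_right 0. norm (p \<epsilon>) \<le> \<epsilon> powr (- N)"
    using assms unfolding moderate_points_iff by blast
  then have "\<forall>\<^sub>F \<epsilon> in at_right 0. norm (fst (p \<epsilon>)) \<le> \<epsilon> powr (- N)"
    by eventually_elim (rule order_trans[OF norm_component_le(1)])
  moreover have "fst (p \<epsilon>) \<in> J" if "\<epsilon> \<in> params" for \<epsilon>
  proof -
    have "p \<epsilon> \<in> J \<times> T" using assms that unfolding moderate_points_iff by blast
    then show ?thesis by (simp add: mem_Times_iff)
  qed
  ultimately show ?thesis unfolding moderate_points_iff by blast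
qed

lemma point_equiv_fst:
  assumes "(p, r) \<in> point_equiv (J \<times> T)"
  shows "((\<lambda>\<epsilon>. fst (p \<epsilon>)), (\<lambda>\<epsilon>. fst (r \<epsilon>))) \<in> point_equiv J"
  unfolding point_equiv_iff
proof (intro conjI moderate_points_fst allI)
  show "p \<in> moderate_points (J \<times> T)" "r \<in> moderate_points (J \<times> T)"
    using assms by (auto simp: point_equiv_iff)
  fix q
  have "\<forall>\<^sub>F \<epsilon> in at_right 0. norm (p \<epsilon> - r \<epsilon>) \<le> \<epsilon> powr q" using assms by (auto simp: point_equiv_iff)
  then show "\<forall>\<^sub>F \<epsilon> in at_right 0. norm (fst (p \<epsilon>) - fst (r \<epsilon>)) \<le> \<epsilon> powr q"
  proof eventually_elim
    case (elim \<epsilon>)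
    then show ?case using norm_component_le(1)[of "p \<epsilon> - r \<epsilon>"] by simp
  qed
qed

lemma point_equiv_snd:
  assumes "(p, r) \<in> point_equiv S"
  shows "((\<lambda>\<epsilon>. snd (p \<epsilon>)), (\<lambda>\<epsilon>. snd (r \<epsilon>))) \<in> point_equiv UNIV"
  unfolding point_equiv_iff
proof (intro conjI moderate_points_snd allI)
  show "p \<in> moderate_points S" "r \<in> moderate_points S"
    using assms by (auto simp: point_equiv_iff)
  fix q
  have "\<forall>\<^sub>F \<epsilon> in at_right 0. norm (p \<epsilon> - r \<epsilon>) \<le> \<epsilon> powr q" using assms by (auto simp: point_equiv_iff)
  then show "\<forall>\<^sub>F \<epsilon> in at_right 0. norm (snd (p \<epsilon>) - snd (r \<epsilon>)) \<le> \<epsilon> powr q"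
  proof eventually_elim
    case (elim \<epsilon>)
    then show ?case using norm_component_le(2)[of "p \<epsilon> - r \<epsilon>"] by simp
  qed
qed

text \<open>
The values of a representative at large parameters are irrelevant for its class and can be moved into
the compact set.
\<close>

lemma compactly_supported_representative:
  assumes P: "P \<in> gen_points S" and supp: "compactly_supported S P"
  obtains p K where "p \<in> P" "compact K" "K \<subseteq> S" "\<And>\<epsilon>. \<epsilon> \<in> params \<Longrightarrow> p \<epsilon> \<in> K"
proof -
  obtain p K where p: "p \<in> P" and K: "compact K" "K \<subseteq> S" and ev: "\<forall>\<^sub>F \<epsilon> in at_right 0. p \<epsilon> \<in> K"
    using supp by (auto simp: compactly_supported_def)
  obtain z where z: "z \<in> K"
    using eventually_happens[OF ev] trivial_limit_at_right_real by blast
  define r where "r \<epsilon> = (if p \<epsilon> \<in> K then p \<epsilon> else z)" for \<epsilon>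
  have rK: "r \<epsilon> \<in> K" for \<epsilon> by (simp add: r_def z)
  have pm: "p \<in> moderate_points S"
    using in_quotient_imp_subset[OF equiv_point_equiv, of P S] P p unfolding gen_points_def by blast
  have near: "\<forall>\<^sub>F \<epsilon> in at_right 0. norm (p \<epsilon> - r \<epsilon>) \<le> \<epsilon> powr q" for q
    using ev by eventually_elim (simp add: r_def)
  have "r \<in> moderate_points S"
    by (rule moderate_points_near[OF pm near[of 0]]) (use rK K(2) in blast)
  then have "(p, r) \<in> point_equiv S" using pm near by (simp add: point_equiv_iff)
  then have "r \<in> P"
    using in_quotient_imp_closed[OF equiv_point_equiv] P p unfolding gen_points_def by blast
  then show thesis using that K rK by blast
qed

locale cauchy_net = solution_net J A a u for J :: "real set"
    and A :: "(real \<Rightarrow> real \<times> 'a::euclidean_space \<Rightarrow> 'a) set"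
    and a :: "real \<Rightarrow> real \<times> 'a \<Rightarrow> 'a" and u :: "real \<Rightarrow> real \<Rightarrow> 'a" +
  fixes P :: "(real \<Rightarrow> real \<times> 'a) set" and p0 :: "real \<Rightarrow> real \<times> 'a" and K0 :: "(real \<times> 'a) set"
  assumes P: "P \<in> gen_points (J \<times> UNIV)" and p0: "p0 \<in> P"
    and K0: "compact K0" "K0 \<subseteq> J \<times> UNIV" "\<And>\<epsilon>. \<epsilon> \<in> params \<Longrightarrow> p0 \<epsilon> \<in> K0"
    and init: "\<And>\<epsilon>. \<epsilon> \<in> params \<Longrightarrow> u \<epsilon> (fst (p0 \<epsilon>)) = snd (p0 \<epsilon>)"
begin

lemma P_equiv: "p \<in> P \<Longrightarrow> (p0, p) \<in> point_equiv (J \<times> UNIV)"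
  using in_quotient_imp_in_rel[OF equiv_point_equiv, of P "J \<times> UNIV" p0 p] P p0
  unfolding gen_points_def by blast

lemma times_compact: "compact (fst ` K0)" "fst ` K0 \<subseteq> J"
  using K0(1,2) by (auto intro!: compact_continuous_image continuous_intros)

lemma gen_snd_class: "gen_snd UNIV P = point_class UNIV (\<lambda>\<epsilon>. snd (p0 \<epsilon>))"
proof -
  have "point_class UNIV (\<lambda>\<epsilon>. snd (p \<epsilon>)) = point_class UNIV (\<lambda>\<epsilon>. snd (p0 \<epsilon>))" if "p \<in> P" for p
    using point_class_eq[OF point_equiv_snd[OF P_equiv[OF that]]] by simp
  then show ?thesis unfolding gen_snd_def using p0 by blast
qed

lemma gen_fst_class: "gen_fst J P = point_class J (\<lambda>\<epsilon>. fst (p0 \<epsilon>))"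
proof -
  have "point_class J (\<lambda>\<epsilon>. fst (p \<epsilon>)) = point_class J (\<lambda>\<epsilon>. fst (p0 \<epsilon>))" if "p \<in> P" for p
    using point_class_eq[OF point_equiv_fst[OF P_equiv[OF that]]] by simp
  then show ?thesis unfolding gen_fst_def using p0 by blast
qed

text \<open>
Replacing the initial time by an equivalent net changes the value only negligibly since the solutions
are eventually Lipschitz; the relative neighbourhood of the compact set of initial times contains
the new times for small parameters.
\<close>

lemma value_at_initial_point:
  assumes v: "(u, v) \<in> net_equiv J" and r: "((\<lambda>\<epsilon>. fst (p0 \<epsilon>)), r) \<in> point_equiv J"
  shows "((\<lambda>\<epsilon>. snd (p0 \<epsilon>)), (\<lambda>\<epsilon>. v \<epsilon> (r \<epsilon>))) \<in> point_equiv UNIV"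
proof -
  obtain c d \<eta> where cd: "{c..d} \<subseteq> J" "fst ` K0 \<subseteq> {c..d}" "0 < \<eta>"
    and nbhd: "\<And>x y. \<lbrakk>x \<in> fst ` K0; y \<in> J; \<bar>y - x\<bar> < \<eta>\<rbrakk> \<Longrightarrow> y \<in> {c..d}"
    using compact_in_interval[OF times_compact] by metis
  obtain C where C: "0 < C"
    "\<forall>\<^sub>F \<epsilon> in at_right 0. \<forall>r\<in>{c..d}. \<forall>s\<in>{c..d}. norm (u \<epsilon> s - u \<epsilon> r) \<le> C * \<bar>s - r\<bar>"
    by (rule eventually_lipschitz[OF cd(1)]) blast
  have near: "\<forall>\<^sub>F \<epsilon> in at_right 0. norm (fst (p0 \<epsilon>) - r \<epsilon>) \<le> \<epsilon> powr q" for q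
    using r by (simp add: point_equiv_iff)
  have rJ: "r \<epsilon> \<in> J" if "\<epsilon> \<in> params" for \<epsilon>
    using r that unfolding point_equiv_iff moderate_points_iff by blast
  \<comment> \<open>For \<open>\<epsilon> < \<eta>\<close> the perturbed initial time is within the margin \<open>\<eta>\<close>.\<close>
  have "\<forall>\<^sub>F \<epsilon> in at_right 0. 2 / \<eta> * \<epsilon> powr 1 \<le> \<epsilon> powr 0"
    by (rule eventually_mult_powr_le) simp
  then have r_in: "\<forall>\<^sub>F \<epsilon> in at_right 0. r \<epsilon> \<in> {c..d} \<and> fst (p0 \<epsilon>) \<in> {c..d}"
    using near[of 1] eventually_params
  proof eventually_elim
    case (elim \<epsilon>)
    have "2 / \<eta> * \<epsilon> \<le> 1" using elim(1,3) by simp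
    then have "\<epsilon> < \<eta>" using elim(3) cd(3) by (simp add: field_simps)
    then have "\<bar>r \<epsilon> - fst (p0 \<epsilon>)\<bar> < \<eta>" using elim(2,3) by (simp add: abs_minus_commute)
    then show ?case using nbhd[OF _ rJ[OF elim(3)]] cd(2) K0(3)[OF elim(3)] by blast
  qed
  have dist: "\<forall>\<^sub>F \<epsilon> in at_right 0. norm (snd (p0 \<epsilon>) - v \<epsilon> (r \<epsilon>)) \<le> \<epsilon> powr q" for q
  proof -
    have "\<forall>\<^sub>F \<epsilon> in at_right 0. \<forall>s\<in>{c..d}. norm (u \<epsilon> s - v \<epsilon> s) \<le> \<epsilon> powr (q + 1)"
      using v cd(1) unfolding net_equiv_iff locally_negligible_def by blast
    moreover have "\<forall>\<^sub>F \<epsilon> in at_right 0. (C + 1) * \<epsilon> powr (q + 1) \<le> \<epsilon> powr q"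
      by (rule eventually_mult_powr_le) simp
    ultimately show ?thesis using near[of "q + 1"] r_in C(2) eventually_params
    proof eventually_elim
      case (elim \<epsilon>)
      have "norm (snd (p0 \<epsilon>) - u \<epsilon> (r \<epsilon>)) \<le> C * \<bar>fst (p0 \<epsilon>) - r \<epsilon>\<bar>"
        using elim(5)[rule_format, of "r \<epsilon>" "fst (p0 \<epsilon>)"] elim(4) init[OF elim(6)] by simp
      also have "\<dots> \<le> C * \<epsilon> powr (q + 1)" using elim(3) C(1) by (intro mult_left_mono) auto
      finally have "norm (snd (p0 \<epsilon>) - u \<epsilon> (r \<epsilon>)) \<le> C * \<epsilon> powr (q + 1)" .
      moreover have "norm (u \<epsilon> (r \<epsilon>) - v \<epsilon> (r \<epsilon>)) \<le> \<epsilon> powr (q + 1)" using elim(1,4) by blast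
      ultimately show ?case
        using elim(2) norm_triangle_ineq[of "snd (p0 \<epsilon>) - u \<epsilon> (r \<epsilon>)" "u \<epsilon> (r \<epsilon>) - v \<epsilon> (r \<epsilon>)"]
        by (simp add: algebra_simps)
    qed
  qed
  have "p0 \<in> moderate_points (J \<times> UNIV)" using P_equiv[OF p0] by (simp add: point_equiv_iff)
  note m = moderate_points_snd[OF this]
  show ?thesis
    unfolding point_equiv_iff using m moderate_points_near[OF m dist[of 0], of UNIV] dist by simp
qed

lemma initial_condition: "gen_value UNIV (net_class J u) (gen_fst J P) = gen_snd UNIV P"
proof -
  have "point_class UNIV (\<lambda>\<epsilon>. v \<epsilon> (r \<epsilon>)) = point_class UNIV (\<lambda>\<epsilon>. snd (p0 \<epsilon>))"
    if "v \<in> net_class J u" "r \<in> gen_fst J P" for v r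
    using value_at_initial_point[of v r] that point_class_eq
    unfolding in_class_iff gen_fst_class point_class_def by blast
  moreover have "u \<in> net_class J u"
    unfolding net_class_def by (rule equiv_class_self[OF equiv_net_equiv u_moderate])
  moreover have "(\<lambda>\<epsilon>. fst (p0 \<epsilon>)) \<in> gen_fst J P"
    using point_equiv_fst[OF P_equiv[OF p0]] unfolding gen_fst_class point_class_def by blast
  ultimately show ?thesis unfolding gen_value_def gen_snd_class by blast
qed

lemma limit_locally_lipschitz:
  assumes e: "\<And>n::nat. e n \<in> params" "e \<longlonglongrightarrow> 0"
    and lim: "\<And>s. s \<in> J \<Longrightarrow> (\<lambda>n. u (e n) s) \<longlonglongrightarrow> \<zeta> s" and cd: "{c..d} \<subseteq> J"
  obtains C where "0 < C" "\<And>r s. \<lbrakk>r \<in> {c..d}; s \<in> {c..d}\<rbrakk> \<Longrightarrow> norm (\<zeta> s - \<zeta> r) \<le> C * \<bar>s - r\<bar>"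
proof -
  obtain C where C: "0 < C"
    "\<forall>\<^sub>F \<epsilon> in at_right 0. \<forall>r\<in>{c..d}. \<forall>s\<in>{c..d}. norm (u \<epsilon> s - u \<epsilon> r) \<le> C * \<bar>s - r\<bar>"
    by (rule eventually_lipschitz[OF cd]) blast
  have ev: "\<forall>\<^sub>F n in sequentially. \<forall>r\<in>{c..d}. \<forall>s\<in>{c..d}. norm (u (e n) s - u (e n) r) \<le> C * \<bar>s - r\<bar>"
    by (rule eventually_compose_filterlim[OF C(2) filterlim_params_sequence[OF e]])
  show thesis
  proof (rule that[OF C(1)])
    fix r s assume rs: "r \<in> {c..d}" "s \<in> {c..d}"
    have "(\<lambda>n. norm (u (e n) s - u (e n) r)) \<longlonglongrightarrow> norm (\<zeta> s - \<zeta> r)"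
      using rs cd by (intro tendsto_intros lim) auto
    moreover have "\<forall>\<^sub>F n in sequentially. norm (u (e n) s - u (e n) r) \<le> C * \<bar>s - r\<bar>"
      using ev by eventually_elim (use rs in blast)
    ultimately show "norm (\<zeta> s - \<zeta> r) \<le> C * \<bar>s - r\<bar>"
      by (rule tendsto_upperbound) simp
  qed
qed

end

lemma lipschitz_imp_locally_absolutely_continuous:
  assumes "\<And>c d. c \<le> d \<Longrightarrow> {c..d} \<subseteq> J \<Longrightarrow>
    \<exists>C>0. \<forall>r\<in>{c..d}. \<forall>s\<in>{c..d}. norm (z s - z r) \<le> C * \<bar>s - r\<bar>"
  shows "locally_absolutely_continuous_on z J"
  unfolding locally_absolutely_continuous_on_def
proof (intro allI impI)
  fix c d e :: real assume cd: "c \<le> d \<and> {c..d} \<subseteq> J" and e: "0 < e"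
  obtain C where C: "0 < C" "\<And>r s. r \<in> {c..d} \<Longrightarrow> s \<in> {c..d} \<Longrightarrow> norm (z s - z r) \<le> C * \<bar>s - r\<bar>"
    using assms cd by blast
  show "\<exists>\<delta>>0. \<forall>(n::nat) l r. (\<forall>i<n. c \<le> l i \<and> l i \<le> r i \<and> r i \<le> d) \<and>
      disjoint_family_on (\<lambda>i. {l i<..<r i}) {..<n} \<and> (\<Sum>i<n. r i - l i) < \<delta> \<longrightarrow>
      (\<Sum>i<n. norm (z (r i) - z (l i))) < e"
  proof (intro exI[of _ "e / C"] conjI allI impI)
    fix n :: nat and l r :: "nat \<Rightarrow> real"
    assume *: "(\<forall>i<n. c \<le> l i \<and> l i \<le> r i \<and> r i \<le> d) \<and>
      disjoint_family_on (\<lambda>i. {l i<..<r i}) {..<n} \<and> (\<Sum>i<n. r i - l i) < e / C"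
    have "(\<Sum>i<n. norm (z (r i) - z (l i))) \<le> (\<Sum>i<n. C * (r i - l i))"
    proof (rule sum_mono)
      fix i assume "i \<in> {..<n}"
      then have i: "c \<le> l i" "l i \<le> r i" "r i \<le> d" using * by auto
      have "norm (z (r i) - z (l i)) \<le> C * \<bar>r i - l i\<bar>" by (rule C(2)) (use i in auto)
      then show "norm (z (r i) - z (l i)) \<le> C * (r i - l i)" using i by simp
    qed
    also have "\<dots> = C * (\<Sum>i<n. r i - l i)" by (simp add: sum_distrib_left)
    also have "\<dots> < C * (e / C)" using * C(1) by (intro mult_strict_left_mono) auto
    finally show "(\<Sum>i<n. norm (z (r i) - z (l i))) < e" using C(1) by simp
  qed (use e C in simp)
qed

context time_interval
begin

lemma continuous_on_if_on_compact_intervals: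
  assumes "\<And>c d. c \<in> J \<Longrightarrow> d \<in> J \<Longrightarrow> continuous_on {c..d} f"
  shows "continuous_on J f"
  unfolding continuous_on_eq_continuous_within
proof
  fix s assume s: "s \<in> J"
  obtain c d \<eta> where cd: "c \<in> J" "d \<in> J" "{c..d} \<subseteq> J" "{s} \<subseteq> {c..d}" "0 < \<eta>"
    and nbhd: "\<And>x y. \<lbrakk>x \<in> {s}; y \<in> J; \<bar>y - x\<bar> < \<eta>\<rbrakk> \<Longrightarrow> y \<in> {c..d}"
    using compact_in_interval[of "{s}"] s by (metis compact_sing empty_subsetI insert_subset)
  then show "continuous (at s within J) f"
    using assms[OF cd(1,2)] at_within_interval[of s \<eta> c d] by (simp add: continuous_on_eq_continuous_within)
qed

end

section \<open>The limit curve\<close>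

context cauchy_net
begin

context
  fixes e :: "nat \<Rightarrow> real" and t x \<zeta>
  assumes e: "\<And>n. e n \<in> params" "e \<longlonglongrightarrow> 0"
    and p0_lim: "(\<lambda>n. p0 (e n)) \<longlonglongrightarrow> (t, x)"
    and u_lim: "\<And>K. compact K \<Longrightarrow> K \<subseteq> J \<Longrightarrow> uniform_limit K (\<lambda>n. u (e n)) \<zeta> sequentially"
begin

lemma limit_absolutely_continuous: "locally_absolutely_continuous_on \<zeta> J"
proof (rule lipschitz_imp_locally_absolutely_continuous)
  fix c d assume sub: "{c..d} \<subseteq> J"
  have pt: "(\<lambda>n. u (e n) s) \<longlonglongrightarrow> \<zeta> s" if "s \<in> J" for s
    using tendsto_uniform_limitI[OF u_lim[of "{s}"], of s] that by simp
  show "\<exists>C>0. \<forall>r\<in>{c..d}. \<forall>s\<in>{c..d}. norm (\<zeta> s - \<zeta> r) \<le> C * \<bar>s - r\<bar>"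
    by (rule limit_locally_lipschitz[of e \<zeta> c d]) (use e pt sub in blast)+
qed

lemma limit_continuous: "continuous_on J \<zeta>"
proof (rule continuous_on_if_on_compact_intervals)
  fix c d assume "c \<in> J" "d \<in> J"
  then have sub: "{c..d} \<subseteq> J" by (rule atLeastAtMost_subset)
  have "continuous_on {c..d} (u (e n))" for n
    using moderate_upto_continuous[OF moderate_imp_upto[OF u_moderate] e(1)] sub
    by (rule continuous_on_subset)
  then show "continuous_on {c..d} \<zeta>"
    by (intro uniform_limit_theorem[OF _ u_lim]) (use sub in auto)
qed

lemma limit_time: "t \<in> J"
proof -
  have "(t, x) \<in> K0"
    by (rule Lim_in_closed_set[OF compact_imp_closed[OF K0(1)] _ _ p0_lim]) (use K0(3) e(1) in auto)
  then show ?thesis using K0(2) by auto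
qed

text \<open>
The solutions converge uniformly on the compact set of initial times, and the limit curve is
continuous, so the values at the converging initial times converge to \<open>\<zeta> t\<close>.
\<close>

lemma limit_initial_value: "\<zeta> t = x"
proof (rule LIMSEQ_unique)
  have fst_lim: "(\<lambda>n. fst (p0 (e n))) \<longlonglongrightarrow> t" using tendsto_fst[OF p0_lim] by simp
  have inJ: "fst (p0 (e n)) \<in> fst ` K0" for n using K0(3)[OF e(1)] by blast
  have "(\<lambda>n. \<zeta> (fst (p0 (e n)))) \<longlonglongrightarrow> \<zeta> t"
    by (rule continuous_on_tendsto_compose[OF limit_continuous fst_lim limit_time], rule always_eventually)
      (use inJ times_compact(2) in blast)
  moreover have "(\<lambda>n. u (e n) (fst (p0 (e n))) - \<zeta> (fst (p0 (e n)))) \<longlonglongrightarrow> 0"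
  proof (rule tendstoI)
    fix \<delta> :: real assume "0 < \<delta>"
    with u_lim[OF times_compact]
    have "\<forall>\<^sub>F n in sequentially. \<forall>s\<in>fst ` K0. dist (u (e n) s) (\<zeta> s) < \<delta>"
      by (rule uniform_limitD)
    then show "\<forall>\<^sub>F n in sequentially. dist (u (e n) (fst (p0 (e n))) - \<zeta> (fst (p0 (e n)))) 0 < \<delta>"
    proof eventually_elim
      case (elim n)
      from bspec[OF this inJ[of n]] show ?case by (simp add: dist_norm)
    qed
  qed
  ultimately have "(\<lambda>n. \<zeta> (fst (p0 (e n))) + (u (e n) (fst (p0 (e n))) - \<zeta> (fst (p0 (e n))))) \<longlonglongrightarrow> \<zeta> t + 0"
    by (rule tendsto_add)
  then show "(\<lambda>n. snd (p0 (e n))) \<longlonglongrightarrow> \<zeta> t" using init[OF e(1)] by simp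
  show "(\<lambda>n. snd (p0 (e n))) \<longlonglongrightarrow> x" using tendsto_snd[OF p0_lim] by simp
qed

lemma subnet_convergence:
  assumes v: "v \<in> net_class J u" and p: "p \<in> P"
  shows "\<exists>\<tau>\<in>subnet_maps. ((\<lambda>\<epsilon>. p (\<tau> \<epsilon>)) \<longlongrightarrow> (t, x)) (at_right 0) \<and>
    (\<forall>K. compact K \<and> K \<subseteq> J \<longrightarrow> uniform_limit K (\<lambda>\<epsilon>. v (\<tau> \<epsilon>)) \<zeta> (at_right 0))"
proof (rule bexI[OF _ subnet_map_of_sequence[of e, OF e]], intro conjI allI impI)
  let ?N = "\<lambda>\<epsilon>::real. nat \<lfloor>1 / \<epsilon>\<rfloor>"
  have e0: "filterlim (\<lambda>\<epsilon>. e (?N \<epsilon>)) (at_right 0) (at_right 0)"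
    by (rule filterlim_compose[OF filterlim_params_sequence[of e, OF e] filterlim_nat_floor_inverse])
  have "\<forall>\<^sub>F \<epsilon> in at_right 0. norm (p0 \<epsilon> - p \<epsilon>) \<le> \<epsilon> powr 1"
    using P_equiv[OF p] unfolding point_equiv_iff by blast
  then have "\<forall>\<^sub>F \<epsilon> in at_right 0. norm (p0 \<epsilon> - p \<epsilon>) \<le> \<epsilon>"
    using eventually_params by eventually_elim simp
  then have "((\<lambda>\<epsilon>. p0 \<epsilon> - p \<epsilon>) \<longlongrightarrow> 0) (at_right 0)"
    by (rule Lim_null_comparison) (rule tendsto_ident_at)
  from tendsto_diff[OF filterlim_compose[OF p0_lim filterlim_nat_floor_inverse] filterlim_compose[OF this e0]]
  show "((\<lambda>\<epsilon>. p (e (?N \<epsilon>))) \<longlongrightarrow> (t, x)) (at_right 0)" by simp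
  fix K assume K: "compact K \<and> K \<subseteq> J"
  have "\<forall>\<^sub>F \<epsilon> in at_right 0. \<forall>s\<in>K. norm (u \<epsilon> s - v \<epsilon> s) \<le> \<epsilon> powr 1"
    using v K unfolding in_class_iff net_equiv_iff locally_negligible_def by blast
  then have close: "\<forall>\<^sub>F \<epsilon> in at_right 0. \<forall>s\<in>K. norm (u \<epsilon> s - v \<epsilon> s) \<le> \<epsilon>"
    using eventually_params by eventually_elim simp
  show "uniform_limit K (\<lambda>\<epsilon>. v (e (?N \<epsilon>))) \<zeta> (at_right 0)"
  proof (rule uniform_limitI)
    fix \<delta> :: real assume \<delta>: "0 < \<delta>"
    have "\<forall>\<^sub>F n in sequentially. \<forall>s\<in>K. dist (u (e n) s) (\<zeta> s) < \<delta> / 2"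
      using u_lim[of K] K \<delta> by (intro uniform_limitD) auto
    from eventually_compose_filterlim[OF this filterlim_nat_floor_inverse]
    have 1: "\<forall>\<^sub>F \<epsilon> in at_right 0. \<forall>s\<in>K. dist (u (e (?N \<epsilon>)) s) (\<zeta> s) < \<delta> / 2" .
    have "\<forall>\<^sub>F \<epsilon>::real in at_right 0. \<epsilon> < \<delta> / 2"
      using \<delta> by (intro eventually_at_rightI[of 0 "\<delta> / 2"]) auto
    with close have "\<forall>\<^sub>F \<epsilon> in at_right 0. \<forall>s\<in>K. norm (u \<epsilon> s - v \<epsilon> s) < \<delta> / 2"
      by eventually_elim (auto intro: le_less_trans)
    from eventually_compose_filterlim[OF this e0]
    have 2: "\<forall>\<^sub>F \<epsilon> in at_right 0. \<forall>s\<in>K. norm (u (e (?N \<epsilon>)) s - v (e (?N \<epsilon>)) s) < \<delta> / 2" .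
    from 1 2 show "\<forall>\<^sub>F \<epsilon> in at_right 0. \<forall>s\<in>K. dist (v (e (?N \<epsilon>)) s) (\<zeta> s) < \<delta>"
    proof eventually_elim
      case (elim \<epsilon>)
      show ?case
      proof
        fix s assume s: "s \<in> K"
        show "dist (v (e (?N \<epsilon>)) s) (\<zeta> s) < \<delta>"
          by (rule dist_triangle_half_r[of "u (e (?N \<epsilon>)) s"])
            (use bspec[OF elim(1) s] bspec[OF elim(2) s] in \<open>simp_all add: dist_norm\<close>)
      qed
    qed
  qed
qed

lemma limit_integral:
  assumes s: "s \<in> J" "t \<le> s"
  shows "(\<lambda>r. supporting_function A r (\<zeta> r) w) absolutely_integrable_on {t..s} \<and>
    \<zeta> s \<bullet> w \<le> x \<bullet> w + integral {t..s} (\<lambda>r. supporting_function A r (\<zeta> r) w)"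
proof -
  interpret locally_bounded_field J a \<zeta>
  proof
    show "continuous_on (J \<times> UNIV) (a \<epsilon>)" if "\<epsilon> \<in> params" for \<epsilon>
      using a_moderate that smooth_on_continuous[of _ "a \<epsilon>" "[]"] by (simp add: moderate_nets_def)
  qed (use c_bounded_maps_locally_bounded[OF A a] limit_continuous in auto)
  have sub: "{t..s} \<subseteq> J" by (rule atLeastAtMost_subset[OF limit_time s(1)])
  obtain C m0 where C: "\<And>r i m. \<lbrakk>r \<in> {t..s}; m0 \<le> m; i \<in> nearby m\<rbrakk> \<Longrightarrow>
      norm (a (fst i) (r, \<zeta> r + snd i)) \<le> C"
    using bound_near_\<zeta>[OF sub] by metis
  have eq: "supporting_function A r (\<zeta> r) w = support w r" if "r \<in> {t..s}" for r
    using gen_graph_slice[OF A_colombeau a, of r "\<zeta> r"] that sub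
    unfolding supporting_function_def support_def by auto
  have "(\<lambda>r. supporting_function A r (\<zeta> r) w) absolutely_integrable_on {t..s}"
    by (rule absolutely_integrable_spike[OF support_absolutely_integrable[OF sub C] negligible_empty])
      (use eq in auto)
  moreover have "\<zeta> s \<bullet> w \<le> \<zeta> t \<bullet> w + integral {t..s} (support w)"
  proof (rule limit_integral_inequality[OF sub C s(2) e])
    show "(u (e n) has_vector_derivative a (e n) (s, u (e n) s)) (at s within J)" if "s \<in> J" for n s
      by (rule solves[OF e(1) that])
  qed (use u_lim[OF compact_Icc sub] in auto)
  moreover have "integral {t..s} (\<lambda>r. supporting_function A r (\<zeta> r) w) = integral {t..s} (support w)"
    by (rule integral_cong) (rule eq)
  ultimately show ?thesis using limit_initial_value by simp
qed

end

end

text \<open>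
An antiderivative of \<open>\<beta>\<close> is a common modulus of continuity for all solutions, forwards and
backwards in time.
\<close>

lemma (in time_interval) increment_le_antiderivative:
  fixes v :: "real \<Rightarrow> 'b::euclidean_space"
  assumes v: "\<And>s. s \<in> J \<Longrightarrow> (v has_vector_derivative g s) (at s within J)"
    and N: "negligible N" and bound: "\<And>s. s \<in> J - N \<Longrightarrow> norm (g s) \<le> \<beta> s"
    and \<beta>: "locally_integrable_on \<beta> J" and cd: "c \<in> J" "d \<in> J"
    and rs: "r \<in> {c..d}" "s \<in> {c..d}"
  shows "norm (v s - v r) \<le> \<bar>integral {c..s} \<beta> - integral {c..r} \<beta>\<bar>"
proof -
  have sub: "{c..d} \<subseteq> J" using cd by (rule atLeastAtMost_subset)
  have *: "norm (v s - v r) \<le> integral {c..s} \<beta> - integral {c..r} \<beta>"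
    if "r \<in> {c..d}" "s \<in> {c..d}" "r \<le> s" for r s
  proof -
    have "{c..s} \<subseteq> J" using sub that by auto
    then have "\<beta> integrable_on {c..s}"
      using \<beta> unfolding locally_integrable_on_def absolutely_integrable_on_def by blast
    then have "integral {c..r} \<beta> + integral {r..s} \<beta> = integral {c..s} \<beta>"
      using that by (intro Henstock_Kurzweil_Integration.integral_combine) auto
    moreover have "norm (v s - v r) \<le> integral {r..s} \<beta>"
      by (rule growth_bound[OF v N bound \<beta>]) (use that sub in auto)
    ultimately show ?thesis by linarith
  qed
  show ?thesis
  proof (cases "r \<le> s")
    case True
    from *[OF rs True] show ?thesis by linarith
  next
    case False
    with *[OF rs(2,1)] show ?thesis by (simp add: norm_minus_commute)
  qed
qed

theorem theorem3p3p6: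
  fixes J :: "real set"
    and A :: "(real \<Rightarrow> real \<times> (real ^ 'n) \<Rightarrow> real ^ 'n) set"
    and a :: "real \<Rightarrow> real \<times> (real ^ 'n) \<Rightarrow> real ^ 'n"
    and \<beta> :: "real \<Rightarrow> real"
    and P :: "(real \<Rightarrow> real \<times> (real ^ 'n)) set"
  assumes "is_interval J" and "interior J \<noteq> {}"
    and "A \<in> c_bounded_maps (J \<times> UNIV) UNIV"
    and "natural_type (J \<times> UNIV) A"
    and "a \<in> A"
    and "\<forall>t\<in>J. 0 < \<beta> t" and "locally_integrable_on \<beta> J"
    and "AE t in lebesgue. t \<in> J \<longrightarrow> (\<forall>\<epsilon>\<in>params. \<forall>x. norm (a \<epsilon> (t, x)) \<le> \<beta> t)"
    and "P \<in> gen_points (J \<times> UNIV)" and "compactly_supported (J \<times> UNIV) P"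
  shows "\<exists>\<xi> \<in> c_bounded_maps J UNIV.
    gen_deriv J \<xi> = gen_along J A \<xi> \<and>
    gen_value UNIV \<xi> (gen_fst J P) = gen_snd UNIV P \<and>
    (\<exists>t x \<zeta>. t \<in> closure J \<and> locally_absolutely_continuous_on \<zeta> J \<and>
       (\<forall>u\<in>\<xi>. \<forall>p\<in>P. \<exists>\<tau>\<in>subnet_maps.
          ((\<lambda>\<epsilon>. p (\<tau> \<epsilon>)) \<longlongrightarrow> (t, x)) (at_right 0) \<and>
          (\<forall>K. compact K \<and> K \<subseteq> J \<longrightarrow> uniform_limit K (\<lambda>\<epsilon>. u (\<tau> \<epsilon>)) \<zeta> (at_right 0))) \<and>
       (\<forall>w. \<forall>s\<in>J. t \<le> s \<longrightarrow>
          (\<lambda>r. supporting_function A r (\<zeta> r) w) absolutely_integrable_on {t..s} \<and>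
          \<zeta> s \<bullet> w \<le> x \<bullet> w + integral {t..s} (\<lambda>r. supporting_function A r (\<zeta> r) w)))"
proof -
  interpret time_interval J by unfold_locales (fact assms(1), fact assms(2))
  have \<beta>: "locally_integrable_on \<beta> J" and nonneg: "\<And>s. s \<in> J \<Longrightarrow> 0 \<le> \<beta> s"
    using assms(6,7) less_imp_le by blast+
  have col: "A \<in> colombeau (J \<times> UNIV)" using assms(3) by (simp add: c_bounded_maps_def)
  have a_mod: "a \<in> moderate_nets (J \<times> UNIV)"
    by (rule colombeau_representative_moderate[OF col assms(5)])
  obtain N where N: "negligible N"
    and bound: "\<And>\<epsilon> t y. \<lbrakk>\<epsilon> \<in> params; t \<in> J - N\<rbrakk> \<Longrightarrow> norm (a \<epsilon> (t, y)) \<le> \<beta> t"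
  proof -
    obtain N where "N \<in> null_sets lebesgue"
      "{t \<in> space lebesgue. \<not> (t \<in> J \<longrightarrow> (\<forall>\<epsilon>\<in>params. \<forall>x. norm (a \<epsilon> (t, x)) \<le> \<beta> t))} \<subseteq> N"
      using assms(8) unfolding eventually_ae_filter by blast
    moreover from this(2) have "norm (a \<epsilon> (t, y)) \<le> \<beta> t" if "\<epsilon> \<in> params" "t \<in> J - N" for \<epsilon> t y
      using that by (auto simp del: greaterThanAtMost_iff)
    ultimately show thesis by (intro that[of N]) (simp_all add: negligible_iff_null_sets)
  qed
  obtain p0 K0 where p0: "p0 \<in> P" and K0: "compact K0" "K0 \<subseteq> J \<times> UNIV"
    "\<And>\<epsilon>. \<epsilon> \<in> params \<Longrightarrow> p0 \<epsilon> \<in> K0"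
    by (rule compactly_supported_representative[OF assms(9,10)]) blast
  have "\<forall>\<epsilon>\<in>params. \<exists>v. v (fst (p0 \<epsilon>)) = snd (p0 \<epsilon>) \<and>
      (\<forall>s\<in>J. (v has_vector_derivative a \<epsilon> (s, v s)) (at s within J))"
  proof
    fix \<epsilon> :: real assume \<epsilon>: "\<epsilon> \<in> params"
    have sm: "smooth_on (J \<times> UNIV) (a \<epsilon>)" using a_mod \<epsilon> by (simp add: moderate_nets_def)
    have t0: "fst (p0 \<epsilon>) \<in> J" using K0(2) K0(3)[OF \<epsilon>] by auto
    show "\<exists>v. v (fst (p0 \<epsilon>)) = snd (p0 \<epsilon>) \<and>
        (\<forall>s\<in>J. (v has_vector_derivative a \<epsilon> (s, v s)) (at s within J))"
    proof (rule global_solution_exists[OF sm N bound[OF \<epsilon>] \<beta> nonneg t0])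
      fix v assume "v (fst (p0 \<epsilon>)) = snd (p0 \<epsilon>)"
        "\<And>s. s \<in> J \<Longrightarrow> (v has_vector_derivative a \<epsilon> (s, v s)) (at s within J)"
      then show ?thesis by blast
    qed
  qed
  from bchoice[OF this] obtain u where
    u: "\<forall>\<epsilon>\<in>params. u \<epsilon> (fst (p0 \<epsilon>)) = snd (p0 \<epsilon>) \<and>
      (\<forall>s\<in>J. (u \<epsilon> has_vector_derivative a \<epsilon> (s, u \<epsilon> s)) (at s within J))" ..
  then have init: "\<And>\<epsilon>. \<epsilon> \<in> params \<Longrightarrow> u \<epsilon> (fst (p0 \<epsilon>)) = snd (p0 \<epsilon>)"
    and solves: "\<And>\<epsilon> s. \<lbrakk>\<epsilon> \<in> params; s \<in> J\<rbrakk> \<Longrightarrow>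
      (u \<epsilon> has_vector_derivative a \<epsilon> (s, u \<epsilon> s)) (at s within J)"
    by blast+
  have increment: "norm (u \<epsilon> s - u \<epsilon> r) \<le> \<bar>integral {c..s} \<beta> - integral {c..r} \<beta>\<bar>"
    if "\<epsilon> \<in> params" "c \<in> J" "d \<in> J" "r \<in> {c..d}" "s \<in> {c..d}" for \<epsilon> c d r s
    by (rule increment_le_antiderivative[OF solves[OF that(1)] N bound[OF that(1)] \<beta> that(2-5)])
  have B_cont: "continuous_on {c..d} (\<lambda>s. integral {c..s} \<beta>)" if "c \<in> J" "d \<in> J" for c d
  proof -
    have "\<beta> integrable_on {c..d}"
      using \<beta> atLeastAtMost_subset[OF that]
      unfolding locally_integrable_on_def absolutely_integrable_on_def by blast
    then show ?thesis by (rule indefinite_integral_continuous_1)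
  qed
  have bounded: "\<exists>R. \<forall>\<epsilon>\<in>params. \<forall>s\<in>K. norm (u \<epsilon> s) \<le> R" if K: "compact K" "K \<subseteq> J" for K
  proof -
    have "compact (K \<union> fst ` K0)" "K \<union> fst ` K0 \<subseteq> J"
      using K K0 by (auto intro!: compact_Un compact_continuous_image continuous_intros)
    then obtain c d where cd: "c \<in> J" "d \<in> J" "K \<union> fst ` K0 \<subseteq> {c..d}"
      by (rule compact_in_interval)
    have "bounded ((\<lambda>s. integral {c..s} \<beta>) ` {c..d})" "bounded (snd ` K0)"
      using K0(1) B_cont[OF cd(1,2)]
      by (auto intro!: compact_imp_bounded compact_continuous_image continuous_intros)
    then obtain M X where M: "\<And>s. s \<in> {c..d} \<Longrightarrow> \<bar>integral {c..s} \<beta>\<bar> \<le> M"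
      and X: "\<And>z. z \<in> K0 \<Longrightarrow> norm (snd z) \<le> X"
      unfolding bounded_iff by (metis image_eqI real_norm_def)
    show ?thesis
    proof (intro exI[of _ "X + 2 * M"] ballI)
      fix \<epsilon> s assume \<epsilon>: "\<epsilon> \<in> params" and s: "s \<in> K"
      have in_cd: "s \<in> {c..d}" "fst (p0 \<epsilon>) \<in> {c..d}" using s cd(3) K0(3)[OF \<epsilon>] by auto
      have "norm (u \<epsilon> s - snd (p0 \<epsilon>)) \<le> 2 * M"
        using increment[OF \<epsilon> cd(1,2) in_cd(2,1)] init[OF \<epsilon>] M[OF in_cd(1)] M[OF in_cd(2)] by auto
      then show "norm (u \<epsilon> s) \<le> X + 2 * M"
        using X[OF K0(3)[OF \<epsilon>]] norm_triangle_ineq2[of "u \<epsilon> s" "snd (p0 \<epsilon>)"] by linarith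
    qed
  qed
  interpret cauchy_net J A a u P p0 K0
    by unfold_locales (use assms(3,5,9) solves bounded p0 K0 init in blast)+
  define e where "e n = 1 / (real n + 1)" for n
  have e: "e n \<in> params" for n by (simp add: e_def)
  have e0: "e \<longlonglongrightarrow> 0"
    using LIMSEQ_inverse_real_of_nat unfolding e_def by (simp add: inverse_eq_divide add.commute)
  have "\<forall>n. p0 (e n) \<in> K0" using K0(3)[OF e] by blast
  with compact_imp_seq_compact[OF K0(1)] obtain z k where
    k: "strict_mono (k :: nat \<Rightarrow> nat)" "((\<lambda>n. p0 (e n)) \<circ> k) \<longlonglongrightarrow> z"
    unfolding seq_compact_def by metis
  obtain k' \<zeta> where k': "strict_mono (k' :: nat \<Rightarrow> nat)"
    "\<And>K. compact K \<Longrightarrow> K \<subseteq> J \<Longrightarrow> uniform_limit K (\<lambda>n. u (e (k (k' n)))) \<zeta> sequentially"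
  proof (rule locally_uniform_subsequence[of "\<lambda>n. u (e (k n))"])
    fix c d assume cd: "c \<in> J" "d \<in> J"
    then show "\<exists>M. \<forall>n. \<forall>s\<in>{c..d}. norm (u (e (k n)) s) \<le> M"
      using bounded[OF compact_Icc atLeastAtMost_subset[OF cd]] e by blast
    show "\<exists>B. continuous_on {c..d} B \<and>
        (\<forall>n. \<forall>r\<in>{c..d}. \<forall>s\<in>{c..d}. norm (u (e (k n)) s - u (e (k n)) r) \<le> \<bar>B s - B r\<bar>)"
      using B_cont[OF cd] increment[OF e cd] by (intro exI[of _ "\<lambda>s. integral {c..s} \<beta>"]) blast
  qed blast
  \<comment> \<open>Along \<open>k\<close> the initial points converge, along the further subsequence \<open>k'\<close> also the solutions.\<close>
  define e' where "e' n = e (k (k' n))" for n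
  have e': "\<And>n. e' n \<in> params" by (simp add: e'_def e del: greaterThanAtMost_iff)
  have e'0: "e' \<longlonglongrightarrow> 0"
    using LIMSEQ_subseq_LIMSEQ[OF LIMSEQ_subseq_LIMSEQ[OF e0 k(1)] k'(1)] by (simp add: e'_def[abs_def] o_def)
  have p0_lim: "(\<lambda>n. p0 (e' n)) \<longlonglongrightarrow> (fst z, snd z)"
    using LIMSEQ_subseq_LIMSEQ[OF k(2) k'(1)] by (simp add: e'_def o_def)
  note lim = e' e'0 p0_lim k'(2)[folded e'_def]
  show ?thesis
  proof (intro bexI[OF _ class_is_c_bounded] conjI exI[of _ "fst z"] exI[of _ "snd z"] exI[of _ \<zeta>]
      ballI allI impI)
    show "fst z \<in> closure J" using limit_time[of e', OF lim] closure_subset by blast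
  qed (use differential_equation initial_condition subnet_convergence[of e', OF lim]
      limit_absolutely_continuous[of e', OF lim] limit_integral[of e', OF lim] in blast)+
qed

end
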